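(* Let $G$ be of type $C_n$, $\mathbf{i}_0=(1\,2\cdots n)^n$ and $c=(c^{(m)}_i)_{1\le i,m\le n}\in(\mathbb{C}^\times)^{n^2}$. Let $m^{(k)}_i:B(\Lambda_i)\hookrightarrow\mathcal{Y}(p_0)$ be the embedding of crystals sending the highest weight element $u_{\Lambda_i}$ to the monomial $c^{(k)}_i$. Then $$\Delta_{w_0\Lambda_n,s_n\Lambda_n}(\Theta^-_{\mathbf{i}_0}(c))=m^{(n)}_n(u_{\Lambda_n})=c^{(n)}_n,$$ and for $k=1,2,\dots,n-1$, $$\Delta_{w_0\Lambda_k,s_k\Lambda_k}(\Theta^-_{\mathbf{i}_0}(c))=\sum_{j=1}^n m^{(k)}_1(v_j)+\sum_{j=k+1}^n m^{(k)}_1(v_{\overline{j}}),$$ $$\Delta_{w_0s_k\Lambda_k,\Lambda_k}(\Theta^-_{\mathbf{i}_0}(c))=\sum_{j=1}^k m^{(k-n)}_1(v_{\overline{j}}).$$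
   Context: Group side. $G$ is the simply connected simple algebraic group over $\mathbb{C}$ of type $C_n$ ($n\ge2$), $I=\{1,\dots,n\}$, with Chevalley generators $e_i,f_i,h_i$, simple roots $\alpha_i$, fundamental weights $\Lambda_i$, Cartan matrix $a_{ij}=\alpha_j(h_i)$: $a_{ii}=2$, $a_{n-1,n}=-2$, $a_{ij}=-1$ for other $|i-j|=1$, $0$ otherwise. $T$ is the maximal torus, $U^{\pm}$ the unipotent subgroups generated by $x_i(t)=\exp(te_i)$, resp. $y_i(t)=\exp(tf_i)$; $\alpha_i^\vee$ is the coroot one-parameter subgroup; $s_i$ are the simple reflections, $w_0$ the longest Weyl group element. $\overline{s}_i=x_i(-1)y_i(1)x_i(-1)$ and $\overline{w}=\overline{s}_{i_1}\cdots\overline{s}_{i_l}$ for any reduced expression $w=s_{i_1}\cdots s_{i_l}$. $\Delta_{\Lambda_i}$ is the regular function on $G$ with $\Delta_{\Lambda_i}(u^-tu^+)=\Lambda_i(t)$ ($u^\pm\in U^\pm$, $t\in T$), and $\Delta_{u\Lambda_i,v\Lambda_i}(g)=\Delta_{\Lambda_i}(\overline{u}^{-1}g\,\overline{v})$ for Weyl group elements $u,v$. With $\mathbf{y}_i(c)=y_i(c)\alpha_i^\vee(c^{-1})$, $\Theta^-_{\mathbf{i}_0}(c)=\prod_{m=1}^{n}\mathbf{y}_1(c^{(m)}_1)\cdots\mathbf{y}_n(c^{(m)}_n)$ (factors for $m=1,\dots,n$ from left to right). Monomial crystals. $\mathcal{Y}$ is the set of Laurent monomials $Y=\prod_{m\in\mathbb{Z},i\in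 I}(c^{(m)}_i)^{l_{m,i}}$ in variables $c_i^{(m)}$, with only finitely many $l_{m,i}\in\mathbb{Z}$ nonzero. For a sign $p=(p_{i,j})_{i\ne j}$ (integers with $p_{i,j}+p_{j,i}=1$) put $A_{m,i}=c^{(m)}_ic^{(m+1)}_i\prod_{j\ne i}(c^{(m+p_{j,i})}_j)^{a_{j,i}}$. The crystal $\mathcal{Y}(p)$ is $\mathcal{Y}$ with $\mathrm{wt}(Y)=\sum l_{m,i}\Lambda_i$, $\varphi_i(Y)=\max_m\sum_{k\le m}l_{k,i}$, $\varepsilon_i(Y)=\varphi_i(Y)-\langle h_i,\mathrm{wt}(Y)\rangle$, $\tilde f_iY=A_{n_f,i}^{-1}Y$ if $\varphi_i(Y)>0$ and $0$ otherwise, $\tilde e_iY=A_{n_e,i}Y$ if $\varepsilon_i(Y)>0$ and $0$ otherwise, where $n_f=\min\{n:\varphi_i(Y)=\sum_{k\le n}l_{k,i}\}$, $n_e=\max\{n:\varphi_i(Y)=\sum_{k\le n}l_{k,i}\}$. Known: the connected component of a monomial $Y$ with all $\varepsilon_i(Y)=0$ is isomorphic to the crystal $B(\mathrm{wt}(Y))$ of the irreducible highest weight module. Here $p_0$ is the sign with $p_{i,j}=1$ if $i<j$ and $p_{i,j}=0$ if $i>j$. The crystal $B(\Lambda_1)=\{v_i,v_{\overline{i}}\mid1\le i\le n\}$ has $u_{\Lambda_1}=v_1$ and arrows $\tilde f_iv_i=v_{i+1}$, $\tilde f_iv_{\overline{i+1}}=v_{\overline{i}}$ ($1\le i<n$),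 $\tilde f_nv_n=v_{\overline{n}}$ (all other $\tilde f_i$ are $0$). Explicitly, with $c_0^{(m)}=1$, $m^{(k)}_1(v_j)=c^{(k)}_j/c^{(k+1)}_{j-1}$ and $m^{(k)}_1(v_{\overline{j}})=c^{(k+n-j+1)}_{j-1}/c^{(k+n-j+1)}_{j}$. Monomials are evaluated at the given $c$. *)

theory Defs
  imports
    Complex_Main
    "HOL-Algebra.Generated_Groups"
    "HOL-Library.Poly_Mapping"
    "Jordan_Normal_Form.Matrix"
begin

section \<open>The root datum and the Weyl group of type \<open>C\<^sub>n\<close>\<close>

text \<open>\<open>cartan n i j = a\<^sub>i\<^sub>j = \<alpha>\<^sub>j(h\<^sub>i)\<close>; the index set is \<open>I = {1..n}\<close>.\<close>

definition cartan :: "nat \<Rightarrow> nat \<Rightarrow> nat \<Rightarrow> int" where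
  "cartan n i j =
     (if i \<notin> {1..n} \<or> j \<notin> {1..n} then 0
      else if i = j then 2
      else if i = n - 1 \<and> j = n then -2
      else if i = Suc j \<or> j = Suc i then -1
      else 0)"

text \<open>
  A weight \<open>\<lambda>\<close> is represented by its coordinates \<open>\<lambda> i = \<langle>h\<^sub>i, \<lambda>\<rangle>\<close> with respect to the fundamental
  weights, so \<open>\<alpha>\<^sub>i\<close> has coordinates \<open>a\<^sub>j\<^sub>i\<close>, and \<open>s\<^sub>i \<lambda> = \<lambda> - \<langle>h\<^sub>i, \<lambda>\<rangle> \<alpha>\<^sub>i\<close>.
\<close>

definition srefl :: "nat \<Rightarrow> nat \<Rightarrow> (nat \<Rightarrow> int) \<Rightarrow> (nat \<Rightarrow> int)" where
  "srefl n i l = (\<lambda>j. l j - l i * cartan n j i)"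

definition word_refl :: "nat \<Rightarrow> nat list \<Rightarrow> (nat \<Rightarrow> int) \<Rightarrow> (nat \<Rightarrow> int)" where
  "word_refl n ws = foldr (\<lambda>i w. srefl n i \<circ> w) ws id"

definition weyl :: "nat \<Rightarrow> ((nat \<Rightarrow> int) \<Rightarrow> (nat \<Rightarrow> int)) set" where
  "weyl n = word_refl n ` lists {1..n}"

definition weyl_length :: "nat \<Rightarrow> ((nat \<Rightarrow> int) \<Rightarrow> (nat \<Rightarrow> int)) \<Rightarrow> nat" where
  "weyl_length n w = (LEAST l. \<exists>ws \<in> lists {1..n}. word_refl n ws = w \<and> length ws = l)"

definition reduced_words :: "nat \<Rightarrow> ((nat \<Rightarrow> int) \<Rightarrow> (nat \<Rightarrow> int)) \<Rightarrow> nat list set" where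
  "reduced_words n w =
     {ws \<in> lists {1..n}. word_refl n ws = w \<and> length ws = weyl_length n w}"

definition longest :: "nat \<Rightarrow> (nat \<Rightarrow> int) \<Rightarrow> (nat \<Rightarrow> int)" where
  "longest n = (THE w. w \<in> weyl n \<and> (\<forall>v \<in> weyl n. weyl_length n v \<le> weyl_length n w))"

section \<open>The group \<open>Sp\<^sub>2\<^sub>n(\<complex>)\<close> and its Chevalley generators\<close>

text \<open>
  The simply connected simple group of type \<open>C\<^sub>n\<close> is realised as \<open>Sp\<^sub>2\<^sub>n(\<complex>)\<close>, acting on the
  vector representation with the ordered basis \<open>v\<^sub>1, \<dots>, v\<^sub>n, vbar\<^sub>n, \<dots>, vbar\<^sub>1\<close>. Matrix indices
  start at 0: \<open>v\<^sub>i\<close> has index \<open>i - 1\<close> and \<open>vbar\<^sub>i\<close> has index \<open>2 * n - i\<close>. On this basis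
  \<open>f\<^sub>i v\<^sub>i = v\<^sub>i\<^sub>+\<^sub>1\<close>, \<open>f\<^sub>i vbar\<^sub>i\<^sub>+\<^sub>1 = vbar\<^sub>i\<close> for \<open>i < n\<close> and \<open>f\<^sub>n v\<^sub>n = vbar\<^sub>n\<close>, with
  \<open>e\<^sub>i\<close> the transpose of \<open>f\<^sub>i\<close>; the alternating signs are in the symplectic form.
\<close>

definition symp_form :: "nat \<Rightarrow> complex mat" where
  "symp_form n = mat (2 * n) (2 * n) (\<lambda>(p, q). if p + q = 2 * n - 1 then (-1) ^ p else 0)"

definition Sp :: "nat \<Rightarrow> complex mat monoid" where
  "Sp n = \<lparr>carrier = {g \<in> carrier_mat (2 * n) (2 * n). g\<^sup>T * symp_form n * g = symp_form n},
           monoid.mult = (*), one = 1\<^sub>m (2 * n)\<rparr>"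

text \<open>For \<open>i = n\<close> the two positions listed below coincide.\<close>

definition chev_e :: "nat \<Rightarrow> nat \<Rightarrow> complex mat" where
  "chev_e n i = mat (2 * n) (2 * n)
     (\<lambda>(p, q). if (p, q) \<in> {(i - 1, i), (2 * n - i - 1, 2 * n - i)} then 1 else 0)"

definition chev_f :: "nat \<Rightarrow> nat \<Rightarrow> complex mat" where
  "chev_f n i = mat (2 * n) (2 * n)
     (\<lambda>(p, q). if (p, q) \<in> {(i, i - 1), (2 * n - i, 2 * n - i - 1)} then 1 else 0)"

text \<open>The diagonal entries of \<open>h\<^sub>i = [e\<^sub>i, f\<^sub>i]\<close>.\<close>

definition chev_h :: "nat \<Rightarrow> nat \<Rightarrow> nat \<Rightarrow> int" where
  "chev_h n i p = (if p \<in> {i - 1, 2 * n - i - 1} then 1 else if p \<in> {i, 2 * n - i} then -1 else 0)"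

definition mat_exp :: "complex mat \<Rightarrow> complex mat" where
  "mat_exp A = mat (dim_row A) (dim_row A)
     (\<lambda>(p, q). suminf (\<lambda>k. (A ^\<^sub>m k) $$ (p, q) / fact k))"

definition x_sub :: "nat \<Rightarrow> nat \<Rightarrow> complex \<Rightarrow> complex mat" where
  "x_sub n i t = mat_exp (t \<cdot>\<^sub>m chev_e n i)"

definition y_sub :: "nat \<Rightarrow> nat \<Rightarrow> complex \<Rightarrow> complex mat" where
  "y_sub n i t = mat_exp (t \<cdot>\<^sub>m chev_f n i)"

definition coroot :: "nat \<Rightarrow> nat \<Rightarrow> complex \<Rightarrow> complex mat" where
  "coroot n i a = mat (2 * n) (2 * n) (\<lambda>(p, q). if p = q then a powi chev_h n i p else 0)"

definition U_plus :: "nat \<Rightarrow> complex mat set" where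
  "U_plus n = generate (Sp n) {x_sub n i t |i t. i \<in> {1..n}}"

definition U_minus :: "nat \<Rightarrow> complex mat set" where
  "U_minus n = generate (Sp n) {y_sub n i t |i t. i \<in> {1..n}}"

definition torus :: "nat \<Rightarrow> complex mat set" where
  "torus n = {t \<in> carrier (Sp n). diagonal_mat t}"

text \<open>The character \<open>\<Lambda>\<^sub>i = \<epsilon>\<^sub>1 + \<dots> + \<epsilon>\<^sub>i\<close> of the torus; see \<open>fund_char_coroot\<close> below.\<close>

definition fund_char :: "nat \<Rightarrow> complex mat \<Rightarrow> complex" where
  "fund_char i t = (\<Prod>p<i. t $$ (p, p))"

section \<open>Generalized minors\<close>

definition mat_list_prod :: "nat \<Rightarrow> complex mat list \<Rightarrow> complex mat" where
  "mat_list_prod n gs = foldr (*) gs (1\<^sub>m (2 * n))"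

definition sbar :: "nat \<Rightarrow> nat \<Rightarrow> complex mat" where
  "sbar n i = x_sub n i (-1) * y_sub n i 1 * x_sub n i (-1)"

text \<open>By the braid relations, the result does not depend on the choice of the reduced word.\<close>

definition weyl_lift :: "nat \<Rightarrow> ((nat \<Rightarrow> int) \<Rightarrow> (nat \<Rightarrow> int)) \<Rightarrow> complex mat" where
  "weyl_lift n w = mat_list_prod n (map (sbar n) (SOME ws. ws \<in> reduced_words n w))"

text \<open>
  As \<open>Sp n\<close> is Zariski closed in the space of all \<open>2n \<times> 2n\<close> matrices, its regular functions are
  the restrictions of polynomials in the matrix entries.
\<close>

inductive_set entry_polys :: "nat \<Rightarrow> (complex mat \<Rightarrow> complex) set" for n :: nat where
  const: "(\<lambda>g. a) \<in> entry_polys n"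
| entry: "p < 2 * n \<Longrightarrow> q < 2 * n \<Longrightarrow> (\<lambda>g. g $$ (p, q)) \<in> entry_polys n"
| add: "P \<in> entry_polys n \<Longrightarrow> Q \<in> entry_polys n \<Longrightarrow> (\<lambda>g. P g + Q g) \<in> entry_polys n"
| mult: "P \<in> entry_polys n \<Longrightarrow> Q \<in> entry_polys n \<Longrightarrow> (\<lambda>g. P g * Q g) \<in> entry_polys n"

definition regular_fun :: "nat \<Rightarrow> (complex mat \<Rightarrow> complex) \<Rightarrow> bool" where
  "regular_fun n F \<longleftrightarrow> (\<exists>P \<in> entry_polys n. \<forall>g \<in> carrier (Sp n). F g = P g)"

text \<open>
  The defining property determines the values on \<open>Sp n\<close> (the only ones that are used), because
  \<open>U\<^sup>- T U\<^sup>+\<close> is dense there.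
\<close>

definition princ_minor :: "nat \<Rightarrow> nat \<Rightarrow> complex mat \<Rightarrow> complex" where
  "princ_minor n i = (SOME F. regular_fun n F \<and>
     (\<forall>u \<in> U_minus n. \<forall>t \<in> torus n. \<forall>u' \<in> U_plus n. F (u * t * u') = fund_char i t))"

text \<open>\<open>gen_minor n i u v\<close> is \<open>\<Delta>\<close> with subscripts \<open>u\<Lambda>\<^sub>i, v\<Lambda>\<^sub>i\<close>.\<close>

definition gen_minor ::
  "nat \<Rightarrow> nat \<Rightarrow> ((nat \<Rightarrow> int) \<Rightarrow> (nat \<Rightarrow> int)) \<Rightarrow> ((nat \<Rightarrow> int) \<Rightarrow> (nat \<Rightarrow> int))
    \<Rightarrow> complex mat \<Rightarrow> complex" where
  "gen_minor n i u v g =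
     princ_minor n i (inv\<^bsub>Sp n\<^esub> (weyl_lift n u) * g * weyl_lift n v)"

definition Y_sub :: "nat \<Rightarrow> nat \<Rightarrow> complex \<Rightarrow> complex mat" where
  "Y_sub n i a = y_sub n i a * coroot n i (inverse a)"

text \<open>The coordinate \<open>c\<^sub>i\<^sup>(\<^sup>m\<^sup>)\<close> is \<open>c m i\<close>.\<close>

definition Theta :: "nat \<Rightarrow> (int \<Rightarrow> nat \<Rightarrow> complex) \<Rightarrow> complex mat" where
  "Theta n c = mat_list_prod n
     (concat (map (\<lambda>m. map (\<lambda>i. Y_sub n i (c (int m) i)) [1..<Suc n]) [1..<Suc n]))"

section \<open>Crystals\<close>

text \<open>
  The weight of \<open>b\<close> is given by its coordinates \<open>wt B b i = \<langle>h\<^sub>i, wt(b)\<rangle>\<close>, which are meaningful for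
  \<open>i\<close> in the index set only. The value \<open>None\<close> of a Kashiwara operator stands for \<open>0\<close>.
\<close>

record 'b crystal = "'b partial_object" +
  wt :: "'b \<Rightarrow> nat \<Rightarrow> int"
  eps :: "nat \<Rightarrow> 'b \<Rightarrow> int"
  phi :: "nat \<Rightarrow> 'b \<Rightarrow> int"
  e_op :: "nat \<Rightarrow> 'b \<Rightarrow> 'b option"
  f_op :: "nat \<Rightarrow> 'b \<Rightarrow> 'b option"

definition crystal_embedding ::
  "nat \<Rightarrow> ('a, 'x) crystal_scheme \<Rightarrow> ('b, 'y) crystal_scheme \<Rightarrow> ('a \<Rightarrow> 'b) \<Rightarrow> bool" where
  "crystal_embedding n B C \<psi> \<longleftrightarrow>
     \<psi> \<in> carrier B \<rightarrow> carrier C \<and> inj_on \<psi> (carrier B) \<and>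
     (\<forall>b \<in> carrier B. \<forall>i \<in> {1..n}.
        wt C (\<psi> b) i = wt B b i \<and> eps C i (\<psi> b) = eps B i b \<and> phi C i (\<psi> b) = phi B i b \<and>
        e_op C i (\<psi> b) = map_option \<psi> (e_op B i b) \<and>
        f_op C i (\<psi> b) = map_option \<psi> (f_op B i b))"

definition component :: "nat \<Rightarrow> ('b, 'x) crystal_scheme \<Rightarrow> 'b \<Rightarrow> 'b set" where
  "component n C b =
     {(x, y). \<exists>i \<in> {1..n}. f_op C i x = Some y \<or> e_op C i x = Some y}\<^sup>* `` {b}"

subsection \<open>Monomial crystals\<close>

text \<open>Laurent monomials are written additively, as finitely supported exponent families.\<close>

type_synonym monomial = "(int \<times> nat) \<Rightarrow>\<^sub>0 int"

definition monomials :: "nat \<Rightarrow> monomial set" where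
  "monomials n = {Y. Poly_Mapping.keys Y \<subseteq> UNIV \<times> {1..n}}"

definition mon_eval :: "(int \<Rightarrow> nat \<Rightarrow> complex) \<Rightarrow> monomial \<Rightarrow> complex" where
  "mon_eval c Y = (\<Prod>(m, i) \<in> Poly_Mapping.keys Y. c m i powi Poly_Mapping.lookup Y (m, i))"

definition cvar :: "int \<Rightarrow> nat \<Rightarrow> monomial" where
  "cvar m i = Poly_Mapping.single (m, i) 1"

definition A_mon :: "nat \<Rightarrow> (nat \<Rightarrow> nat \<Rightarrow> int) \<Rightarrow> int \<Rightarrow> nat \<Rightarrow> monomial" where
  "A_mon n p m i = cvar m i + cvar (m + 1) i +
     (\<Sum>j \<in> {1..n} - {i}. Poly_Mapping.single (m + p j i, j) (cartan n j i))"

definition mon_wt :: "monomial \<Rightarrow> nat \<Rightarrow> int" where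
  "mon_wt Y i = (\<Sum>(k, j) \<in> {x \<in> Poly_Mapping.keys Y. snd x = i}. Poly_Mapping.lookup Y (k, j))"

definition partial_exp :: "monomial \<Rightarrow> nat \<Rightarrow> int \<Rightarrow> int" where
  "partial_exp Y i m =
     (\<Sum>(k, j) \<in> {x \<in> Poly_Mapping.keys Y. snd x = i \<and> fst x \<le> m}. Poly_Mapping.lookup Y (k, j))"

definition mon_phi :: "nat \<Rightarrow> monomial \<Rightarrow> int" where
  "mon_phi i Y = Max (range (partial_exp Y i))"

definition mon_eps :: "nat \<Rightarrow> monomial \<Rightarrow> int" where
  "mon_eps i Y = mon_phi i Y - mon_wt Y i"

definition mon_f :: "nat \<Rightarrow> (nat \<Rightarrow> nat \<Rightarrow> int) \<Rightarrow> nat \<Rightarrow> monomial \<Rightarrow> monomial option" where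
  "mon_f n p i Y =
     (if mon_phi i Y > 0 then Some (Y - A_mon n p (LEAST m. mon_phi i Y = partial_exp Y i m) i)
      else None)"

definition mon_e :: "nat \<Rightarrow> (nat \<Rightarrow> nat \<Rightarrow> int) \<Rightarrow> nat \<Rightarrow> monomial \<Rightarrow> monomial option" where
  "mon_e n p i Y =
     (if mon_eps i Y > 0 then Some (Y + A_mon n p (GREATEST m. mon_phi i Y = partial_exp Y i m) i)
      else None)"

definition mon_crystal :: "nat \<Rightarrow> (nat \<Rightarrow> nat \<Rightarrow> int) \<Rightarrow> monomial crystal" where
  "mon_crystal n p =
     \<lparr>carrier = monomials n, wt = mon_wt, eps = mon_eps, phi = mon_phi,
      e_op = mon_e n p, f_op = mon_f n p\<rparr>"

definition p0 :: "nat \<Rightarrow> nat \<Rightarrow> int" where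
  "p0 i j = (if i < j then 1 else 0)"

subsection \<open>The crystals \<open>B(\<Lambda>\<^sub>i)\<close>\<close>

text \<open>
  \<open>B(\<Lambda>\<^sub>1)\<close> consists of the letters \<open>V j\<close> and \<open>VB j\<close> (barred) for \<open>j \<in> {1..n}\<close>; \<open>V j\<close> has weight
  \<open>\<Lambda>\<^sub>j - \<Lambda>\<^sub>j\<^sub>-\<^sub>1\<close>, where \<open>\<Lambda>\<^sub>0 = 0\<close>, and all strings have length at most 1.
\<close>

datatype letter = V nat | VB nat

fun letter_f :: "nat \<Rightarrow> nat \<Rightarrow> letter \<Rightarrow> letter option" where
  "letter_f n i (V j) = (if j = i then Some (if i < n then V (Suc i) else VB n) else None)"
| "letter_f n i (VB j) = (if j = Suc i \<and> i < n then Some (VB i) else None)"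

fun letter_e :: "nat \<Rightarrow> nat \<Rightarrow> letter \<Rightarrow> letter option" where
  "letter_e n i (V j) = (if j = Suc i \<and> i < n then Some (V i) else None)"
| "letter_e n i (VB j) = (if j = i then Some (if i < n then VB (Suc i) else V n) else None)"

fun letter_wt :: "letter \<Rightarrow> nat \<Rightarrow> int" where
  "letter_wt (V j) i = of_bool (i = j) - of_bool (Suc i = j)"
| "letter_wt (VB j) i = of_bool (Suc i = j) - of_bool (i = j)"

definition letter_eps :: "nat \<Rightarrow> nat \<Rightarrow> letter \<Rightarrow> int" where
  "letter_eps n i x = of_bool (letter_e n i x \<noteq> None)"

definition letter_phi :: "nat \<Rightarrow> nat \<Rightarrow> letter \<Rightarrow> int" where
  "letter_phi n i x = of_bool (letter_f n i x \<noteq> None)"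

text \<open>
  The word \<open>[x\<^sub>1, \<dots>, x\<^sub>r]\<close> stands for the element \<open>x\<^sub>1 \<otimes> \<dots> \<otimes> x\<^sub>r\<close> of the \<open>r\<close>-fold tensor power of
  \<open>B(\<Lambda>\<^sub>1)\<close>. The tensor product rule is Kashiwara's: \<open>f\<^sub>i (b\<^sub>1 \<otimes> b\<^sub>2)\<close> is \<open>f\<^sub>i b\<^sub>1 \<otimes> b\<^sub>2\<close> if
  \<open>\<phi>\<^sub>i(b\<^sub>1) > \<epsilon>\<^sub>i(b\<^sub>2)\<close> and \<open>b\<^sub>1 \<otimes> f\<^sub>i b\<^sub>2\<close> otherwise; \<open>e\<^sub>i (b\<^sub>1 \<otimes> b\<^sub>2)\<close> is \<open>e\<^sub>i b\<^sub>1 \<otimes> b\<^sub>2\<close> if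
  \<open>\<phi>\<^sub>i(b\<^sub>1) \<ge> \<epsilon>\<^sub>i(b\<^sub>2)\<close> and \<open>b\<^sub>1 \<otimes> e\<^sub>i b\<^sub>2\<close> otherwise.
\<close>

fun word_wt :: "letter list \<Rightarrow> nat \<Rightarrow> int" where
  "word_wt [] i = 0"
| "word_wt (x # xs) i = letter_wt x i + word_wt xs i"

fun word_eps :: "nat \<Rightarrow> nat \<Rightarrow> letter list \<Rightarrow> int" where
  "word_eps n i [] = 0"
| "word_eps n i (x # xs) = max (letter_eps n i x) (word_eps n i xs - letter_wt x i)"

fun word_phi :: "nat \<Rightarrow> nat \<Rightarrow> letter list \<Rightarrow> int" where
  "word_phi n i [] = 0"
| "word_phi n i (x # xs) = max (word_phi n i xs) (letter_phi n i x + word_wt xs i)"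

fun word_f :: "nat \<Rightarrow> nat \<Rightarrow> letter list \<Rightarrow> letter list option" where
  "word_f n i [] = None"
| "word_f n i (x # xs) =
     (if letter_phi n i x > word_eps n i xs then map_option (\<lambda>y. y # xs) (letter_f n i x)
      else map_option ((#) x) (word_f n i xs))"

fun word_e :: "nat \<Rightarrow> nat \<Rightarrow> letter list \<Rightarrow> letter list option" where
  "word_e n i [] = None"
| "word_e n i (x # xs) =
     (if letter_phi n i x \<ge> word_eps n i xs then map_option (\<lambda>y. y # xs) (letter_e n i x)
      else map_option ((#) x) (word_e n i xs))"

definition word_crystal :: "nat \<Rightarrow> letter list crystal" where
  "word_crystal n =
     \<lparr>carrier = lists (V ` {1..n} \<union> VB ` {1..n}), wt = word_wt, eps = word_eps n, phi = word_phi n,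
      e_op = word_e n, f_op = word_f n\<rparr>"

text \<open>
  Kashiwara and Nakashima: \<open>B(\<Lambda>\<^sub>i)\<close> is the connected component of \<open>v\<^sub>1 \<otimes> \<dots> \<otimes> v\<^sub>i\<close>. For \<open>i = 1\<close> it
  consists of the one-letter words and is \<open>B(\<Lambda>\<^sub>1)\<close> itself.
\<close>

definition hw :: "nat \<Rightarrow> letter list" where
  "hw i = map V [1..<Suc i]"

definition B_fund :: "nat \<Rightarrow> nat \<Rightarrow> letter list crystal" where
  "B_fund n i = word_crystal n \<lparr>carrier := component n (word_crystal n) (hw i)\<rparr>"

abbreviation v_el :: "nat \<Rightarrow> letter list" where
  "v_el j \<equiv> [V j]"

abbreviation vbar_el :: "nat \<Rightarrow> letter list" where
  "vbar_el j \<equiv> [VB j]"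

section \<open>Consistency checks\<close>

lemma fund_char_coroot:
  assumes "i \<in> {1..n}" "j \<in> {1..n}" "a \<noteq> 0"
  shows "fund_char i (coroot n j a) = (if i = j then a else 1)"
proof -
  have *: "(\<Prod>p<l. coroot n j a $$ (p, p)) = (if l = j then a else 1)" if "l \<le> n" for l
    using that
  proof (induction l)
    case 0
    then show ?case using assms by simp
  next
    case (Suc l)
    then have "coroot n j a $$ (l, l) = a powi chev_h n j l"
      by (simp add: coroot_def)
    with Suc show ?case
      using assms by (auto simp: chev_h_def power_int_minus split: if_splits)
  qed
  show ?thesis
    unfolding fund_char_def using * assms by simp
qed

lemma chev_root_cartan:
  assumes "i \<in> {1..n}" "j \<in> {1..n}" "p < 2 * n" "q < 2 * n"
  shows "chev_e n j $$ (p, q) \<noteq> 0 \<Longrightarrow> chev_h n i p - chev_h n i q = cartan n i j"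
    and "chev_f n j $$ (p, q) \<noteq> 0 \<Longrightarrow> chev_h n i p - chev_h n i q = - cartan n i j"
proof -
  have pos:
    "j - 1 \<in> {i - 1, 2 * n - i - 1} \<longleftrightarrow> i = j"
    "j - 1 \<in> {i, 2 * n - i} \<longleftrightarrow> j = Suc i"
    "j \<in> {i - 1, 2 * n - i - 1} \<longleftrightarrow> i = Suc j \<or> (j = n \<and> i = n - 1)"
    "j \<in> {i, 2 * n - i} \<longleftrightarrow> i = j"
    "2 * n - j - 1 \<in> {i - 1, 2 * n - i - 1} \<longleftrightarrow> i = j"
    "2 * n - j - 1 \<in> {i, 2 * n - i} \<longleftrightarrow> i = Suc j \<or> (j = n \<and> i = n - 1)"
    "2 * n - j \<in> {i - 1, 2 * n - i - 1} \<longleftrightarrow> j = Suc i"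
    "2 * n - j \<in> {i, 2 * n - i} \<longleftrightarrow> i = j"
    using assms(1,2) by auto
  have *: "chev_h n i (j - 1) - chev_h n i j = cartan n i j"
    "chev_h n i (2 * n - j - 1) - chev_h n i (2 * n - j) = cartan n i j"
    using assms(1,2) unfolding chev_h_def pos cartan_def by auto
  have e: "(p = j - 1 \<and> q = j) \<or> (p = 2 * n - j - 1 \<and> q = 2 * n - j)"
    if "chev_e n j $$ (p, q) \<noteq> 0"
    using that assms(3,4) unfolding chev_e_def by (auto split: if_splits)
  have f: "(q = j - 1 \<and> p = j) \<or> (q = 2 * n - j - 1 \<and> p = 2 * n - j)"
    if "chev_f n j $$ (p, q) \<noteq> 0"
    using that assms(3,4) unfolding chev_f_def by (auto split: if_splits)
  show "chev_h n i p - chev_h n i q = cartan n i j" if "chev_e n j $$ (p, q) \<noteq> 0"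
    using e[OF that] * by (elim disjE) simp_all
  show "chev_h n i p - chev_h n i q = - cartan n i j" if "chev_f n j $$ (p, q) \<noteq> 0"
    using f[OF that] * by (elim disjE) simp_all
qed

lemma one_letter_word:
  "word_wt [x] i = letter_wt x i"
  "word_f n i [x] = map_option (\<lambda>y. [y]) (letter_f n i x)"
  "word_e n i [x] = map_option (\<lambda>y. [y]) (letter_e n i x)"
  by (auto simp: letter_phi_def)

lemma one_letter_word_eps_phi:
  assumes "i \<in> {1..n}" "x \<in> V ` {1..n} \<union> VB ` {1..n}"
  shows "word_eps n i [x] = letter_eps n i x" "word_phi n i [x] = letter_phi n i x"
  using assms by (cases x; auto simp: letter_phi_def letter_eps_def)+

lemma carrier_B_fund_1:
  assumes "n \<ge> 1"
  shows "carrier (B_fund n 1) = (\<lambda>x. [x]) ` (V ` {1..n} \<union> VB ` {1..n})"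
proof -
  define R where "R = {(x, y). \<exists>i \<in> {1..n}. f_op (word_crystal n) i x = Some y \<or>
                                 e_op (word_crystal n) i x = Some y}"
  have car: "carrier (B_fund n 1) = R\<^sup>* `` {[V 1]}"
    by (simp add: B_fund_def component_def R_def hw_def)
  have R_iff: "([x], w) \<in> R \<longleftrightarrow> (\<exists>i \<in> {1..n}. \<exists>y. w = [y] \<and>
                 (letter_f n i x = Some y \<or> letter_e n i x = Some y))" for x w
    unfolding R_def word_crystal_def by (auto simp: letter_phi_def)
  have sub: "w \<in> (\<lambda>x. [x]) ` (V ` {1..n} \<union> VB ` {1..n})" if "([V 1], w) \<in> R\<^sup>*" for w
    using that
  proof (induction rule: rtrancl_induct)
    case base
    then show ?case using assms by auto
  next
    case (step y z)
    then obtain x where x: "y = [x]" "x \<in> V ` {1..n} \<union> VB ` {1..n}" by auto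
    with step.hyps(2) obtain i t where i: "i \<in> {1..n}" "z = [t]"
      "letter_f n i x = Some t \<or> letter_e n i x = Some t" using R_iff by auto
    have "t \<in> V ` {1..n} \<union> VB ` {1..n}"
      using x(2) i(1,3) by (cases x) (auto split: if_splits)
    then show ?case using i by auto
  qed
  have V: "([V 1], [V j]) \<in> R\<^sup>*" if "1 \<le> j" "j \<le> n" for j
    using that
  proof (induction j rule: dec_induct)
    case (step k)
    have "([V k], [V (Suc k)]) \<in> R" using step.prems step.hyps
      by (auto simp: R_iff intro!: bexI[of _ k])
    then show ?case using step by (auto intro: rtrancl_into_rtrancl)
  qed simp
  have VB: "([V 1], [VB j]) \<in> R\<^sup>*" if "j \<le> n" "1 \<le> j" for j
    using that
  proof (induction j rule: inc_induct)
    case base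
    have "([V n], [VB n]) \<in> R" using assms by (auto simp: R_iff intro!: bexI[of _ n])
    then show ?case using V[of n] assms by (auto intro: rtrancl_into_rtrancl)
  next
    case (step k)
    have "([VB (Suc k)], [VB k]) \<in> R" using step.prems step.hyps
      by (auto simp: R_iff intro!: bexI[of _ k])
    then show ?case using step by (auto intro: rtrancl_into_rtrancl)
  qed
  show ?thesis unfolding car using sub V VB by auto
qed

end

theory Submission
  imports Defs "Jordan_Normal_Form.Determinant"
begin

text \<open>
  On \<open>Sp\<^sub>2\<^sub>n\<close> the function \<open>\<Delta>\<^sub>\<Lambda>\<^sub>k\<close> is the leading principal \<open>k \<times> k\<close> minor, and the lift of a
  Weyl group element \<open>w\<close> is the signed permutation matrix of \<open>w\<close> whose sign in column \<open>q\<close> is the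
  parity of the number of \<open>r < q\<close> with \<open>w r > w q\<close>. Hence both generalized minors are minors of
  \<open>\<Theta>\<close> taken from rows near the bottom. Write \<open>\<Theta> = L\<^sub>1 \<cdots> L\<^sub>n\<close> with \<open>L\<^sub>m\<close> the product over one Coxeter
  word, and let \<open>Q\<^sub>j\<^sub>,\<^sub>m\<close> be the row of \<open>L\<^sub>m \<cdots> L\<^sub>n\<close> with label \<open>vbar\<^sub>j\<close>. The explicit rows of \<open>L\<^sub>m\<close> give
  \<open>Q\<^sub>j\<^sub>+\<^sub>1\<^sub>,\<^sub>m = (c\<^sub>j\<^sub>-\<^sub>1 / c\<^sub>j) Q\<^sub>j\<^sub>,\<^sub>m - Q\<^sub>j\<^sub>,\<^sub>m\<^sub>+\<^sub>1\<close> (with upper index \<open>m\<close> on \<open>c\<close>). Therefore the last \<open>n\<close> rows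
  of \<open>\<Theta>\<close>, with alternating signs, are a lower unitriangular matrix times the matrix with rows
  \<open>Q\<^sub>1\<^sub>,\<^sub>1, \<dots>, Q\<^sub>1\<^sub>,\<^sub>n\<close>, which is upper unitriangular. The first minor is the entry \<open>(k, k + 1)\<close> of the upper
  factor and the second one is, up to sign, the entry \<open>(k + 1, k)\<close> of the lower factor.
\<close>

section \<open>Rank-one blocks\<close>

text \<open>Both \<open>princ_minor\<close> and \<open>weyl_lift\<close> are defined by a choice.
  The first is pinned down by density of the big cell, proved only along words in the root
  subgroups, since every matrix at which a minor is evaluated is such a word. The second is pinned
  down by a formula for the entries that sees the permutation but not the word; reducedness enters
  there, as it makes every letter an ascent. The upper unitriangular factor arises because each
  Coxeter factor moves the first nonzero column of a row one place to the left. On the right, s_k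
  replaces the last selected column k by k + 1; on the left, w_0 s_k replaces the last selected row
  vbar_k by vbar_{k+1}. Each time one factor stays unitriangular and the other loses only its last
  diagonal 1, so the k x k determinant collapses to one entry. For k < n the first minor has 2n - k
  terms because the row vbar_1 of a tail is the row v_n of the next tail plus a combination of its n
  barred rows: these give n terms, the row v_n gives n - k. On the crystal side only the arrows from
  v_1 down to vbar_1 are followed.\<close>

definition sw :: "nat \<Rightarrow> nat \<Rightarrow> nat \<Rightarrow> nat" where
  "sw n i p = (if p = i - 1 then i else if p = i then i - 1
     else if p = 2 * n - i - 1 then 2 * n - i else if p = 2 * n - i then 2 * n - i - 1 else p)"

definition pick :: "nat \<Rightarrow> nat \<Rightarrow> 'a \<Rightarrow> 'a \<Rightarrow> 'a \<Rightarrow> nat \<Rightarrow> 'a" where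
  "pick n i x y z p = (if p = i - 1 \<or> p = 2 * n - i - 1 then x
     else if p = i \<or> p = 2 * n - i then y else z)"

text \<open>The image of the \<open>2 \<times> 2\<close> matrix with rows \<open>(a, b)\<close>, \<open>(c, d)\<close> in the \<open>i\<close>-th copy of \<open>SL\<^sub>2\<close>; for \<open>i = n\<close> its
  two diagonal blocks coincide.\<close>

definition blk :: "nat \<Rightarrow> nat \<Rightarrow> complex \<Rightarrow> complex \<Rightarrow> complex \<Rightarrow> complex \<Rightarrow> complex mat" where
  "blk n i a b c d = mat (2 * n) (2 * n)
     (\<lambda>(p, q). of_bool (q = p) * pick n i a d 1 p + of_bool (q = sw n i p) * pick n i b c 0 p)"

text \<open>With \<open>u = i - 1\<close> and \<open>v = 2 * n - i - 1\<close> all truncated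
  subtractions disappear. The swapped pairs are \<open>{u, Suc u}\<close> and
  \<open>{v, Suc v}\<close>: equal for i = n, disjoint and in this order otherwise.\<close>

lemma sw_index:
  assumes "i \<in> {1..n}"
  obtains u v where "i = Suc u" "2 * n = Suc (Suc (u + v))" "u = v \<or> Suc u < v"
    "i - 1 = u" "2 * n - i - 1 = v" "2 * n - i = Suc v"
proof (rule that)
  show "i = Suc (i - 1)" "2 * n = Suc (Suc (i - 1 + (2 * n - i - 1)))"
    "i - 1 = 2 * n - i - 1 \<or> Suc (i - 1) < 2 * n - i - 1" "2 * n - i = Suc (2 * n - i - 1)"
    using assms by (simp_all; arith)+
qed simp_all

lemma sw_less:
  assumes "i \<in> {1..n}" "p < 2 * n"
  shows "sw n i p < 2 * n"
proof -
  obtain u v where uv: "i = Suc u" "2 * n = Suc (Suc (u + v))" "u = v \<or> Suc u < v"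
    "i - 1 = u" "2 * n - i - 1 = v" "2 * n - i = Suc v" using assms sw_index by blast
  then show ?thesis
    unfolding sw_def uv(4-6) unfolding uv(1) uv(2) using assms(2)[unfolded uv(2)] by auto
qed

lemma sw_sw:
  assumes "i \<in> {1..n}"
  shows "sw n i (sw n i p) = p"
proof -
  obtain u v where uv: "i = Suc u" "2 * n = Suc (Suc (u + v))" "u = v \<or> Suc u < v"
    "i - 1 = u" "2 * n - i - 1 = v" "2 * n - i = Suc v" using assms sw_index by blast
  show ?thesis
    unfolding sw_def uv(4-6) unfolding uv(1) using uv(3) by auto
qed

lemma pick_sw:
  assumes "i \<in> {1..n}"
  shows "pick n i x y z (sw n i p) = pick n i y x z p"
proof -
  obtain u v where uv: "i = Suc u" "2 * n = Suc (Suc (u + v))" "u = v \<or> Suc u < v"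
    "i - 1 = u" "2 * n - i - 1 = v" "2 * n - i = Suc v" using assms sw_index by blast
  show ?thesis
    unfolding sw_def pick_def uv(4-6) unfolding uv(1) using uv(3) by auto
qed

lemma sw_mirror:
  assumes "i \<in> {1..n}" "p < 2 * n"
  shows "sw n i (2 * n - 1 - p) = 2 * n - 1 - sw n i p"
proof -
  obtain u v where uv: "i = Suc u" "2 * n = Suc (Suc (u + v))" "u = v \<or> Suc u < v"
    "i - 1 = u" "2 * n - i - 1 = v" "2 * n - i = Suc v" using assms sw_index by blast
  define m where "m = 2 * n - 1 - p"
  have m: "m + p = Suc (u + v)" using uv(2) assms(2) by (simp add: m_def)
  have "sw n i m + sw n i p = Suc (u + v)"
    unfolding sw_def uv(4-6) unfolding uv(1) using uv(3) m by (simp; linarith)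
  then show ?thesis unfolding m_def[symmetric] using uv(2) by linarith
qed

lemma pick_mirror:
  assumes "i \<in> {1..n}" "p < 2 * n"
  shows "pick n i x y z (2 * n - 1 - p) = pick n i y x z p"
proof -
  obtain u v where uv: "i = Suc u" "2 * n = Suc (Suc (u + v))" "u = v \<or> Suc u < v"
    "i - 1 = u" "2 * n - i - 1 = v" "2 * n - i = Suc v" using assms sw_index by blast
  define m where "m = 2 * n - 1 - p"
  have m: "m + p = Suc (u + v)" using uv(2) assms(2) by (simp add: m_def)
  then have "m = u \<longleftrightarrow> p = Suc v" "m = Suc u \<longleftrightarrow> p = v" "m = v \<longleftrightarrow> p = Suc u" "m = Suc v \<longleftrightarrow> p = u"
    by linarith+
  then have "pick n i x y z m = pick n i y x z p"
    unfolding pick_def uv(4-6) unfolding uv(1) using uv(3) by auto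
  then show ?thesis unfolding m_def .
qed

lemma blk_carrier [simp]: "blk n i a b c d \<in> carrier_mat (2 * n) (2 * n)"
  by (simp add: blk_def)

lemma blk_dim [simp]: "dim_row (blk n i a b c d) = 2 * n" "dim_col (blk n i a b c d) = 2 * n"
  by (simp_all add: blk_def)

lemma index_blk: "p < 2 * n \<Longrightarrow> q < 2 * n \<Longrightarrow> blk n i a b c d $$ (p, q) =
    of_bool (q = p) * pick n i a d 1 p + of_bool (q = sw n i p) * pick n i b c 0 p"
  by (simp add: blk_def)

text \<open>Row p of a block matrix lives in the columns p and \<open>sw n i p\<close>, so left
  multiplication combines two rows of B. At fixed points of \<open>sw n i\<close> the second
  coefficient is 0.\<close>

lemma blk_mult_index:
  assumes "i \<in> {1..n}" "dim_row B = 2 * n" "p < 2 * n" "q < dim_col B"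
  shows "(blk n i a b c d * B) $$ (p, q) =
    pick n i a d 1 p * B $$ (p, q) + pick n i b c 0 p * B $$ (sw n i p, q)"
proof -
  have "(blk n i a b c d * B) $$ (p, q) = (\<Sum>r<2 * n. blk n i a b c d $$ (p, r) * B $$ (r, q))"
    using assms by (simp add: scalar_prod_def atLeast0LessThan)
  also have "\<dots> = (\<Sum>r<2 * n. (if r = p then pick n i a d 1 p * B $$ (p, q) else 0) +
      (if r = sw n i p then pick n i b c 0 p * B $$ (sw n i p, q) else 0))"
    using assms by (intro sum.cong) (auto simp: index_blk algebra_simps)
  finally show ?thesis
    using assms sw_less[of i n p] by (simp add: sum.distrib)
qed

lemma blk_mult:
  assumes "i \<in> {1..n}"
  shows "blk n i a b c d * blk n i a' b' c' d' =
    blk n i (a * a' + b * c') (a * b' + b * d') (c * a' + d * c') (c * b' + d * d')"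
proof (rule eq_matI)
  fix p q assume "p < dim_row (blk n i (a * a' + b * c') (a * b' + b * d') (c * a' + d * c') (c * b' + d * d'))"
    "q < dim_col (blk n i (a * a' + b * c') (a * b' + b * d') (c * a' + d * c') (c * b' + d * d'))"
  then show "(blk n i a b c d * blk n i a' b' c' d') $$ (p, q) =
    blk n i (a * a' + b * c') (a * b' + b * d') (c * a' + d * c') (c * b' + d * d') $$ (p, q)"
    using assms by (simp add: blk_mult_index index_blk sw_less sw_sw pick_sw del: index_mult_mat)
     (auto simp: pick_def algebra_simps)
qed auto

lemma blk_one: "blk n i 1 0 0 1 = 1\<^sub>m (2 * n)"
  by (rule eq_matI) (auto simp: index_blk pick_def)

lemma mat_exp_square_zero:
  assumes A: "A \<in> carrier_mat N N" and "A * A = 0\<^sub>m N N"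
  shows "mat_exp A = 1\<^sub>m N + A"
proof (rule eq_matI)
  have pow: "A ^\<^sub>m (Suc (Suc k)) = 0\<^sub>m N N" for k
  proof (induction k)
    case 0
    have "A ^\<^sub>m (Suc (Suc 0)) = 1\<^sub>m (dim_row A) * A * A" by simp
    also have "\<dots> = A * A" using A by simp
    finally show ?case using assms(2) by simp
  next
    case (Suc k)
    have "A ^\<^sub>m (Suc (Suc (Suc k))) = A ^\<^sub>m (Suc (Suc k)) * A" by simp
    also have "\<dots> = 0\<^sub>m N N" unfolding Suc using A by simp
    finally show ?case .
  qed
  fix p q assume "p < dim_row (1\<^sub>m N + A)" "q < dim_col (1\<^sub>m N + A)"
  then have pq: "p < N" "q < N" using A by auto
  have "suminf (\<lambda>k. (A ^\<^sub>m k) $$ (p, q) / fact k) = (\<Sum>k\<in>{0, 1}. (A ^\<^sub>m k) $$ (p, q) / fact k)"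
  proof (rule suminf_finite)
    fix k :: nat assume "k \<notin> {0, 1}"
    then obtain l where "k = Suc (Suc l)" by (cases k; cases "k - 1") auto
    then show "(A ^\<^sub>m k) $$ (p, q) / fact k = 0" using pow pq by (simp del: pow_mat.simps)
  qed auto
  then show "mat_exp A $$ (p, q) = (1\<^sub>m N + A) $$ (p, q)"
    using A pq by (simp add: mat_exp_def)
qed (use A in \<open>auto simp: mat_exp_def\<close>)

lemma chev_eq_blk:
  assumes "i \<in> {1..n}"
  shows "t \<cdot>\<^sub>m chev_e n i = blk n i 1 t 0 1 - 1\<^sub>m (2 * n)"
    and "t \<cdot>\<^sub>m chev_f n i = blk n i 1 0 t 1 - 1\<^sub>m (2 * n)"
proof -
  obtain u v where uv: "i = Suc u" "2 * n = Suc (Suc (u + v))" "u = v \<or> Suc u < v"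
    "i - 1 = u" "2 * n - i - 1 = v" "2 * n - i = Suc v" using assms sw_index by blast
  have e: "(p, q) \<in> {(i - 1, i), (2 * n - i - 1, 2 * n - i)} \<longleftrightarrow>
      q = sw n i p \<and> (p = i - 1 \<or> p = 2 * n - i - 1)" for p q
    unfolding sw_def uv(4-6) unfolding uv(1) using uv(3) by auto
  show "t \<cdot>\<^sub>m chev_e n i = blk n i 1 t 0 1 - 1\<^sub>m (2 * n)"
    unfolding chev_e_def e by (intro eq_matI) (simp_all add: index_blk pick_def)
  have f: "(p, q) \<in> {(i, i - 1), (2 * n - i, 2 * n - i - 1)} \<longleftrightarrow>
      q = sw n i p \<and> \<not> (p = i - 1 \<or> p = 2 * n - i - 1) \<and> (p = i \<or> p = 2 * n - i)" for p q
    unfolding sw_def uv(4-6) unfolding uv(1) using uv(3) by auto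
  show "t \<cdot>\<^sub>m chev_f n i = blk n i 1 0 t 1 - 1\<^sub>m (2 * n)"
    unfolding chev_f_def f by (intro eq_matI) (simp_all add: index_blk pick_def)
qed

text \<open>The condition \<open>b * c = 0\<close> treats x_i and y_i at once: the block minus the
  identity then squares to zero, and the exponential series stops after its linear term.\<close>

lemma blk_nilpotent:
  assumes "i \<in> {1..n}" "b * c = 0"
  shows "mat_exp (blk n i 1 b c 1 - 1\<^sub>m (2 * n)) = blk n i 1 b c 1"
proof -
  let ?B = "blk n i 1 b c 1"
  let ?A = "?B - 1\<^sub>m (2 * n)"
  have "?A * ?A = ?A * ?B - ?A * 1\<^sub>m (2 * n)"
    by (rule mult_minus_distrib_mat[where n = "2 * n" and nr = "2 * n" and nc = "2 * n"])
      (simp_all add: minus_carrier_mat)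
  also have "?A * ?B = ?B * ?B - 1\<^sub>m (2 * n) * ?B"
    by (rule minus_mult_distrib_mat[where n = "2 * n" and nr = "2 * n" and nc = "2 * n"]) simp_all
  also have "1\<^sub>m (2 * n) * ?B = ?B"
    by (rule left_mult_one_mat[OF blk_carrier])
  also have "?A * 1\<^sub>m (2 * n) = ?A"
    by (rule right_mult_one_mat[OF minus_carrier_mat[OF one_carrier_mat]])
  also have "?B * ?B - ?B - ?A = 0\<^sub>m (2 * n) (2 * n)"
    using assms unfolding blk_mult[OF assms(1)]
    by (intro eq_matI) (auto simp: index_blk pick_def mult.commute)
  finally have "?A * ?A = 0\<^sub>m (2 * n) (2 * n)" .
  then have "mat_exp ?A = 1\<^sub>m (2 * n) + ?A"
    by (intro mat_exp_square_zero minus_carrier_mat one_carrier_mat)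
  also have "\<dots> = ?B"
    by (intro eq_matI) auto
  finally show ?thesis .
qed

lemma x_sub_blk: "i \<in> {1..n} \<Longrightarrow> x_sub n i t = blk n i 1 t 0 1"
  by (simp only: x_sub_def chev_eq_blk blk_nilpotent mult_zero_right)

lemma y_sub_blk: "i \<in> {1..n} \<Longrightarrow> y_sub n i t = blk n i 1 0 t 1"
  by (simp only: y_sub_def chev_eq_blk blk_nilpotent mult_zero_left)

lemma coroot_blk:
  assumes "i \<in> {1..n}"
  shows "coroot n i a = blk n i a 0 0 (inverse a)"
proof (rule eq_matI)
  fix p q assume "p < dim_row (blk n i a 0 0 (inverse a))" "q < dim_col (blk n i a 0 0 (inverse a))"
  then show "coroot n i a $$ (p, q) = blk n i a 0 0 (inverse a) $$ (p, q)"
    by (simp add: coroot_def index_blk pick_def chev_h_def power_int_minus)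
qed (simp_all add: coroot_def)

lemma sbar_blk: "i \<in> {1..n} \<Longrightarrow> sbar n i = blk n i 0 (-1) 1 0"
  by (simp add: sbar_def x_sub_blk y_sub_blk blk_mult)

text \<open>The corner stays \<open>a * inverse a\<close> so that the identity holds for a = 0 too;
  it becomes 1 once a is known to be nonzero.\<close>

lemma Y_sub_blk: "i \<in> {1..n} \<Longrightarrow> Y_sub n i a = blk n i (inverse a) 0 (a * inverse a) a"
  by (simp add: Y_sub_def y_sub_blk coroot_blk blk_mult)

section \<open>The symplectic group\<close>

lemma one_mult_dim [simp]:
  fixes A :: "'a :: semiring_1 mat"
  shows "dim_row A = N \<Longrightarrow> 1\<^sub>m N * A = A" "dim_col A = N \<Longrightarrow> A * 1\<^sub>m N = A"
  by (auto intro!: left_mult_one_mat[of A N "dim_col A"] right_mult_one_mat[of A "dim_row A" N] carrier_matI)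

lemma mat_assoc_square:
  "A \<in> carrier_mat N N \<Longrightarrow> B \<in> carrier_mat N N \<Longrightarrow> C \<in> carrier_mat N N \<Longrightarrow> A * B * C = A * (B * C)"
  by (rule assoc_mult_mat)

text \<open>The adjoint with respect to the symplectic form, so that \<open>g\<close> is symplectic iff it is inverted by
  its adjoint.\<close>

definition sharp :: "nat \<Rightarrow> complex mat \<Rightarrow> complex mat" where
  "sharp n g = mat (2 * n) (2 * n) (\<lambda>(p, q). (-1) ^ (p + q) * g $$ (2 * n - 1 - q, 2 * n - 1 - p))"

lemma sharp_carrier [simp]: "sharp n g \<in> carrier_mat (2 * n) (2 * n)"
  by (simp add: sharp_def)

lemma mirror_sign:
  assumes "p < 2 * n"
  shows "(-1 :: 'a :: ring_1) ^ (2 * n - 1 - p) = - ((-1) ^ p)"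
proof (cases "even p")
  case True
  then have "odd (2 * n - 1 - p)" using assms by auto
  then show ?thesis using True by simp
next
  case False
  then have "even (2 * n - 1 - p)" using assms by auto
  then show ?thesis using False by simp
qed

text \<open>The form is antidiagonal with alternating signs. Up to a sign and the reversal of rows,
  multiplying \<open>g\<^sup>T\<close> by it gives the adjoint of g.\<close>

lemma symp_form_index:
  assumes g: "g \<in> carrier_mat (2 * n) (2 * n)" and "p < 2 * n" "q < 2 * n"
  shows "(g\<^sup>T * symp_form n * g) $$ (2 * n - 1 - p, q) = - ((-1) ^ p) * (sharp n g * g) $$ (p, q)"
proof -
  have J: "symp_form n \<in> carrier_mat (2 * n) (2 * n)" by (simp add: symp_form_def)
  have gJ: "(g\<^sup>T * symp_form n) $$ (2 * n - 1 - p, r) = - ((-1) ^ r) * g $$ (2 * n - 1 - r, 2 * n - 1 - p)"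
    if "r < 2 * n" for r
  proof -
    have "(g\<^sup>T * symp_form n) $$ (2 * n - 1 - p, r) =
      (\<Sum>s<2 * n. g $$ (s, 2 * n - 1 - p) * (if s + r = 2 * n - 1 then (-1) ^ s else 0))"
      using that assms by (simp add: symp_form_def scalar_prod_def atLeast0LessThan)
    also have "\<dots> = (\<Sum>s<2 * n. if s = 2 * n - 1 - r then g $$ (2 * n - 1 - r, 2 * n - 1 - p) * (-1) ^ (2 * n - 1 - r) else 0)"
      using that by (intro sum.cong) auto
    also have "\<dots> = - ((-1) ^ r) * g $$ (2 * n - 1 - r, 2 * n - 1 - p)"
      using that mirror_sign[OF that, where 'a = complex] by simp
    finally show ?thesis .
  qed
  have "(g\<^sup>T * symp_form n * g) $$ (2 * n - 1 - p, q) =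
      (\<Sum>r<2 * n. (g\<^sup>T * symp_form n) $$ (2 * n - 1 - p, r) * g $$ (r, q))"
    using assms J by (subst times_mat_def) (simp add: scalar_prod_def atLeast0LessThan)
  also have "\<dots> = (\<Sum>r<2 * n. - ((-1) ^ p) * (sharp n g $$ (p, r) * g $$ (r, q)))"
  proof (rule sum.cong[OF refl])
    fix r assume "r \<in> {..<2 * n}"
    then have r: "r < 2 * n" by simp
    have "(-1 :: complex) ^ p * (-1) ^ p = 1" by (simp flip: power_mult_distrib)
    then have "- ((-1) ^ p) * (sharp n g $$ (p, r) * g $$ (r, q)) =
        - ((-1) ^ r) * g $$ (2 * n - 1 - r, 2 * n - 1 - p) * g $$ (r, q)"
      using assms(2) r by (simp add: sharp_def power_add mult.assoc[symmetric])
    then show "(g\<^sup>T * symp_form n) $$ (2 * n - 1 - p, r) * g $$ (r, q) =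
        - ((-1) ^ p) * (sharp n g $$ (p, r) * g $$ (r, q))"
      by (simp only: gJ[OF r])
  qed
  also have "\<dots> = - ((-1) ^ p) * (sharp n g * g) $$ (p, q)"
    using assms by (subst times_mat_def)
      (simp add: scalar_prod_def atLeast0LessThan sum_distrib_left sharp_def)
  finally show ?thesis .
qed

lemma Sp_iff_sharp:
  "g \<in> carrier (Sp n) \<longleftrightarrow> g \<in> carrier_mat (2 * n) (2 * n) \<and> sharp n g * g = 1\<^sub>m (2 * n)"
proof -
  have "g\<^sup>T * symp_form n * g = symp_form n \<longleftrightarrow> sharp n g * g = 1\<^sub>m (2 * n)"
    if g: "g \<in> carrier_mat (2 * n) (2 * n)"
  proof -
    have J: "symp_form n $$ (2 * n - 1 - p, q) = - ((-1) ^ p) * 1\<^sub>m (2 * n) $$ (p, q)"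
      if "p < 2 * n" "q < 2 * n" for p q
      using that mirror_sign[of p n, where 'a = complex] by (auto simp: symp_form_def)
    have "g\<^sup>T * symp_form n * g = symp_form n \<longleftrightarrow> (\<forall>p<2 * n. \<forall>q<2 * n.
        (g\<^sup>T * symp_form n * g) $$ (2 * n - 1 - p, q) = symp_form n $$ (2 * n - 1 - p, q))"
    proof
      assume *: "\<forall>p<2 * n. \<forall>q<2 * n.
        (g\<^sup>T * symp_form n * g) $$ (2 * n - 1 - p, q) = symp_form n $$ (2 * n - 1 - p, q)"
      show "g\<^sup>T * symp_form n * g = symp_form n"
      proof (rule eq_matI)
        fix p q assume "p < dim_row (symp_form n)" "q < dim_col (symp_form n)"
        then have "p < 2 * n" "q < 2 * n" by (auto simp: symp_form_def)
        moreover from this have "2 * n - 1 - (2 * n - 1 - p) = p" "2 * n - 1 - p < 2 * n" by auto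
        ultimately show "(g\<^sup>T * symp_form n * g) $$ (p, q) = symp_form n $$ (p, q)"
          using * by metis
      qed (use g in \<open>auto simp: symp_form_def\<close>)
    qed simp
    also have "\<dots> \<longleftrightarrow> (\<forall>p<2 * n. \<forall>q<2 * n. (sharp n g * g) $$ (p, q) = 1\<^sub>m (2 * n) $$ (p, q))"
      by (simp only: symp_form_index[OF g] J cong: all_cong) simp
    also have "\<dots> \<longleftrightarrow> sharp n g * g = 1\<^sub>m (2 * n)"
    proof
      assume "\<forall>p<2 * n. \<forall>q<2 * n. (sharp n g * g) $$ (p, q) = 1\<^sub>m (2 * n) $$ (p, q)"
      then show "sharp n g * g = 1\<^sub>m (2 * n)" using g by (intro eq_matI) (auto simp: sharp_def)
    qed simp
    finally show ?thesis .
  qed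
  then show ?thesis by (auto simp: Sp_def)
qed

lemma Sp_carrier_mat: "g \<in> carrier (Sp n) \<Longrightarrow> g \<in> carrier_mat (2 * n) (2 * n)"
  by (simp add: Sp_def)

lemma Sp_mult [simp]: "g \<otimes>\<^bsub>Sp n\<^esub> h = g * h"
  by (simp add: Sp_def)

lemma Sp_one [simp]: "\<one>\<^bsub>Sp n\<^esub> = 1\<^sub>m (2 * n)"
  by (simp add: Sp_def)

lemma symp_form_carrier [simp]: "symp_form n \<in> carrier_mat (2 * n) (2 * n)"
  by (simp add: symp_form_def)

lemma group_Sp: "group (Sp n)"
proof (rule groupI)
  fix g h assume "g \<in> carrier (Sp n)" "h \<in> carrier (Sp n)"
  then have g: "g \<in> carrier_mat (2 * n) (2 * n)" "g\<^sup>T * symp_form n * g = symp_form n"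
    and h: "h \<in> carrier_mat (2 * n) (2 * n)" "h\<^sup>T * symp_form n * h = symp_form n"
    by (auto simp: Sp_def)
  have "(g * h)\<^sup>T * symp_form n * (g * h) = h\<^sup>T * (g\<^sup>T * symp_form n * g) * h"
    using g(1) h(1) by (simp add: transpose_mult[OF g(1) h(1)]
      mat_assoc_square[of _ "2 * n"] mult_carrier_mat[of _ "2 * n" "2 * n"])
  then show "g \<otimes>\<^bsub>Sp n\<^esub> h \<in> carrier (Sp n)"
    using g h by (simp add: Sp_def)
next
  show "\<one>\<^bsub>Sp n\<^esub> \<in> carrier (Sp n)" by (simp add: Sp_def symp_form_def)
next
  fix g h k assume "g \<in> carrier (Sp n)" "h \<in> carrier (Sp n)" "k \<in> carrier (Sp n)"
  then show "g \<otimes>\<^bsub>Sp n\<^esub> h \<otimes>\<^bsub>Sp n\<^esub> k = g \<otimes>\<^bsub>Sp n\<^esub> (h \<otimes>\<^bsub>Sp n\<^esub> k)"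
    by (simp add: Sp_def mat_assoc_square[of _ "2 * n"] mult_carrier_mat[of _ "2 * n" "2 * n"])
next
  fix g assume "g \<in> carrier (Sp n)"
  then show "\<one>\<^bsub>Sp n\<^esub> \<otimes>\<^bsub>Sp n\<^esub> g = g" by (auto simp: Sp_def)
next
  fix g assume "g \<in> carrier (Sp n)"
  then have g: "g \<in> carrier_mat (2 * n) (2 * n)" "g\<^sup>T * symp_form n * g = symp_form n"
      "sharp n g * g = 1\<^sub>m (2 * n)"
    using Sp_iff_sharp by (auto simp: Sp_def)
  let ?h = "sharp n g"
  \<comment> \<open>A left inverse of a square matrix is a right inverse. Inserting the invariance
    under g into the form then shows that the adjoint is symplectic as well.\<close>
  have gh: "g * ?h = 1\<^sub>m (2 * n)"
    using mat_mult_left_right_inverse[OF sharp_carrier g(1) g(3)] .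
  have "?h\<^sup>T * symp_form n * ?h = ?h\<^sup>T * (g\<^sup>T * symp_form n * g) * ?h"
    using g by simp
  also have "\<dots> = (g * ?h)\<^sup>T * symp_form n * (g * ?h)"
    using g(1) by (simp add: transpose_mult[OF g(1) sharp_carrier]
      mat_assoc_square[of _ "2 * n"] mult_carrier_mat[of _ "2 * n" "2 * n"])
  also have "\<dots> = symp_form n"  by (simp add: gh symp_form_def)
  finally have "?h \<in> carrier (Sp n)" by (simp add: Sp_def)
  then show "\<exists>h\<in>carrier (Sp n). h \<otimes>\<^bsub>Sp n\<^esub> g = \<one>\<^bsub>Sp n\<^esub>"
    using g(3) by auto
qed

text \<open>On a rank-one block the symplectic adjoint is the adjugate of the 2 x 2 matrix, hence
  its inverse when the determinant is 1.\<close>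

lemma sharp_blk:
  assumes "i \<in> {1..n}"
  shows "sharp n (blk n i a b c d) = blk n i d (- b) (- c) a"
proof (rule eq_matI)
  fix p q assume "p < dim_row (blk n i d (- b) (- c) a)" "q < dim_col (blk n i d (- b) (- c) a)"
  then have pq: "p < 2 * n" "q < 2 * n" by simp_all
  let ?p = "2 * n - 1 - p" and ?q = "2 * n - 1 - q"
  have lt: "?p < 2 * n" "?q < 2 * n" using pq by auto
  have e1: "?p = ?q \<longleftrightarrow> q = p" using pq by auto
  have "?p = sw n i ?q \<longleftrightarrow> p = sw n i q"
    unfolding sw_mirror[OF assms pq(2)] using pq sw_less[OF assms pq(2)] by linarith
  also have "\<dots> \<longleftrightarrow> q = sw n i p"
    using sw_sw[OF assms] by metis
  finally have e2: "?p = sw n i ?q \<longleftrightarrow> q = sw n i p" .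
  \<comment> \<open>Where \<open>sw n i\<close> moves p it moves it to a neighbour, so the exponent
    is odd; elsewhere the entry is 0 and the sign is irrelevant.\<close>
  have sgn: "(-1 :: complex) ^ (p + sw n i p) * pick n i b c 0 p = pick n i (- b) (- c) 0 p"
  proof -
    obtain u v where uv: "i = Suc u" "2 * n = Suc (Suc (u + v))" "u = v \<or> Suc u < v"
      "i - 1 = u" "2 * n - i - 1 = v" "2 * n - i = Suc v" using assms sw_index by blast
    show ?thesis
      unfolding sw_def pick_def uv(4-6) unfolding uv(1) using uv(3) by auto
  qed
  show "sharp n (blk n i a b c d) $$ (p, q) = blk n i d (- b) (- c) a $$ (p, q)"
  proof -
    have "sharp n (blk n i a b c d) $$ (p, q) = (-1) ^ (p + q) *
        (of_bool (q = p) * pick n i d a 1 q + of_bool (q = sw n i p) * pick n i c b 0 q)"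
      unfolding sharp_def index_mat(1)[OF pq] prod.case index_blk[OF lt(2,1)] e1 e2 pick_mirror[OF assms pq(2)] ..
    also have "\<dots> = of_bool (q = p) * pick n i d a 1 p + of_bool (q = sw n i p) * ((-1) ^ (p + sw n i p) * pick n i b c 0 p)"
      using pick_sw[OF assms, of c b 0 p] by (auto simp: algebra_simps simp flip: mult_2)
    also have "\<dots> = blk n i d (- b) (- c) a $$ (p, q)"
      unfolding sgn index_blk[OF pq] ..
    finally show ?thesis .
  qed
qed (simp_all add: sharp_def)

lemma blk_in_Sp:
  assumes "i \<in> {1..n}" "a * d - b * c = 1"
  shows "blk n i a b c d \<in> carrier (Sp n)"
proof -
  have eqs: "d * a + - b * c = 1" "d * b + - b * d = 0" "- c * a + a * c = 0" "- c * b + a * d = 1"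
    using assms(2) by (auto simp: algebra_simps)
  show ?thesis
    unfolding Sp_iff_sharp sharp_blk[OF assms(1)] blk_mult[OF assms(1)] eqs blk_one by simp
qed

lemma torus_mirror:
  assumes "t \<in> torus n" "p < 2 * n"
  shows "t $$ (2 * n - 1 - p, 2 * n - 1 - p) * t $$ (p, p) = 1"
proof -
  have t: "t \<in> carrier_mat (2 * n) (2 * n)" "sharp n t * t = 1\<^sub>m (2 * n)" "diagonal_mat t"
    using assms(1) Sp_iff_sharp by (auto simp: torus_def)
  have "1 = (sharp n t * t) $$ (p, p)" using assms t by simp
  also have "\<dots> = (\<Sum>r<2 * n. sharp n t $$ (p, r) * t $$ (r, p))"
    using assms t(1) by (subst times_mat_def) (simp add: scalar_prod_def atLeast0LessThan sharp_def)
  also have "\<dots> = (\<Sum>r<2 * n. if r = p then t $$ (2 * n - 1 - p, 2 * n - 1 - p) * t $$ (p, p) else 0)"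
    using assms t(1,3) by (intro sum.cong) (auto simp: sharp_def diagonal_mat_def)
  finally show ?thesis using assms by simp
qed

lemma torus_mult:
  assumes "s \<in> torus n" "t \<in> torus n"
  shows "s * t \<in> torus n"
proof -
  have st: "s \<in> carrier_mat (2 * n) (2 * n)" "t \<in> carrier_mat (2 * n) (2 * n)"
      "diagonal_mat s" "diagonal_mat t"
    using assms by (auto simp: torus_def Sp_def)
  have "s * t \<in> carrier (Sp n)"
    using assms monoid.m_closed[OF group.is_monoid[OF group_Sp], of s n t] by (simp add: torus_def)
  moreover have "(s * t) $$ (p, q) = 0" if "p < 2 * n" "q < 2 * n" "p \<noteq> q" for p q
  proof -
    have "(s * t) $$ (p, q) = (\<Sum>r<2 * n. s $$ (p, r) * t $$ (r, q))"
      using st that by (simp add: scalar_prod_def atLeast0LessThan)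
    also have "\<dots> = 0"
    proof (intro sum.neutral ballI)
      fix r assume "r \<in> {..<2 * n}"
      then have "s $$ (p, r) = 0 \<or> t $$ (r, q) = 0"
        using st that unfolding diagonal_mat_def by (metis carrier_matD lessThan_iff)
      then show "s $$ (p, r) * t $$ (r, q) = 0" by auto
    qed
    finally show ?thesis .
  qed
  ultimately show ?thesis using st by (auto simp: torus_def diagonal_mat_def)
qed

section \<open>Signed permutations and the length function\<close>

text \<open>The notation \<open>inv\<close> belongs to the inverse in a group here.\<close>

abbreviation pinv :: "('a \<Rightarrow> 'b) \<Rightarrow> 'b \<Rightarrow> 'a" where
  "pinv \<equiv> inv_into UNIV"

text \<open>\<open>sw n i\<close> is an adjacent transposition or a product of two disjoint ones,
  and these reverse only the pairs that they swap.\<close>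

lemma sw_neq_order:
  assumes "i \<in> {1..n}" "y \<noteq> sw n i x"
  shows "sw n i x < sw n i y \<longleftrightarrow> x < y"
proof -
  obtain u v where uv: "i = Suc u" "2 * n = Suc (Suc (u + v))" "u = v \<or> Suc u < v"
    "i - 1 = u" "2 * n - i - 1 = v" "2 * n - i = Suc v" using assms sw_index by blast
  have disj: "x = u \<and> sw n i x = Suc u \<or> x = Suc u \<and> sw n i x = u \<or>
      x = v \<and> sw n i x = Suc v \<or> x = Suc v \<and> sw n i x = v \<or>
      x \<noteq> u \<and> x \<noteq> Suc u \<and> x \<noteq> v \<and> x \<noteq> Suc v \<and> sw n i x = x" for x
    unfolding sw_def uv(4-6) unfolding uv(1) by auto
  show ?thesis
    using disj[of x] disj[of y] assms(2) uv(3) by (elim disjE conjE) linarith+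
qed

lemma sw_eq_cases:
  assumes "i \<in> {1..n}" "y = sw n i x" "x < y"
  shows "x = i - 1 \<and> y = i \<or> x = 2 * n - i - 1 \<and> y = 2 * n - i"
proof -
  obtain u v where uv: "i = Suc u" "2 * n = Suc (Suc (u + v))" "u = v \<or> Suc u < v"
    "i - 1 = u" "2 * n - i - 1 = v" "2 * n - i = Suc v" using assms sw_index by blast
  show ?thesis
    using assms(2,3) unfolding sw_def uv(4-6) unfolding uv(1) using uv(3)
    by (simp split: if_splits)
qed

lemma sw_simple:
  assumes "i \<in> {1..n}"
  shows "sw n i (i - 1) = i" "sw n i i = i - 1"
    "sw n i (2 * n - i) = 2 * n - i - 1" "sw n i (2 * n - i - 1) = 2 * n - i"
proof -
  obtain u v where uv: "i = Suc u" "2 * n = Suc (Suc (u + v))" "u = v \<or> Suc u < v"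
    "i - 1 = u" "2 * n - i - 1 = v" "2 * n - i = Suc v" using assms sw_index by blast
  show "sw n i (i - 1) = i" "sw n i i = i - 1"
    "sw n i (2 * n - i) = 2 * n - i - 1" "sw n i (2 * n - i - 1) = 2 * n - i"
    unfolding sw_def uv(4-6) unfolding uv(1) using uv(3) by auto
qed

section \<open>Signed permutations and their inversions\<close>

definition signed_perm :: "nat \<Rightarrow> (nat \<Rightarrow> nat) \<Rightarrow> bool" where
  "signed_perm n \<pi> \<longleftrightarrow> \<pi> permutes {..<2 * n} \<and> (\<forall>p<2 * n. \<pi> (2 * n - 1 - p) = 2 * n - 1 - \<pi> p)"

text \<open>The pair \<open>(p, q)\<close> stands for the positive root \<open>wt p - wt q\<close>, where \<open>wt (2 * n - 1 - p) = - wt p\<close>;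
  the condition on \<open>p + q\<close> picks one of the two pairs with this difference.\<close>

definition pos_roots :: "nat \<Rightarrow> (nat \<times> nat) set" where
  "pos_roots n = {(p, q). p < q \<and> p + q < 2 * n}"

definition invs :: "nat \<Rightarrow> (nat \<Rightarrow> nat) \<Rightarrow> (nat \<times> nat) set" where
  "invs n \<pi> = {(p, q) \<in> pos_roots n. \<pi> q < \<pi> p}"

lemma finite_pos_roots: "finite (pos_roots n)"
  by (rule finite_subset[of _ "{..<2 * n} \<times> {..<2 * n}"]) (auto simp: pos_roots_def)

lemma finite_invs: "finite (invs n \<pi>)"
  by (rule finite_subset[OF _ finite_pos_roots[of n]]) (auto simp: invs_def)

lemma sw_permutes: "i \<in> {1..n} \<Longrightarrow> sw n i permutes {..<2 * n}"
  unfolding permutes_def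
proof (intro conjI allI impI)
  fix p assume "i \<in> {1..n}" "p \<notin> {..<2 * n}"
  then show "sw n i p = p" by (auto simp: sw_def)
next
  fix p assume i: "i \<in> {1..n}"
  show "\<exists>!q. sw n i q = p" using sw_sw[OF i] by metis
qed

lemma signed_perm_sw: "i \<in> {1..n} \<Longrightarrow> signed_perm n (sw n i)"
  using sw_mirror[of i n] by (auto simp: signed_perm_def sw_permutes)

lemma signed_perm_comp:
  assumes "signed_perm n \<pi>" "signed_perm n \<rho>"
  shows "signed_perm n (\<pi> \<circ> \<rho>)"
  using assms permutes_in_image[of \<rho> "{..<2 * n}"]
  by (auto simp: signed_perm_def intro: permutes_compose)

lemma signed_perm_lt: "signed_perm n \<pi> \<Longrightarrow> p < 2 * n \<Longrightarrow> \<pi> p < 2 * n"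
  using permutes_in_image[of \<pi> "{..<2 * n}"] by (auto simp: signed_perm_def)

lemma signed_perm_inv:
  assumes "signed_perm n \<pi>"
  shows "signed_perm n (pinv \<pi>)"
  unfolding signed_perm_def
proof (intro conjI allI impI)
  have \<pi>: "\<pi> permutes {..<2 * n}" using assms by (simp add: signed_perm_def)
  show "pinv \<pi> permutes {..<2 * n}" using permutes_inv[OF \<pi>] .
  fix p assume "p < 2 * n"
  then have "pinv \<pi> p < 2 * n" using permutes_in_image[OF permutes_inv[OF \<pi>]] by auto
  then have "\<pi> (2 * n - 1 - pinv \<pi> p) = 2 * n - 1 - p"
    using assms permutes_inverses(1)[OF \<pi>] by (simp add: signed_perm_def)
  then show "pinv \<pi> (2 * n - 1 - p) = 2 * n - 1 - pinv \<pi> p"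
    using permutes_inv_eq[OF \<pi>] by auto
qed

text \<open>Only the pair of positions carrying the values \<open>i - 1\<close>, \<open>i\<close>
  and its mirror image change their order. They stand for the same positive root, so exactly one new
  inversion is counted.\<close>

lemma invs_ascent:
  assumes \<pi>: "signed_perm n \<pi>" and i: "i \<in> {1..n}" and asc: "pinv \<pi> (i - 1) < pinv \<pi> i"
  shows "card (invs n (sw n i \<circ> \<pi>)) = Suc (card (invs n \<pi>))"
proof -
  have perm: "\<pi> permutes {..<2 * n}" using \<pi> by (simp add: signed_perm_def)
  have lt: "i - 1 < 2 * n" "i < 2 * n" using i by auto
  define a b where "a = pinv \<pi> (i - 1)" and "b = pinv \<pi> i"
  have ab: "a < b" "b < 2 * n" "\<pi> a = i - 1" "\<pi> b = i"
    using asc lt permutes_inverses(1)[OF perm] signed_perm_lt[OF signed_perm_inv[OF \<pi>] lt(2)]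
    by (auto simp: a_def b_def)
  have inj: "\<pi> x = \<pi> y \<longleftrightarrow> x = y" for x y using permutes_inj[OF perm] by (auto simp: inj_def)
  define a' b' where "a' = 2 * n - 1 - a" and "b' = 2 * n - 1 - b"
  have ab': "b' < a'" "a + a' = 2 * n - 1" "b + b' = 2 * n - 1" using ab by (auto simp: a'_def b'_def)
  have "\<pi> a' = 2 * n - 1 - (i - 1)" "\<pi> b' = 2 * n - 1 - i"
    using \<pi> ab by (auto simp: signed_perm_def a'_def b'_def)
  then have \<pi>': "\<pi> a' = 2 * n - i" "\<pi> b' = 2 * n - i - 1" using i by auto
  have eqs: "\<pi> x = i - 1 \<longleftrightarrow> x = a" "\<pi> x = i \<longleftrightarrow> x = b" "\<pi> x = 2 * n - i \<longleftrightarrow> x = a'"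
      "\<pi> x = 2 * n - i - 1 \<longleftrightarrow> x = b'" for x
    using inj[of x a] inj[of x b] inj[of x a'] inj[of x b'] unfolding ab(3,4) \<pi>' by simp_all
  \<comment> \<open>Of the pair and its mirror image, this is the one listed in
    \<open>pos_roots\<close>. If \<open>a + b = 2 * n - 1\<close>, as for i = n, the two
    coincide.\<close>
  define z where "z = (if a + b < 2 * n then (a, b) else (b', a'))"
  have z: "z \<in> pos_roots n" using ab ab' by (auto simp: z_def pos_roots_def)
  have "\<not> \<pi> (snd z) < \<pi> (fst z)" using ab \<pi>' i by (auto simp: z_def)
  then have z': "z \<notin> invs n \<pi>" by (auto simp: invs_def)
  have "invs n (sw n i \<circ> \<pi>) = insert z (invs n \<pi>)"
  proof -
    have "(sw n i (\<pi> q) < sw n i (\<pi> p)) \<longleftrightarrow> (p, q) = z \<or> \<pi> q < \<pi> p" if pq: "(p, q) \<in> pos_roots n" for p q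
    proof (cases "\<pi> p = sw n i (\<pi> q)")
      case False
      have "sw n i (\<pi> (snd z)) = \<pi> (fst z)"
        unfolding z_def by (simp only: if_distrib[of fst] if_distrib[of snd] fst_conv snd_conv) (simp only: ab(3,4) \<pi>' sw_simple[OF i] split: if_split, simp)
      then have "(p, q) \<noteq> z" using False by auto
      then show ?thesis using sw_neq_order[OF i False] by simp
    next
      case True
      then have True': "\<pi> q = sw n i (\<pi> p)" using sw_sw[OF i] by simp
      have "\<pi> p \<noteq> \<pi> q" using pq inj by (auto simp: pos_roots_def)
      then consider "\<pi> p < \<pi> q" | "\<pi> q < \<pi> p" by linarith
      then show ?thesis
      proof cases
        case 1
        then have "p = a \<and> q = b \<or> p = b' \<and> q = a'"
          using sw_eq_cases[OF i True' 1] eqs by blast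
        then have "(p, q) = z" using pq ab(1) ab'
          by (elim disjE conjE) (simp_all add: z_def pos_roots_def, linarith)
        then show ?thesis using 1 True[symmetric] True'[symmetric] by simp
      next
        case 2
        then have "q = a \<and> p = b \<or> q = b' \<and> p = a'"
          using sw_eq_cases[OF i True 2] eqs by blast
        then have False using pq ab(1) ab'(1) by (elim disjE conjE) (simp_all add: pos_roots_def)
        then show ?thesis ..
      qed
    qed
    then show ?thesis using z by (auto simp: invs_def)
  qed
  then show ?thesis using z' finite_invs by simp
qed

lemma inv_sw_comp:
  assumes "signed_perm n \<pi>" "i \<in> {1..n}"
  shows "pinv (sw n i \<circ> \<pi>) p = pinv \<pi> (sw n i p)"
proof -
  have perm: "\<pi> permutes {..<2 * n}" using assms by (simp add: signed_perm_def)
  have "(sw n i \<circ> \<pi>) permutes {..<2 * n}" by (intro permutes_compose perm sw_permutes assms)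
  then show ?thesis
    using permutes_inverses(1)[OF perm] sw_sw[OF assms(2)] by (subst permutes_inv_eq) auto
qed

lemma invs_descent:
  assumes \<pi>: "signed_perm n \<pi>" and i: "i \<in> {1..n}" and desc: "pinv \<pi> i < pinv \<pi> (i - 1)"
  shows "Suc (card (invs n (sw n i \<circ> \<pi>))) = card (invs n \<pi>)"
proof -
  let ?\<rho> = "sw n i \<circ> \<pi>"
  have \<rho>: "signed_perm n ?\<rho>" by (intro signed_perm_comp signed_perm_sw i \<pi>)
  have "pinv ?\<rho> (i - 1) < pinv ?\<rho> i"
    unfolding inv_sw_comp[OF \<pi> i] sw_simple[OF i] using desc .
  moreover have "sw n i \<circ> ?\<rho> = \<pi>" using sw_sw[OF i] by (auto simp: fun_eq_iff)
  ultimately show ?thesis using invs_ascent[OF \<rho> i] by simp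
qed

lemma inv_neq:
  assumes "signed_perm n \<pi>" "i \<in> {1..n}"
  shows "pinv \<pi> i \<noteq> pinv \<pi> (i - 1)"
proof
  assume "pinv \<pi> i = pinv \<pi> (i - 1)"
  then have "i = i - 1" using assms(1) permutes_inverses(1)[of \<pi> "{..<2 * n}"]
    unfolding signed_perm_def by metis
  then show False using assms(2) by auto
qed

text \<open>The mirror symmetry carries the inequalities of the first half over to the second, so f
  is strictly increasing and \<open>q \<le> f q\<close>. The same bound at the mirror image of p
  gives \<open>f p \<le> p\<close>.\<close>

lemma mirror_increasing_eq:
  assumes f: "\<And>p. p < 2 * n \<Longrightarrow> f p < 2 * n" "\<And>p. p < 2 * n \<Longrightarrow> f (2 * n - 1 - p) = 2 * n - 1 - f p"
    and inc: "\<And>i. i \<in> {1..n} \<Longrightarrow> f (i - 1) < f i" and "p < 2 * n"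
  shows "f p = (p :: nat)"
proof -
  have step: "f p < f (Suc p)" if "Suc p < 2 * n" for p
  proof (cases "Suc p \<le> n")
    case True
    then show ?thesis using inc[of "Suc p"] by simp
  next
    case False
    have "2 * n - 1 - p \<in> {1..n}" "2 * n - 1 - p - 1 = 2 * n - 1 - Suc p" using False that by auto
    then have "f (2 * n - 1 - Suc p) < f (2 * n - 1 - p)" using inc[of "2 * n - 1 - p"] by simp
    then have "2 * n - 1 - f (Suc p) < 2 * n - 1 - f p" using f(2)[OF that] f(2)[of p] that by simp
    then show ?thesis by linarith
  qed
  have le: "q \<le> f q" if "q < 2 * n" for q
    using that
  proof (induction q)
    case (Suc q)
    then show ?case using step[of q] by simp
  qed simp
  have "2 * n - 1 - p \<le> f (2 * n - 1 - p)" using assms(4) by (intro le) auto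
  then have "f p \<le> p" using f(1,2)[OF assms(4)] assms(4) by auto
  with le[OF assms(4)] show ?thesis by simp
qed

definition mirror_perm :: "nat \<Rightarrow> nat \<Rightarrow> nat" where
  "mirror_perm n p = (if p < 2 * n then 2 * n - 1 - p else p)"

lemma signed_perm_mirror: "signed_perm n (mirror_perm n)"
proof -
  have *: "mirror_perm n (mirror_perm n p) = p" for p by (auto simp: mirror_perm_def)
  have "\<exists>!q. mirror_perm n q = p" for p using * by metis
  then have "mirror_perm n permutes {..<2 * n}"
    unfolding permutes_def by (simp add: mirror_perm_def)
  then show ?thesis by (auto simp: signed_perm_def mirror_perm_def)
qed

lemma no_descent_id:
  assumes \<pi>: "signed_perm n \<pi>" and "\<And>i. i \<in> {1..n} \<Longrightarrow> pinv \<pi> (i - 1) < pinv \<pi> i"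
  shows "\<pi> = id"
proof
  fix p
  have perm: "\<pi> permutes {..<2 * n}" using \<pi> by (simp add: signed_perm_def)
  show "\<pi> p = id p"
  proof (cases "p < 2 * n")
    case True
    have "pinv \<pi> p = p"
      using signed_perm_inv[OF \<pi>]
      by (intro mirror_increasing_eq[of n "pinv \<pi>", OF signed_perm_lt[OF signed_perm_inv[OF \<pi>]] _ assms(2) True])
        (simp_all only: signed_perm_def)
    then show ?thesis using permutes_inv_eq[OF perm] by auto
  next
    case False
    then show ?thesis using permutes_not_in[OF perm] by auto
  qed
qed

text \<open>Reversing the values of the inverse permutation turns all descents into ascents, which
  leaves only the identity.\<close>

lemma no_ascent_mirror:
  assumes \<pi>: "signed_perm n \<pi>" and "\<And>i. i \<in> {1..n} \<Longrightarrow> pinv \<pi> i < pinv \<pi> (i - 1)"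
  shows "\<pi> = mirror_perm n"
proof
  fix p
  have perm: "\<pi> permutes {..<2 * n}" using \<pi> by (simp add: signed_perm_def)
  note lt = signed_perm_lt[OF signed_perm_inv[OF \<pi>]]
  show "\<pi> p = mirror_perm n p"
  proof (cases "p < 2 * n")
    case True
    then have p': "2 * n - 1 - p < 2 * n" by auto
    have sp: "pinv \<pi> (2 * n - 1 - q) = 2 * n - 1 - pinv \<pi> q" if "q < 2 * n" for q
      using signed_perm_inv[OF \<pi>] that by (simp only: signed_perm_def)
    have "2 * n - 1 - pinv \<pi> (2 * n - 1 - p) = 2 * n - 1 - p"
    proof (rule mirror_increasing_eq[of n "\<lambda>p. 2 * n - 1 - pinv \<pi> p"])
      fix i assume i: "i \<in> {1..n}"
      then have "pinv \<pi> (i - 1) < 2 * n" using lt by auto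
      then show "2 * n - 1 - pinv \<pi> (i - 1) < 2 * n - 1 - pinv \<pi> i" using assms(2)[OF i] by auto
    next
      fix q assume "q < 2 * n"
      then show "2 * n - 1 - pinv \<pi> q < 2 * n"
        "2 * n - 1 - pinv \<pi> (2 * n - 1 - q) = 2 * n - 1 - (2 * n - 1 - pinv \<pi> q)"
        using sp[of q] by simp_all
    qed (rule p')
    then have "pinv \<pi> (2 * n - 1 - p) = p" using lt[OF p'] True by linarith
    then show ?thesis using permutes_inv_eq[OF perm] True by (auto simp: mirror_perm_def)
  next
    case False
    then show ?thesis using permutes_not_in[OF perm] by (auto simp: mirror_perm_def)
  qed
qed

section \<open>Words in the simple reflections\<close>

definition perm_word :: "nat \<Rightarrow> nat list \<Rightarrow> nat \<Rightarrow> nat" where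
  "perm_word n ws = foldr (\<lambda>i f. sw n i \<circ> f) ws id"

lemma perm_word_simps [simp]: "perm_word n [] = id" "perm_word n (i # ws) = sw n i \<circ> perm_word n ws"
  by (simp_all add: perm_word_def)

lemma perm_word_append: "perm_word n (us @ ws) = perm_word n us \<circ> perm_word n ws"
  by (induction us) (auto simp: o_assoc)

lemma signed_perm_word: "ws \<in> lists {1..n} \<Longrightarrow> signed_perm n (perm_word n ws)"
proof (induction ws)
  case Nil
  show ?case unfolding signed_perm_def perm_word_simps(1) using permutes_id by auto
next
  case (Cons i ws)
  then show ?case unfolding perm_word_simps by (intro signed_perm_comp signed_perm_sw) auto
qed

lemma invs_id: "invs n id = {}"
  by (auto simp: invs_def pos_roots_def)

lemma card_invs_word_le: "ws \<in> lists {1..n} \<Longrightarrow> card (invs n (perm_word n ws)) \<le> length ws"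
proof (induction ws)
  case Nil
  show ?case unfolding perm_word_simps(1) invs_id by simp
next
  case (Cons i ws)
  then have i: "i \<in> {1..n}" and ws: "ws \<in> lists {1..n}" by auto
  note \<pi> = signed_perm_word[OF ws]
  have "card (invs n (sw n i \<circ> perm_word n ws)) \<le> Suc (card (invs n (perm_word n ws)))"
    using inv_neq[OF \<pi> i] invs_ascent[OF \<pi> i] invs_descent[OF \<pi> i] by linarith
  then show ?case using Cons.IH[OF ws] unfolding perm_word_simps length_Cons by linarith
qed

text \<open>Sorting: a descent is removed by a left factor \<open>sw n i\<close>, which lowers the
  number of inversions by one, and without descents only the identity is left. With
  \<open>card_invs_word_le\<close> this makes the inversion number the minimal word length.\<close>

lemma exists_word:
  assumes "signed_perm n \<pi>"
  shows "\<exists>ws \<in> lists {1..n}. perm_word n ws = \<pi> \<and> length ws = card (invs n \<pi>)"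
  using assms
proof (induction "card (invs n \<pi>)" arbitrary: \<pi> rule: less_induct)
  case less
  show ?case
  proof (cases "\<exists>i \<in> {1..n}. pinv \<pi> i < pinv \<pi> (i - 1)")
    case True
    then obtain i where i: "i \<in> {1..n}" "pinv \<pi> i < pinv \<pi> (i - 1)" by auto
    note d = invs_descent[OF less.prems i]
    then obtain ws where ws: "ws \<in> lists {1..n}" "perm_word n ws = sw n i \<circ> \<pi>"
        "length ws = card (invs n (sw n i \<circ> \<pi>))"
      using less.hyps[of "sw n i \<circ> \<pi>"] signed_perm_comp[OF signed_perm_sw[OF i(1)] less.prems] by auto
    have "perm_word n (i # ws) = \<pi>" using ws(2) sw_sw[OF i(1)] by (auto simp: fun_eq_iff)
    then show ?thesis using ws d i by (intro bexI[of _ "i # ws"]) auto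
  next
    case False
    then have "\<pi> = id" using inv_neq[OF less.prems]
      by (intro no_descent_id[OF less.prems]) (meson linorder_neqE_nat)
    then have "perm_word n [] = \<pi> \<and> length [] = card (invs n \<pi>)" unfolding perm_word_simps(1) by (simp only: invs_id) simp
    then show ?thesis by (intro bexI[of _ "[]"]) auto
  qed
qed

text \<open>The coordinates of a weight in the basis \<open>\<epsilon>\<^sub>1, \<dots>, \<epsilon>\<^sub>n\<close>, followed by their negatives in reverse
  order. On these, \<open>s\<^sub>i\<close> acts by permuting positions.\<close>

definition eps_coord :: "nat \<Rightarrow> (nat \<Rightarrow> int) \<Rightarrow> nat \<Rightarrow> int" where
  "eps_coord n l p = (if p < n then sum l {p + 1..n} else - sum l {2 * n - p..n})"

lemma eps_coord_mirror: "p < 2 * n \<Longrightarrow> eps_coord n l (2 * n - 1 - p) = - eps_coord n l p"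
proof -
  assume p: "p < 2 * n"
  show ?thesis
  proof (cases "p < n")
    case True
    then have "\<not> 2 * n - 1 - p < n" "2 * n - (2 * n - 1 - p) = p + 1" by auto
    then show ?thesis using True by (simp add: eps_coord_def)
  next
    case False
    then have "2 * n - 1 - p < n" "2 * n - 1 - p + 1 = 2 * n - p" using p by auto
    then show ?thesis using False by (simp add: eps_coord_def)
  qed
qed

text \<open>The sum is the coefficient of epsilon_{p+1} in the simple root: alpha_i = epsilon_i -
  epsilon_{i+1} for i < n, and alpha_n = 2 epsilon_n.\<close>

lemma sum_cartan:
  assumes "i \<in> {1..n}" "p \<le> n"
  shows "(\<Sum>j = p + 1..n. cartan n j i) =
    (if i = n then 2 * of_bool (Suc p = n) else of_bool (Suc p = i) - of_bool (p = i))"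
  using assms(2)
proof (induction p rule: inc_induct)
  case base
  then show ?case using assms by auto
next
  case (step p)
  have "{p + 1..n} = insert (p + 1) {Suc p + 1..n}" using step by auto
  then have "(\<Sum>j = p + 1..n. cartan n j i) = cartan n (p + 1) i + (\<Sum>j = Suc p + 1..n. cartan n j i)"
    by simp
  also note step.IH
  finally show ?case using assms step.hyps by (auto simp: cartan_def)
qed

lemma eps_coord_srefl:
  assumes i: "i \<in> {1..n}" and p: "p < 2 * n"
  shows "eps_coord n (srefl n i l) p = eps_coord n l (sw n i p)"
proof -
  have small: "eps_coord n (srefl n i l) p = eps_coord n l (sw n i p)" if p: "p < n" for p
  proof -
    have lhs: "eps_coord n (srefl n i l) p = sum l {p + 1..n} - l i * (\<Sum>j = p + 1..n. cartan n j i)"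
      using p by (simp add: eps_coord_def srefl_def sum_subtractf sum_distrib_left)
    consider "Suc p = i" "i = n" | "Suc p = i" "i < n" | "p = i" "i < n" | "Suc p \<noteq> i" "p \<noteq> i"
      using i by (cases "Suc p = i"; cases "p = i"; cases "i = n") (use p in auto)
    then show ?thesis
    proof cases
      case 1
      then have "sw n i p = n" by (auto simp: sw_def)
      moreover have "{p + 1..n} = {n}" using 1 by auto
      ultimately show ?thesis unfolding lhs using 1 i by (simp add: eps_coord_def cartan_def)
    next
      case 2
      then have "sw n i p = i" by (auto simp: sw_def)
      moreover have "{p + 1..n} = insert i {i + 1..n}" using 2 by auto
      ultimately show ?thesis unfolding lhs using sum_cartan[OF i, of p] 2 i p by (auto simp: eps_coord_def)
    next
      case 3
      then have "sw n i p = i - 1" using i by (auto simp: sw_def)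
      moreover have "{i - 1 + 1..n} = insert i {i + 1..n}" using 3 i by auto
      ultimately show ?thesis unfolding lhs using sum_cartan[OF i, of p] 3 i p by (auto simp: eps_coord_def)
    next
      case 4
      then have "sw n i p = p" using i p by (auto simp: sw_def)
      then show ?thesis unfolding lhs using sum_cartan[OF i, of p] 4 p by (auto simp: eps_coord_def)
    qed
  qed
  show ?thesis
  proof (cases "p < n")
    case False
    define q where "q = 2 * n - 1 - p"
    have q: "p = 2 * n - 1 - q" "q < n" "q < 2 * n" using False p by (auto simp: q_def)
    show ?thesis
      unfolding q(1) sw_mirror[OF i q(3)] eps_coord_mirror[OF q(3)] eps_coord_mirror[OF sw_less[OF i q(3)]]
        small[OF q(2)] ..
  qed (rule small)
qed

lemma word_refl_Cons [simp]: "word_refl n (i # ws) = srefl n i \<circ> word_refl n ws"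
  by (simp add: word_refl_def)

lemma word_refl_Nil [simp]: "word_refl n [] = id"
  by (simp add: word_refl_def)

lemma eps_coord_word:
  assumes "ws \<in> lists {1..n}" "p < 2 * n"
  shows "eps_coord n (word_refl n ws l) (perm_word n ws p) = eps_coord n l p"
  using assms(1)
proof (induction ws)
  case (Cons i ws)
  then have i: "i \<in> {1..n}" and ws: "ws \<in> lists {1..n}" by auto
  have lt: "perm_word n ws p < 2 * n" using signed_perm_lt[OF signed_perm_word[OF ws] assms(2)] .
  show ?case
    using eps_coord_srefl[OF i sw_less[OF i lt]] Cons.IH sw_sw[OF i] by simp
qed simp

lemma word_refl_outside: "ws \<in> lists {1..n} \<Longrightarrow> j \<notin> {1..n} \<Longrightarrow> word_refl n ws l j = l j"
  by (induction ws) (auto simp: srefl_def cartan_def)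

lemma eps_coord_ext:
  assumes "\<And>p. p < 2 * n \<Longrightarrow> eps_coord n l p = eps_coord n l' p" "j \<in> {1..n}"
  shows "l j = l' j"
proof -
  have rec: "l j = sum l {j - 1 + 1..n} - sum l {j + 1..n}" for l :: "nat \<Rightarrow> int"
  proof -
    have "{j - 1 + 1..n} = insert j {j + 1..n}" using assms(2) by auto
    then show ?thesis by simp
  qed
  have "sum l {j - 1 + 1..n} = sum l' {j - 1 + 1..n}"
  proof -
    have "j - 1 < n" "j - 1 < 2 * n" using assms(2) by auto
    then show ?thesis using assms(1)[of "j - 1"] by (simp only: eps_coord_def if_True)
  qed
  moreover have "sum l {j + 1..n} = sum l' {j + 1..n}"
    using assms(1)[of j] assms(2) by (cases "j = n") (auto simp: eps_coord_def)
  ultimately show ?thesis using rec[of l] rec[of l'] by simp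
qed

text \<open>Permuting the epsilon coordinates determines the action on weights, because these
  coordinates determine a weight on the index set and nothing changes outside it. Conversely, a
  single regular weight detects the permutation.\<close>

lemma word_refl_eq_iff:
  assumes us: "us \<in> lists {1..n}" and ws: "ws \<in> lists {1..n}"
  shows "word_refl n us = word_refl n ws \<longleftrightarrow> perm_word n us = perm_word n ws"
proof
  assume eq: "perm_word n us = perm_word n ws"
  show "word_refl n us = word_refl n ws"
  proof (rule ext)+
    fix l j
    show "word_refl n us l j = word_refl n ws l j"
    proof (cases "j \<in> {1..n}")
      case True
      have "eps_coord n (word_refl n us l) p = eps_coord n (word_refl n ws l) p" if "p < 2 * n" for p
      proof -
        define q where "q = pinv (perm_word n us) p"
        have "q < 2 * n" using signed_perm_lt[OF signed_perm_inv[OF signed_perm_word[OF us]] that]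
          by (simp add: q_def)
        moreover have "perm_word n us q = p"
          using permutes_inverses(1) signed_perm_word[OF us] unfolding q_def signed_perm_def by metis
        ultimately show ?thesis using eps_coord_word[OF us, of q l] eps_coord_word[OF ws, of q l] eq by simp
      qed
      then show ?thesis using True by (rule eps_coord_ext)
    next
      case False
      then show ?thesis using us ws by (simp add: word_refl_outside)
    qed
  qed
next
  assume eq: "word_refl n us = word_refl n ws"
  \<comment> \<open>The sum of the fundamental weights: its coordinates n, ..., 1, -1, ..., -n are
    pairwise distinct.\<close>
  define \<rho> where "\<rho> = (\<lambda>j :: nat. 1 :: int)"
  have E: "eps_coord n \<rho> p = (if p < n then int n - int p else int n - int p - 1)" if "p < 2 * n" for p
    using that by (auto simp: eps_coord_def \<rho>_def)
  have inj: "p = q" if "eps_coord n \<rho> p = eps_coord n \<rho> q" "p < 2 * n" "q < 2 * n" for p q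
    using that by (auto simp: E split: if_splits)
  show "perm_word n us = perm_word n ws"
  proof
    fix p
    have perms: "perm_word n us permutes {..<2 * n}" "perm_word n ws permutes {..<2 * n}"
      using signed_perm_word us ws by (auto simp: signed_perm_def)
    show "perm_word n us p = perm_word n ws p"
    proof (cases "p < 2 * n")
      case True
      define q where "q = pinv (perm_word n ws) (perm_word n us p)"
      have q: "perm_word n ws q = perm_word n us p" "q < 2 * n"
        using permutes_inverses(1)[OF perms(2)] signed_perm_lt[OF signed_perm_inv[OF signed_perm_word[OF ws]]]
          signed_perm_lt[OF signed_perm_word[OF us] True] by (auto simp: q_def)
      have "eps_coord n \<rho> p = eps_coord n \<rho> q"
        using eps_coord_word[OF us True, of \<rho>] eps_coord_word[OF ws q(2), of \<rho>] eq q(1) by simp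
      then show ?thesis using inj True q by metis
    next
      case False
      then show ?thesis using permutes_not_in[OF perms(1)] permutes_not_in[OF perms(2)] by simp
    qed
  qed
qed

section \<open>The length function and the longest element\<close>

lemma weyl_length_word:
  assumes ws: "ws \<in> lists {1..n}"
  shows "weyl_length n (word_refl n ws) = card (invs n (perm_word n ws))"
  unfolding weyl_length_def
proof (rule Least_equality)
  obtain us where "us \<in> lists {1..n}" "perm_word n us = perm_word n ws"
      "length us = card (invs n (perm_word n ws))"
    using exists_word[OF signed_perm_word[OF ws]] by auto
  then show "\<exists>us \<in> lists {1..n}. word_refl n us = word_refl n ws \<and> length us = card (invs n (perm_word n ws))"
    using word_refl_eq_iff[OF _ ws] by auto
next
  fix l assume "\<exists>us \<in> lists {1..n}. word_refl n us = word_refl n ws \<and> length us = l"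
  then show "card (invs n (perm_word n ws)) \<le> l"
    using word_refl_eq_iff[OF _ ws] card_invs_word_le by metis
qed

lemma reduced_words_word:
  assumes ws: "ws \<in> lists {1..n}"
  shows "us \<in> reduced_words n (word_refl n ws) \<longleftrightarrow> us \<in> lists {1..n} \<and>
      perm_word n us = perm_word n ws \<and> length us = card (invs n (perm_word n us))"
    and "reduced_words n (word_refl n ws) \<noteq> {}"
proof -
  show *: "us \<in> reduced_words n (word_refl n ws) \<longleftrightarrow> us \<in> lists {1..n} \<and>
      perm_word n us = perm_word n ws \<and> length us = card (invs n (perm_word n us))" for us
    using word_refl_eq_iff[of us n ws] ws unfolding reduced_words_def weyl_length_word[OF ws] by (cases "us \<in> lists {1..n}") auto
  show "reduced_words n (word_refl n ws) \<noteq> {}"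
    using exists_word[OF signed_perm_word[OF ws]] * by (metis empty_iff)
qed

lemma weylE:
  assumes "w \<in> weyl n"
  obtains us where "us \<in> lists {1..n}" "w = word_refl n us"
  using assms unfolding weyl_def by (rule imageE) (rule that)

lemma longest_word:
  obtains ws where "ws \<in> lists {1..n}" "perm_word n ws = mirror_perm n" "longest n = word_refl n ws"
proof -
  obtain ws where ws: "ws \<in> lists {1..n}" "perm_word n ws = mirror_perm n"
    using exists_word[OF signed_perm_mirror[of n]] by blast
  have invs: "invs n (mirror_perm n) = pos_roots n"
  proof -
    have "mirror_perm n q < mirror_perm n p" if "p < q" "p + q < 2 * n" for p q
      using that unfolding mirror_perm_def by simp
    then show ?thesis unfolding invs_def pos_roots_def by blast
  qed
  have le: "weyl_length n v \<le> card (pos_roots n)" if "v \<in> weyl n" for v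
  proof -
    from that obtain us where "us \<in> lists {1..n}" "v = word_refl n us" by (rule weylE)
    moreover have "invs n (perm_word n us) \<subseteq> pos_roots n" by (auto simp: invs_def)
    ultimately show ?thesis using card_mono[OF finite_pos_roots] by (simp add: weyl_length_word)
  qed
  have "longest n = word_refl n ws"
    unfolding longest_def
  proof (rule the_equality)
    show "word_refl n ws \<in> weyl n \<and> (\<forall>v\<in>weyl n. weyl_length n v \<le> weyl_length n (word_refl n ws))"
    proof
      show "word_refl n ws \<in> weyl n" unfolding weyl_def by (rule imageI[OF ws(1)])
      show "\<forall>v\<in>weyl n. weyl_length n v \<le> weyl_length n (word_refl n ws)"
        unfolding weyl_length_word[OF ws(1)] ws(2) invs using le by blast
    qed
  next
    fix w assume w: "w \<in> weyl n \<and> (\<forall>v\<in>weyl n. weyl_length n v \<le> weyl_length n w)"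
    then have "w \<in> weyl n" by (rule conjunct1)
    then obtain us where us: "us \<in> lists {1..n}" "w = word_refl n us" by (rule weylE)
    have "word_refl n ws \<in> weyl n" unfolding weyl_def by (rule imageI[OF ws(1)])
    then have ge: "card (pos_roots n) \<le> card (invs n (perm_word n us))"
      using w unfolding us(2) weyl_length_word[OF us(1), symmetric] invs[symmetric] ws(2)[symmetric]
        weyl_length_word[OF ws(1), symmetric] by blast
    note \<pi> = signed_perm_word[OF us(1)]
    have "perm_word n us = mirror_perm n"
    proof (rule no_ascent_mirror[OF \<pi>])
      fix i assume i: "i \<in> {1..n}"
      \<comment> \<open>An ascent of an element of maximal length would yield more inversions than
        there are positive roots.\<close>
      have "card (invs n (sw n i \<circ> perm_word n us)) \<le> card (pos_roots n)"
        by (intro card_mono finite_pos_roots) (auto simp: invs_def)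
      then show "pinv (perm_word n us) i < pinv (perm_word n us) (i - 1)"
        using invs_ascent[OF \<pi> i] inv_neq[OF \<pi> i] ge by linarith
    qed
    then show "w = word_refl n ws" unfolding us(2) word_refl_eq_iff[OF us(1) ws(1)] ws(2) .
  qed
  then show ?thesis using ws that by blast
qed

section \<open>Lifts of Weyl group elements\<close>

lemma mat_list_prod_Nil [simp]: "mat_list_prod n [] = 1\<^sub>m (2 * n)"
  and mat_list_prod_Cons [simp]: "mat_list_prod n (g # gs) = g * mat_list_prod n gs"
  by (simp_all add: mat_list_prod_def)

lemma mat_list_prod_carrier:
  "set gs \<subseteq> carrier_mat (2 * n) (2 * n) \<Longrightarrow> mat_list_prod n gs \<in> carrier_mat (2 * n) (2 * n)"
  by (induction gs) (auto intro: mult_carrier_mat)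

lemma mat_list_prod_append:
  assumes "set gs \<subseteq> carrier_mat (2 * n) (2 * n)" "set hs \<subseteq> carrier_mat (2 * n) (2 * n)"
  shows "mat_list_prod n (gs @ hs) = mat_list_prod n gs * mat_list_prod n hs"
  using assms(1)
proof (induction gs)
  case Nil
  then show ?case using mat_list_prod_carrier[OF assms(2)] by simp
next
  case (Cons g gs)
  then show ?case
    using mat_list_prod_carrier[of gs n] mat_list_prod_carrier[OF assms(2)]
    by (simp add: mat_assoc_square[of _ "2 * n"])
qed

text \<open>The mirror image of an ascent is an ascent, so both swapped pairs of values occur in
  increasing order of position.\<close>

lemma ascent_sw:
  assumes \<pi>: "signed_perm n \<pi>" and i: "i \<in> {1..n}" and asc: "pinv \<pi> (i - 1) < pinv \<pi> i"
    and "x < sw n i x"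
  shows "pinv \<pi> x < pinv \<pi> (sw n i x)"
proof -
  have lt: "pinv \<pi> i < 2 * n" using i by (intro signed_perm_lt[OF signed_perm_inv[OF \<pi>]]) auto
  have sp: "pinv \<pi> (2 * n - 1 - q) = 2 * n - 1 - pinv \<pi> q" if "q < 2 * n" for q
    using signed_perm_inv[OF \<pi>] that by (simp only: signed_perm_def)
  have eqs: "2 * n - i - 1 = 2 * n - 1 - i" "2 * n - i = 2 * n - 1 - (i - 1)" and "i < 2 * n" "i - 1 < 2 * n"
    using i by (simp_all add: less_imp_diff_less)
  then have "pinv \<pi> (2 * n - i - 1) < pinv \<pi> (2 * n - i)"
    unfolding eqs(1) unfolding eqs(2) sp[OF \<open>i < 2 * n\<close>] sp[OF \<open>i - 1 < 2 * n\<close>] using asc lt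
    by (intro diff_less_mono2) simp_all
  with sw_eq_cases[OF i refl assms(4)] asc show ?thesis by (elim disjE conjE) simp_all
qed

lemma pick_low:
  assumes "i \<in> {1..n}" "p = i \<or> p = 2 * n - i"
  shows "pick n i x y z p = y"
proof -
  obtain u v where uv: "i = Suc u" "2 * n = Suc (Suc (u + v))" "u = v \<or> Suc u < v"
    "i - 1 = u" "2 * n - i - 1 = v" "2 * n - i = Suc v" using assms sw_index by blast
  have "p = Suc u \<or> p = Suc v" using assms(2) unfolding uv(6) unfolding uv(1) .
  then show ?thesis
    unfolding pick_def uv(4-6) unfolding uv(1) using uv(3) by auto
qed

text \<open>The entry -1 of \<open>sbar n i\<close> acts on exactly those columns whose value
  decreases under \<open>sw n i\<close>, and at an ascent exactly these columns gain an earlier,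
  larger value. Hence the sign and the parity of the count change together. Here all r < q are
  counted, not only the representatives in \<open>pos_roots\<close>.\<close>

lemma sbar_word_index:
  assumes "ws \<in> lists {1..n}" "length ws = card (invs n (perm_word n ws))" "p < 2 * n" "q < 2 * n"
  shows "mat_list_prod n (map (sbar n) ws) $$ (p, q) =
    (if p = perm_word n ws q then (-1) ^ card {r. r < q \<and> perm_word n ws q < perm_word n ws r} else 0)"
  using assms
proof (induction ws arbitrary: p)
  case Nil
  have e: "{r. r < q \<and> q < r} = {}" by auto
  have "p < 2 * n" using Nil.prems by simp
  then show ?case using assms(4) by (simp add: e)
next
  case (Cons i ws)
  then have i: "i \<in> {1..n}" and ws: "ws \<in> lists {1..n}" by auto
  define \<pi> where "\<pi> = perm_word n ws"
  have \<pi>: "signed_perm n \<pi>" unfolding \<pi>_def by (rule signed_perm_word[OF ws])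
  have perm: "\<pi> permutes {..<2 * n}" using \<pi> by (simp add: signed_perm_def)
  have inj: "\<pi> r = \<pi> s \<longleftrightarrow> r = s" for r s using permutes_inj[OF perm] by (auto simp: inj_def)
  have len: "length ws \<ge> card (invs n \<pi>)" unfolding \<pi>_def by (rule card_invs_word_le[OF ws])
  have len': "Suc (length ws) = card (invs n (sw n i \<circ> \<pi>))"
  proof -
    have "length (i # ws) = card (invs n (perm_word n (i # ws)))" using Cons.prems by blast
    then show ?thesis unfolding perm_word_simps \<pi>_def length_Cons .
  qed
  \<comment> \<open>A letter adds at most one inversion. Equality for the whole word therefore
    forces an ascent at the first letter and equality for the remaining word.\<close>
  have asc: "pinv \<pi> (i - 1) < pinv \<pi> i" and len_ws: "length ws = card (invs n \<pi>)"
    using invs_ascent[OF \<pi> i] invs_descent[OF \<pi> i] inv_neq[OF \<pi> i] len len' by linarith+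
  define M where "M = mat_list_prod n (map (sbar n) ws)"
  have IH: "M $$ (p, q) = (if p = \<pi> q then (-1) ^ card {r. r < q \<and> \<pi> q < \<pi> r} else 0)"
    if "p < 2 * n" for p
    using Cons.IH len_ws that assms(4) unfolding M_def \<pi>_def by simp
  have M: "M \<in> carrier_mat (2 * n) (2 * n)"
    unfolding M_def using ws by (intro mat_list_prod_carrier) (auto simp: sbar_blk)
  define x where "x = \<pi> q"
  have x: "x < 2 * n" unfolding x_def by (rule signed_perm_lt[OF \<pi> assms(4)])
  let ?S = "{r. r < q \<and> x < \<pi> r}" and ?S' = "{r. r < q \<and> sw n i x < sw n i (\<pi> r)}"
  have other: "r \<in> ?S' \<longleftrightarrow> r \<in> ?S" if "\<pi> r \<noteq> sw n i x" for r
    using sw_neq_order[OF i that] by simp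
  have p: "p < 2 * n" using Cons.prems by blast
  have "mat_list_prod n (map (sbar n) (i # ws)) $$ (p, q) = (blk n i 0 (-1) 1 0 * M) $$ (p, q)"
    using i by (simp add: M_def sbar_blk)
  also have "\<dots> = pick n i 0 0 1 p * M $$ (p, q) + pick n i (-1) 1 0 p * M $$ (sw n i p, q)"
    using M assms(4) by (intro blk_mult_index[OF i _ p]) auto
  also have "\<dots> = (if p = sw n i x then (-1) ^ card ?S' else 0)"
  proof -
    \<comment> \<open>The value x of column q is fixed, increases (entry 1, no new inversion because
      the swapped value stands further right), or decreases (entry -1, one new inversion).\<close>
    consider (stay) "sw n i x = x" | (up) "x < sw n i x" | (dn) "sw n i x < x" by linarith
    then show ?thesis
    proof cases
      case stay
      have nq: "r < q \<Longrightarrow> \<pi> r \<noteq> sw n i x" for r using stay inj by (simp add: x_def)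
      have "?S' = ?S"
      proof (rule Set.set_eqI)
        show "r \<in> ?S' \<longleftrightarrow> r \<in> ?S" for r using other[OF nq, of r] by (cases "r < q") simp_all
      qed
      moreover have "p \<noteq> x \<Longrightarrow> sw n i p \<noteq> x" using stay sw_sw[OF i] by metis
      moreover have "pick n i 0 0 (1 :: complex) x = 1" "pick n i (-1) 1 (0 :: complex) x = 0"
        using stay i by (auto simp: pick_def sw_def split: if_splits)
      ultimately show ?thesis
        unfolding IH[OF p] IH[OF sw_less[OF i p]] x_def[symmetric] stay using stay by auto
    next
      case up
      have nq: "r < q \<Longrightarrow> \<pi> r \<noteq> sw n i x" for r
        using ascent_sw[OF \<pi> i asc up] permutes_inverses(2)[OF perm] unfolding x_def by (metis less_asym)
      have eq: "?S' = ?S"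
      proof (rule Set.set_eqI)
        show "r \<in> ?S' \<longleftrightarrow> r \<in> ?S" for r using other[OF nq, of r] by (cases "r < q") simp_all
      qed
      have "pick n i 0 0 (1 :: complex) x = 0" "pick n i (-1) 1 (0 :: complex) (sw n i x) = 1"
        using sw_eq_cases[OF i refl up] i unfolding pick_sw[OF i] by (auto simp: pick_def)
      moreover have "sw n i p = x \<longleftrightarrow> p = sw n i x" using sw_sw[OF i] by metis
      ultimately show ?thesis
        unfolding IH[OF p] IH[OF sw_less[OF i p]] x_def[symmetric] eq using up by auto
    next
      case dn
      define y where "y = sw n i x"
      have y: "y < sw n i y" "sw n i y = x" using dn sw_sw[OF i] by (auto simp: y_def)
      \<comment> \<open>The column that carries the partner of x stands to the left of q by the
        ascent; it is the one new element of the set.\<close>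
      define r0 where "r0 = pinv \<pi> y"
      have r0: "r0 < q" "\<pi> r0 = y"
        using ascent_sw[OF \<pi> i asc y(1)] permutes_inverses[OF perm] unfolding y(2) by (auto simp: r0_def x_def)
      have nr: "r \<noteq> r0 \<Longrightarrow> \<pi> r \<noteq> sw n i x" for r using inj r0 by (metis y_def)
      have "r0 \<in> ?S'" using r0 y(2) dn by (simp add: y_def[symmetric])
      have "?S' = insert r0 ?S"
      proof (rule Set.set_eqI)
        show "r \<in> ?S' \<longleftrightarrow> r \<in> insert r0 ?S" for r
          using other[OF nr, of r] \<open>r0 \<in> ?S'\<close> by (cases "r = r0") simp_all
      qed
      moreover have "r0 \<notin> ?S" using r0 dn by (auto simp: y_def)
      ultimately have eq: "card ?S' = Suc (card ?S)" by simp
      have "pick n i 0 0 (1 :: complex) x = 0" "pick n i (-1) 1 (0 :: complex) (sw n i x) = -1"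
      proof -
        have "x = i \<or> x = 2 * n - i" using sw_eq_cases[OF i refl y(1)] unfolding y(2) by blast
        note low = pick_low[OF i this]
        show "pick n i 0 0 (1 :: complex) x = 0" "pick n i (-1) 1 (0 :: complex) (sw n i x) = -1"
          unfolding pick_sw[OF i] by (rule low)+
      qed
      moreover have "sw n i p = x \<longleftrightarrow> p = sw n i x" using sw_sw[OF i] by metis
      ultimately show ?thesis
        unfolding IH[OF p] IH[OF sw_less[OF i p]] x_def[symmetric] eq using dn by auto
    qed
  qed
  finally show ?case unfolding perm_word_simps x_def \<pi>_def by simp
qed

lemma weyl_lift_reduced:
  assumes ws: "ws \<in> lists {1..n}"
  obtains us where "us \<in> lists {1..n}" "perm_word n us = perm_word n ws"
    "length us = card (invs n (perm_word n us))"
    "weyl_lift n (word_refl n ws) = mat_list_prod n (map (sbar n) us)"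
proof -
  define us where "us = (SOME us. us \<in> reduced_words n (word_refl n ws))"
  have "us \<in> reduced_words n (word_refl n ws)"
    unfolding us_def some_in_eq using reduced_words_word(2)[OF ws] .
  then have "us \<in> lists {1..n} \<and> perm_word n us = perm_word n ws \<and> length us = card (invs n (perm_word n us))"
    unfolding reduced_words_word(1)[OF ws] .
  then show ?thesis
    by (intro that[of us]) (simp_all only: weyl_lift_def us_def)
qed

text \<open>The formula for a reduced word depends only on its permutation, so the arbitrary choice
  of the word in the lift drops out.\<close>

lemma weyl_lift_index:
  assumes ws: "ws \<in> lists {1..n}" and "p < 2 * n" "q < 2 * n"
  shows "weyl_lift n (word_refl n ws) $$ (p, q) =
    (if p = perm_word n ws q then (-1) ^ card {r. r < q \<and> perm_word n ws q < perm_word n ws r} else 0)"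
proof -
  obtain us where us: "us \<in> lists {1..n}" "perm_word n us = perm_word n ws"
    "length us = card (invs n (perm_word n us))"
    "weyl_lift n (word_refl n ws) = mat_list_prod n (map (sbar n) us)"
    using weyl_lift_reduced[OF ws] by blast
  show ?thesis unfolding us(4) sbar_word_index[OF us(1,3) assms(2,3)] us(2) ..
qed

text \<open>The subgroup generated by the root subgroups, built by prepending one generator at a
  time. It contains the lifts, their transposes and \<open>Theta\<close>, and the principal minor is
  identified on it.\<close>

inductive_set elem_group :: "nat \<Rightarrow> complex mat set" for n where
  one: "1\<^sub>m (2 * n) \<in> elem_group n"
| x: "i \<in> {1..n} \<Longrightarrow> h \<in> elem_group n \<Longrightarrow> blk n i 1 t 0 1 * h \<in> elem_group n"
| y: "i \<in> {1..n} \<Longrightarrow> h \<in> elem_group n \<Longrightarrow> blk n i 1 0 t 1 * h \<in> elem_group n"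

lemma elem_group_Sp: "h \<in> elem_group n \<Longrightarrow> h \<in> carrier (Sp n)"
proof (induction rule: elem_group.induct)
  case one
  then show ?case using group.is_monoid[OF group_Sp, THEN monoid.one_closed] by simp
next
  case (x i h t)
  then show ?case
    using monoid.m_closed[OF group.is_monoid[OF group_Sp] blk_in_Sp[OF x(1), of 1 1 t 0] x.IH] by simp
next
  case (y i h t)
  then show ?case
    using monoid.m_closed[OF group.is_monoid[OF group_Sp] blk_in_Sp[OF y(1), of 1 1 0 t] y.IH] by simp
qed

lemma elem_group_carrier: "h \<in> elem_group n \<Longrightarrow> h \<in> carrier_mat (2 * n) (2 * n)"
  by (intro Sp_carrier_mat elem_group_Sp)

lemma elem_group_mult: "g \<in> elem_group n \<Longrightarrow> h \<in> elem_group n \<Longrightarrow> g * h \<in> elem_group n"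
proof (induction rule: elem_group.induct)
  case one
  then show ?case using elem_group_carrier[of h n] by auto
next
  case (x i g t)
  then show ?case
    using elem_group_carrier[of h n] elem_group_carrier[of g n] elem_group.x[of i n "g * h" t]
    by (simp add: mat_assoc_square[of _ "2 * n"])
next
  case (y i g t)
  then show ?case
    using elem_group_carrier[of h n] elem_group_carrier[of g n] elem_group.y[of i n "g * h" t]
    by (simp add: mat_assoc_square[of _ "2 * n"])
qed

lemma blk_x_elem_group: "i \<in> {1..n} \<Longrightarrow> blk n i 1 t 0 1 \<in> elem_group n"
  using elem_group.x[OF _ elem_group.one, of i n t] by simp

lemma blk_y_elem_group: "i \<in> {1..n} \<Longrightarrow> blk n i 1 0 t 1 \<in> elem_group n"
  using elem_group.y[OF _ elem_group.one, of i n t] by simp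

text \<open>An element of SL_2 with lower left entry 1 factors as x(a - 1) y(1) x(d - 1). The case a
  = d = 0 is \<open>sbar n i\<close>, the case a d = 1 is \<open>Y_sub\<close>.\<close>

lemma blk_elem_group:
  assumes "i \<in> {1..n}"
  shows "blk n i a (a * d - 1) 1 d \<in> elem_group n"
proof -
  have "blk n i 1 (a - 1) 0 1 * (blk n i 1 0 1 1 * blk n i 1 (d - 1) 0 1) = blk n i a (a * d - 1) 1 d"
    by (simp add: blk_mult[OF assms] algebra_simps)
  moreover have "blk n i 1 (a - 1) 0 1 * (blk n i 1 0 1 1 * blk n i 1 (d - 1) 0 1) \<in> elem_group n"
    by (intro elem_group_mult blk_x_elem_group blk_y_elem_group assms)
  ultimately show ?thesis by simp
qed

lemma sbar_elem_group: "i \<in> {1..n} \<Longrightarrow> sbar n i \<in> elem_group n"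
  using blk_elem_group[of i n 0 0] by (simp add: sbar_blk)

lemma Y_sub_elem_group: "i \<in> {1..n} \<Longrightarrow> a \<noteq> 0 \<Longrightarrow> Y_sub n i a \<in> elem_group n"
  using blk_elem_group[of i n "inverse a" a] by (simp add: Y_sub_blk)

lemma mat_list_prod_elem_group: "set gs \<subseteq> elem_group n \<Longrightarrow> mat_list_prod n gs \<in> elem_group n"
  by (induction gs) (auto intro: elem_group_mult elem_group.one)

lemma blk_transpose:
  assumes "i \<in> {1..n}"
  shows "(blk n i a b c d)\<^sup>T = blk n i a c b d"
proof (rule eq_matI)
  fix p q assume "p < dim_row (blk n i a c b d)" "q < dim_col (blk n i a c b d)"
  moreover have "p = sw n i q \<longleftrightarrow> q = sw n i p" using sw_sw[OF assms] by metis
  moreover have "pick n i b c 0 (sw n i p) = pick n i c b 0 p" by (rule pick_sw[OF assms])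
  ultimately show "(blk n i a b c d)\<^sup>T $$ (p, q) = blk n i a c b d $$ (p, q)"
    by (auto simp: index_blk)
qed simp_all

lemma elem_group_transpose: "h \<in> elem_group n \<Longrightarrow> h\<^sup>T \<in> elem_group n"
proof (induction rule: elem_group.induct)
  case one
  then show ?case by (simp add: elem_group.one)
next
  case (x i h t)
  then show ?case
    using elem_group_mult[OF x.IH blk_y_elem_group[OF x(1), of t]]
    by (simp add: transpose_mult[OF blk_carrier elem_group_carrier[OF x(2)]] blk_transpose)
next
  case (y i h t)
  then show ?case
    using elem_group_mult[OF y.IH blk_x_elem_group[OF y(1), of t]]
    by (simp add: transpose_mult[OF blk_carrier elem_group_carrier[OF y(2)]] blk_transpose)
qed

lemma weyl_lift_elem_group:
  assumes "ws \<in> lists {1..n}"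
  shows "weyl_lift n (word_refl n ws) \<in> elem_group n"
proof -
  obtain us where us: "us \<in> lists {1..n}"
    "weyl_lift n (word_refl n ws) = mat_list_prod n (map (sbar n) us)"
    using weyl_lift_reduced[OF assms] by metis
  have "set (map (sbar n) us) \<subseteq> elem_group n" using us(1) sbar_elem_group by auto
  then show ?thesis unfolding us(2) by (rule mat_list_prod_elem_group)
qed

lemma sbar_word_orthogonal:
  "ws \<in> lists {1..n} \<Longrightarrow>
   (mat_list_prod n (map (sbar n) ws))\<^sup>T * mat_list_prod n (map (sbar n) ws) = 1\<^sub>m (2 * n)"
proof (induction ws)
  case (Cons i ws)
  then have i: "i \<in> {1..n}" and ws: "ws \<in> lists {1..n}" by auto
  let ?M = "mat_list_prod n (map (sbar n) ws)" and ?B = "blk n i 0 (-1) 1 0"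
  have M: "?M \<in> carrier_mat (2 * n) (2 * n)"
    using ws by (intro mat_list_prod_carrier) (auto simp: sbar_blk)
  have "?B\<^sup>T * ?B = 1\<^sub>m (2 * n)"
    by (simp add: blk_transpose[OF i] blk_mult[OF i] blk_one)
  then have "?M\<^sup>T * (?B\<^sup>T * ?B) * ?M = 1\<^sub>m (2 * n)" using Cons.IH[OF ws] M by simp
  then show ?case
    using M i by (simp add: sbar_blk transpose_mult[OF blk_carrier M] mat_assoc_square[of _ "2 * n"]
        mult_carrier_mat[of _ "2 * n" "2 * n"])
qed simp

text \<open>A lift is a product of real orthogonal blocks, so the inverse in the generalized minor
  is a transpose and its entries can be read off.\<close>

lemma inv_weyl_lift:
  assumes "ws \<in> lists {1..n}"
  shows "inv\<^bsub>Sp n\<^esub> (weyl_lift n (word_refl n ws)) = (weyl_lift n (word_refl n ws))\<^sup>T"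
proof -
  obtain us where us: "us \<in> lists {1..n}"
    "weyl_lift n (word_refl n ws) = mat_list_prod n (map (sbar n) us)"
    using weyl_lift_reduced[OF assms] by metis
  let ?W = "weyl_lift n (word_refl n ws)"
  have W: "?W \<in> elem_group n" by (rule weyl_lift_elem_group[OF assms])
  have "?W\<^sup>T * ?W = 1\<^sub>m (2 * n)" unfolding us(2) by (rule sbar_word_orthogonal[OF us(1)])
  then show ?thesis
    using group.inv_equality[OF group_Sp, where x = ?W and y = "?W\<^sup>T"] elem_group_Sp[OF W]
      elem_group_Sp[OF elem_group_transpose[OF W]] by simp
qed

section \<open>Generalized minors as leading principal minors\<close>

lemma Sp_mult_closed: "g \<in> carrier (Sp n) \<Longrightarrow> h \<in> carrier (Sp n) \<Longrightarrow> g * h \<in> carrier (Sp n)"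
  using monoid.m_closed[OF group.is_monoid[OF group_Sp], of g n h] by simp

lemma U_plus_gen: "U_plus n = generate (Sp n) {blk n i 1 t 0 1 |i t. i \<in> {1..n}}"
  unfolding U_plus_def by (rule arg_cong[of _ _ "generate (Sp n)"]) (metis (lifting) x_sub_blk)

lemma U_minus_gen: "U_minus n = generate (Sp n) {blk n i 1 0 t 1 |i t. i \<in> {1..n}}"
  unfolding U_minus_def by (rule arg_cong[of _ _ "generate (Sp n)"]) (metis (lifting) y_sub_blk)

lemma inv_blk:
  assumes "i \<in> {1..n}" "b * c = 0"
  shows "inv\<^bsub>Sp n\<^esub> (blk n i 1 b c 1) = blk n i 1 (- b) (- c) 1"
proof (rule group.inv_equality[OF group_Sp])
  show "blk n i 1 (- b) (- c) 1 \<otimes>\<^bsub>Sp n\<^esub> blk n i 1 b c 1 = \<one>\<^bsub>Sp n\<^esub>"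
    using assms(2) by (auto simp: blk_mult[OF assms(1)] blk_one)
qed (use assms in \<open>auto intro!: blk_in_Sp\<close>)

lemma U_plus_induct [consumes 1, case_names one gen mult]:
  assumes "u \<in> U_plus n" "P (1\<^sub>m (2 * n))"
    and "\<And>i t. i \<in> {1..n} \<Longrightarrow> P (blk n i 1 t 0 1)"
    and "\<And>u v. u \<in> U_plus n \<Longrightarrow> v \<in> U_plus n \<Longrightarrow> P u \<Longrightarrow> P v \<Longrightarrow> P (u * v)"
  shows "P u"
  using assms(1) unfolding U_plus_gen
proof (induction rule: generate.induct)
  case one
  then show ?case using assms(2) by simp
next
  case (incl h)
  then show ?case using assms(3) by blast
next
  case (inv h)
  then obtain i t where "h = blk n i 1 t 0 1" "i \<in> {1..n}" by blast
  then show ?case using inv_blk[of i n t 0] assms(3)[of i "- t"] by simp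
next
  case (eng h1 h2)
  then show ?case using assms(4) unfolding U_plus_gen by simp
qed

lemma U_minus_induct [consumes 1, case_names one gen mult]:
  assumes "u \<in> U_minus n" "P (1\<^sub>m (2 * n))"
    and "\<And>i t. i \<in> {1..n} \<Longrightarrow> P (blk n i 1 0 t 1)"
    and "\<And>u v. u \<in> U_minus n \<Longrightarrow> v \<in> U_minus n \<Longrightarrow> P u \<Longrightarrow> P v \<Longrightarrow> P (u * v)"
  shows "P u"
  using assms(1) unfolding U_minus_gen
proof (induction rule: generate.induct)
  case one
  then show ?case using assms(2) by simp
next
  case (incl h)
  then show ?case using assms(3) by blast
next
  case (inv h)
  then obtain i t where "h = blk n i 1 0 t 1" "i \<in> {1..n}" by blast
  then show ?case using inv_blk[of i n 0 t] assms(3)[of i "- t"] by simp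
next
  case (eng h1 h2)
  then show ?case using assms(4) unfolding U_minus_gen by simp
qed

lemma U_plus_mult: "u \<in> U_plus n \<Longrightarrow> v \<in> U_plus n \<Longrightarrow> u * v \<in> U_plus n"
  using generate.eng[of u "Sp n" _ v] unfolding U_plus_def by simp

lemma U_minus_mult: "u \<in> U_minus n \<Longrightarrow> v \<in> U_minus n \<Longrightarrow> u * v \<in> U_minus n"
  using generate.eng[of u "Sp n" _ v] unfolding U_minus_def by simp

lemma blk_U_plus: "i \<in> {1..n} \<Longrightarrow> blk n i 1 t 0 1 \<in> U_plus n"
  unfolding U_plus_gen by (intro generate.incl) blast

lemma blk_U_minus: "i \<in> {1..n} \<Longrightarrow> blk n i 1 0 t 1 \<in> U_minus n"
  unfolding U_minus_gen by (intro generate.incl) blast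

lemma one_U_plus: "1\<^sub>m (2 * n) \<in> U_plus n"
  using generate.one[of "Sp n"] unfolding U_plus_def by simp

lemma one_U_minus: "1\<^sub>m (2 * n) \<in> U_minus n"
  using generate.one[of "Sp n"] unfolding U_minus_def by simp

lemma U_plus_Sp: "u \<in> U_plus n \<Longrightarrow> u \<in> carrier (Sp n)"
proof (induction rule: U_plus_induct)
  case one
  show ?case by (rule elem_group_Sp[OF elem_group.one])
next
  case (gen i t)
  then show ?case by (intro blk_in_Sp) simp_all
next
  case (mult u v)
  then show ?case by (intro Sp_mult_closed)
qed

lemma U_minus_Sp: "u \<in> U_minus n \<Longrightarrow> u \<in> carrier (Sp n)"
proof (induction rule: U_minus_induct)
  case one
  show ?case by (rule elem_group_Sp[OF elem_group.one])
next
  case (gen i t)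
  then show ?case by (intro blk_in_Sp) simp_all
next
  case (mult u v)
  then show ?case by (intro Sp_mult_closed)
qed

lemma one_torus: "1\<^sub>m (2 * n) \<in> torus n"
  using elem_group_Sp[OF elem_group.one] by (auto simp: torus_def diagonal_mat_def)

lemma torus_Sp: "t \<in> torus n \<Longrightarrow> t \<in> carrier (Sp n)"
  by (simp add: torus_def)

lemma torus_index: "t \<in> torus n \<Longrightarrow> p < 2 * n \<Longrightarrow> q < 2 * n \<Longrightarrow> p \<noteq> q \<Longrightarrow> t $$ (p, q) = 0"
  using Sp_carrier_mat[OF torus_Sp, of t n] unfolding torus_def diagonal_mat_def by auto

section \<open>Moving torus elements and root subgroups past each other\<close>

lemma blk_torus:
  assumes i: "i \<in> {1..n}" and "a \<noteq> 0"
  shows "blk n i a 0 0 (inverse a) \<in> torus n"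
proof -
  have "blk n i a 0 0 (inverse a) \<in> carrier (Sp n)" using assms by (intro blk_in_Sp) simp_all
  moreover have "diagonal_mat (blk n i a 0 0 (inverse a))"
    unfolding diagonal_mat_def by (auto simp: index_blk pick_def)
  ultimately show ?thesis by (simp add: torus_def)
qed

lemma index_mult_torus:
  assumes "t \<in> torus n" "g \<in> carrier_mat (2 * n) (2 * n)" "p < 2 * n" "q < 2 * n"
  shows "(g * t) $$ (p, q) = g $$ (p, q) * t $$ (q, q)" "(t * g) $$ (p, q) = t $$ (p, p) * g $$ (p, q)"
proof -
  have t: "t \<in> carrier_mat (2 * n) (2 * n)" by (intro Sp_carrier_mat torus_Sp assms)
  have "(g * t) $$ (p, q) = (\<Sum>r<2 * n. g $$ (p, r) * t $$ (r, q))"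
    using assms t by (simp add: scalar_prod_def atLeast0LessThan)
  also have "\<dots> = (\<Sum>r<2 * n. if r = q then g $$ (p, q) * t $$ (q, q) else 0)"
    using torus_index[OF assms(1)] assms(4) by (intro sum.cong) auto
  finally show "(g * t) $$ (p, q) = g $$ (p, q) * t $$ (q, q)" using assms by simp
  have "(t * g) $$ (p, q) = (\<Sum>r<2 * n. t $$ (p, r) * g $$ (r, q))"
    using assms t by (simp add: scalar_prod_def atLeast0LessThan)
  also have "\<dots> = (\<Sum>r<2 * n. if r = p then t $$ (p, p) * g $$ (p, q) else 0)"
    using torus_index[OF assms(1)] assms(3) by (intro sum.cong) auto
  finally show "(t * g) $$ (p, q) = t $$ (p, p) * g $$ (p, q)" using assms by simp
qed

text \<open>The number r is alpha_i(t)^{-1}. Both pairs swapped by \<open>sw n i\<close> give the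
  same ratio because mirrored diagonal entries are inverse to each other.\<close>

lemma torus_sw:
  assumes t: "t \<in> torus n" and i: "i \<in> {1..n}"
  obtains r where "r \<noteq> 0" "\<And>p. p = i - 1 \<or> p = 2 * n - i - 1 \<Longrightarrow> t $$ (sw n i p, sw n i p) = t $$ (p, p) * r"
    "\<And>p. p = i \<or> p = 2 * n - i \<Longrightarrow> t $$ (sw n i p, sw n i p) = t $$ (p, p) / r"
proof -
  have lt: "i < 2 * n" "i - 1 < 2 * n" using i by (simp_all add: less_imp_diff_less)
  have eqs: "2 * n - 1 - i = 2 * n - i - 1" "2 * n - 1 - (i - 1) = 2 * n - i" using i by simp_all
  let ?a = "t $$ (i - 1, i - 1)" and ?b = "t $$ (i, i)"
  have m: "t $$ (2 * n - i - 1, 2 * n - i - 1) * ?b = 1" "t $$ (2 * n - i, 2 * n - i) * ?a = 1"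
    using torus_mirror[OF t lt(1)] torus_mirror[OF t lt(2)] unfolding eqs by blast+
  then have nz: "?a \<noteq> 0" "?b \<noteq> 0" by auto
  have m': "t $$ (2 * n - i - 1, 2 * n - i - 1) = 1 / ?b" "t $$ (2 * n - i, 2 * n - i) = 1 / ?a"
    using m nz by (simp_all add: field_simps)
  show ?thesis
  proof (rule that[of "?b / ?a"])
    show "?b / ?a \<noteq> 0" using nz by simp
    show "t $$ (sw n i p, sw n i p) = t $$ (p, p) * (?b / ?a)" if "p = i - 1 \<or> p = 2 * n - i - 1" for p
      using that
    proof
      assume p: "p = i - 1"
      show ?thesis unfolding p sw_simple[OF i] using nz by simp
    next
      assume p: "p = 2 * n - i - 1"
      show ?thesis unfolding p sw_simple[OF i] m' using nz by simp
    qed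
    show "t $$ (sw n i p, sw n i p) = t $$ (p, p) / (?b / ?a)" if "p = i \<or> p = 2 * n - i" for p
      using that
    proof
      assume p: "p = i"
      show ?thesis unfolding p sw_simple[OF i] using nz by simp
    next
      assume p: "p = 2 * n - i"
      show ?thesis unfolding p sw_simple[OF i] m' using nz by simp
    qed
  qed
qed

lemma pick_const [simp]: "pick n i x x x p = x"
  by (simp add: pick_def)

lemma torus_conj_blk:
  assumes t: "t \<in> torus n" and i: "i \<in> {1..n}"
  obtains r where "r \<noteq> 0" "\<And>b c. blk n i 1 b c 1 * t = t * blk n i 1 (b * r) (c / r) 1"
proof -
  obtain r where r: "r \<noteq> 0"
    "\<And>p. p = i - 1 \<or> p = 2 * n - i - 1 \<Longrightarrow> t $$ (sw n i p, sw n i p) = t $$ (p, p) * r"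
    "\<And>p. p = i \<or> p = 2 * n - i \<Longrightarrow> t $$ (sw n i p, sw n i p) = t $$ (p, p) / r"
    by (rule torus_sw[OF t i]) blast
  have tc: "t \<in> carrier_mat (2 * n) (2 * n)" by (intro Sp_carrier_mat torus_Sp t)
  show ?thesis
  proof (rule that[OF r(1)])
    fix b c
    show "blk n i 1 b c 1 * t = t * blk n i 1 (b * r) (c / r) 1"
    proof (rule eq_matI)
      fix p q assume "p < dim_row (t * blk n i 1 (b * r) (c / r) 1)" "q < dim_col (t * blk n i 1 (b * r) (c / r) 1)"
      then have pq: "p < 2 * n" "q < 2 * n" using tc by simp_all
      have h: "pick n i b c 0 p * t $$ (sw n i p, sw n i p) = t $$ (p, p) * pick n i (b * r) (c / r) 0 p"
        using r(2)[of p] r(3)[of p] by (simp add: pick_def)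
      have ob: "of_bool (q = x) * y * t $$ (q, q) = of_bool (q = x) * (y * t $$ (x, x))" for x y
        by simp
      show "(blk n i 1 b c 1 * t) $$ (p, q) = (t * blk n i 1 (b * r) (c / r) 1) $$ (p, q)"
        unfolding index_mult_torus[OF t blk_carrier pq] index_blk[OF pq] pick_const distrib_left distrib_right ob h
        by (simp add: mult.left_commute)
    qed (use tc in simp_all)
  qed
qed

lemma U_plus_torus:
  assumes "u \<in> U_plus n" and t: "t \<in> torus n"
  shows "\<exists>u' \<in> U_plus n. u * t = t * u'"
  using assms(1)
proof (induction rule: U_plus_induct)
  case one
  have "1\<^sub>m (2 * n) * t = t * 1\<^sub>m (2 * n)" using Sp_carrier_mat[OF torus_Sp[OF t]] by simp
  then show ?case using one_U_plus by blast
next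
  case (gen i s)
  obtain r where "\<And>b c. blk n i 1 b c 1 * t = t * blk n i 1 (b * r) (c / r) 1"
    by (rule torus_conj_blk[OF t gen]) blast
  then have "blk n i 1 s 0 1 * t = t * blk n i 1 (s * r) 0 1" by simp
  then show ?case using blk_U_plus[OF gen] by blast
next
  case (mult u v)
  then obtain u' v' where uv: "u' \<in> U_plus n" "u * t = t * u'" "v' \<in> U_plus n" "v * t = t * v'" by blast
  note [intro] = Sp_carrier_mat torus_Sp U_plus_Sp
  have c: "u \<in> carrier_mat (2 * n) (2 * n)" "v \<in> carrier_mat (2 * n) (2 * n)" "t \<in> carrier_mat (2 * n) (2 * n)"
    "u' \<in> carrier_mat (2 * n) (2 * n)" "v' \<in> carrier_mat (2 * n) (2 * n)"
    using mult uv t by blast+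
  have "u * v * t = u * (v * t)" using c by (simp add: mat_assoc_square[of _ "2 * n"])
  also have "\<dots> = u * t * v'" unfolding uv(4) using c by (simp add: mat_assoc_square[of _ "2 * n"])
  also have "\<dots> = t * (u' * v')" unfolding uv(2) using c by (simp add: mat_assoc_square[of _ "2 * n"])
  finally show ?case using U_plus_mult uv by blast
qed

lemma pick_disjoint:
  assumes "i \<in> {1..n}" "j \<in> {1..n}" "i \<noteq> j"
  shows "pick n i 0 s 0 p * pick n j 0 a 0 p = (0 :: complex)" "pick n i s 0 0 p * pick n j a 0 0 p = 0"
proof -
  obtain u v where uv: "i = Suc u" "2 * n = Suc (Suc (u + v))" "u = v \<or> Suc u < v"
    "i - 1 = u" "2 * n - i - 1 = v" "2 * n - i = Suc v" using assms(1) sw_index by blast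
  obtain u' v' where uv': "j = Suc u'" "2 * n = Suc (Suc (u' + v'))" "u' = v' \<or> Suc u' < v'"
    "j - 1 = u'" "2 * n - j - 1 = v'" "2 * n - j = Suc v'" using assms(2) sw_index by blast
  have "u \<noteq> u'" "u + v = u' + v'" using assms(3) uv(1,2) uv'(1,2) by simp_all
  moreover have "u \<le> v" "u' \<le> v'" using uv(3) uv'(3) by linarith+
  ultimately have ne: "u \<noteq> u'" "v \<noteq> v'" "u \<noteq> v'" "v \<noteq> u'" by linarith+
  show "pick n i 0 s 0 p * pick n j 0 a 0 p = 0" "pick n i s 0 0 p * pick n j a 0 0 p = 0"
    unfolding pick_def uv(4-6) uv'(4-6) unfolding uv(1) uv'(1) using ne by auto
qed

text \<open>alpha_j - alpha_i is not a root. Concretely e_j f_i and f_i e_j vanish as matrices, and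
  both products reduce to the identity plus the same two linear terms.\<close>

lemma blk_commute:
  assumes i: "i \<in> {1..n}" and j: "j \<in> {1..n}" and "i \<noteq> j"
  shows "blk n j 1 a 0 1 * blk n i 1 0 s 1 = blk n i 1 0 s 1 * blk n j 1 a 0 1"
proof (rule eq_matI)
  fix p q assume "p < dim_row (blk n i 1 0 s 1 * blk n j 1 a 0 1)" "q < dim_col (blk n i 1 0 s 1 * blk n j 1 a 0 1)"
  then have pq: "p < 2 * n" "q < 2 * n" by simp_all
  have *: "pick n j a 0 0 p * pick n i 0 s 0 (sw n j p) = 0" "pick n i 0 s 0 p * pick n j a 0 0 (sw n i p) = 0"
    using pick_disjoint(1)[OF assms, of s "sw n j p" a] pick_disjoint(2)[OF assms, of s "sw n i p" a]
    unfolding pick_sw[OF i] pick_sw[OF j] by (simp_all add: mult.commute)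
  have gen: "1 * (A * 1 + B * X) + Y * (C * 1 + D * Z) = A + B * X + Y * C + D * (Y * Z)"
    for A B C D X Y Z :: complex by (simp add: algebra_simps)
  have "(blk n j 1 a 0 1 * blk n i 1 0 s 1) $$ (p, q) = of_bool (q = p) + of_bool (q = sw n i p) * pick n i 0 s 0 p +
      pick n j a 0 0 p * of_bool (q = sw n j p) + of_bool (q = sw n i (sw n j p)) * (pick n j a 0 0 p * pick n i 0 s 0 (sw n j p))"
    unfolding blk_mult_index[OF j blk_dim(1) pq(1) pq(2)[folded blk_dim(2)[of n i 1 0 s 1]]]
      index_blk[OF pq] index_blk[OF sw_less[OF j pq(1)] pq(2)] pick_const
    by (rule gen)
  also have "\<dots> = of_bool (q = p) + of_bool (q = sw n j p) * pick n j a 0 0 p +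
      pick n i 0 s 0 p * of_bool (q = sw n i p) + of_bool (q = sw n j (sw n i p)) * (pick n i 0 s 0 p * pick n j a 0 0 (sw n i p))"
    unfolding * by simp
  also have "\<dots> = (blk n i 1 0 s 1 * blk n j 1 a 0 1) $$ (p, q)"
    by (rule sym) (unfold blk_mult_index[OF i blk_dim(1) pq(1) pq(2)[folded blk_dim(2)[of n j 1 a 0 1]]]
      index_blk[OF pq] index_blk[OF sw_less[OF i pq(1)] pq(2)] pick_const, rule gen)
  finally show "(blk n j 1 a 0 1 * blk n i 1 0 s 1) $$ (p, q) = (blk n i 1 0 s 1 * blk n j 1 a 0 1) $$ (p, q)" .
qed simp_all

text \<open>The Gauss decomposition of the 2 x 2 matrix with rows (1 + a s, a) and (s, 1); its pivot
  is 1 + a s.\<close>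

lemma blk_exchange:
  assumes i: "i \<in> {1..n}" and b: "1 + a * s \<noteq> 0"
  shows "blk n i 1 a 0 1 * blk n i 1 0 s 1 = blk n i 1 0 (s / (1 + a * s)) 1 *
    blk n i (1 + a * s) 0 0 (inverse (1 + a * s)) * blk n i 1 (a / (1 + a * s)) 0 1"
proof -
  have "s / (1 + a * s) * (1 + a * s) = s" "(1 + a * s) * (a / (1 + a * s)) = a"
    "s * (a / (1 + a * s)) + inverse (1 + a * s) = 1"
    using b by (simp_all add: field_simps)
  then show ?thesis by (simp add: blk_mult[OF i])
qed

text \<open>Moving \<open>y\<^sub>i(s)\<close> to the left through a word in the \<open>x\<^sub>j\<close> replaces \<open>s\<close> by an injective function of \<open>s\<close>
  that is defined for all but finitely many \<open>s\<close>.\<close>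

definition exchanges :: "nat \<Rightarrow> nat \<Rightarrow> complex mat \<Rightarrow> complex set \<Rightarrow> (complex \<Rightarrow> complex) \<Rightarrow> bool" where
  "exchanges n i u S \<sigma> \<longleftrightarrow> finite S \<and> inj_on \<sigma> (- S) \<and> (\<forall>s. s \<notin> S \<longrightarrow>
    (\<exists>h \<in> torus n. \<exists>v \<in> U_plus n. u * blk n i 1 0 s 1 = blk n i 1 0 (\<sigma> s) 1 * h * v))"

lemma U_plus_exchange:
  assumes "u \<in> U_plus n" and i: "i \<in> {1..n}"
  shows "\<exists>S \<sigma>. exchanges n i u S \<sigma>"
  using assms(1)
proof (induction rule: U_plus_induct)
  case one
  have "1\<^sub>m (2 * n) * blk n i 1 0 s 1 = blk n i 1 0 s 1 * 1\<^sub>m (2 * n) * 1\<^sub>m (2 * n)" for s by simp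
  then have "exchanges n i (1\<^sub>m (2 * n)) {} (\<lambda>s. s)"
    unfolding exchanges_def using one_torus one_U_plus inj_on_id2 by blast
  then show ?case by blast
next
  case (gen j a)
  show ?case
  proof (cases "i = j")
    case True
    \<comment> \<open>Among the generators only x_i changes the parameter: by a Moebius map,
      injective away from its pole, and there is no pole for a = 0.\<close>
    define S where "S = {s. 1 + a * s = 0}"
    define \<sigma> where "\<sigma> = (\<lambda>s. s / (1 + a * s))"
    have "finite S"
    proof (rule finite_subset)
      show "S \<subseteq> {- 1 / a}"
      proof
        fix s assume "s \<in> S"
        then have s: "a * s = - 1" by (simp add: S_def add_eq_0_iff)
        then have "a \<noteq> 0" by auto
        then show "s \<in> {- 1 / a}" using s eq_divide_imp[of a s "- 1"] by (simp add: mult.commute)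
      qed
    qed simp
    moreover have "inj_on \<sigma> (- S)"
      unfolding inj_on_def \<sigma>_def S_def by (auto simp: field_simps)
    moreover have "\<exists>h \<in> torus n. \<exists>v \<in> U_plus n. blk n j 1 a 0 1 * blk n i 1 0 s 1 = blk n i 1 0 (\<sigma> s) 1 * h * v"
      if "s \<notin> S" for s
    proof -
      have b: "1 + a * s \<noteq> 0" using that by (simp add: S_def)
      show ?thesis
        unfolding True[symmetric] blk_exchange[OF i b] \<sigma>_def using blk_torus[OF i b] blk_U_plus[OF i] by blast
    qed
    ultimately have "exchanges n i (blk n j 1 a 0 1) S \<sigma>" unfolding exchanges_def by blast
    then show ?thesis by blast
  next
    case False
    have "blk n j 1 a 0 1 * blk n i 1 0 s 1 = blk n i 1 0 s 1 * 1\<^sub>m (2 * n) * blk n j 1 a 0 1" for s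
      using blk_commute[OF i gen False] by simp
    then have "exchanges n i (blk n j 1 a 0 1) {} (\<lambda>s. s)"
      unfolding exchanges_def using one_torus blk_U_plus[OF gen] inj_on_id2 by blast
    then show ?thesis by blast
  qed
next
  case (mult u v)
  from mult.IH obtain S \<sigma> S' \<sigma>' where exch: "exchanges n i u S \<sigma>" "exchanges n i v S' \<sigma>'"
    by blast
  have u: "finite S" "inj_on \<sigma> (- S)" and v: "finite S'" "inj_on \<sigma>' (- S')"
    using exch unfolding exchanges_def by blast+
  \<comment> \<open>The right factor acts first. Injectivity of \<open>\<sigma>'\<close> keeps the
    preimage of the exceptional set S finite, which is why it is part of
    \<open>exchanges\<close>.\<close>
  define R where "R = S' \<union> (\<sigma>' -` S \<inter> - S')"
  have "finite R" unfolding R_def using finite_vimage_IntI[OF u(1) v(2)] v(1) by blast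
  moreover have "inj_on (\<sigma> \<circ> \<sigma>') (- R)"
  proof (rule comp_inj_on)
    show "inj_on \<sigma>' (- R)" using v(2) by (rule inj_on_subset) (auto simp: R_def)
    show "inj_on \<sigma> (\<sigma>' ` (- R))" using u(2) by (rule inj_on_subset) (auto simp: R_def)
  qed
  moreover have "\<exists>h \<in> torus n. \<exists>w \<in> U_plus n. u * v * blk n i 1 0 s 1 = blk n i 1 0 ((\<sigma> \<circ> \<sigma>') s) 1 * h * w"
    if "s \<notin> R" for s
  proof -
    have s: "s \<notin> S'" "\<sigma>' s \<notin> S" using that by (auto simp: R_def)
    from exch(2) s(1) obtain h w where hw: "h \<in> torus n" "w \<in> U_plus n"
      "v * blk n i 1 0 s 1 = blk n i 1 0 (\<sigma>' s) 1 * h * w" unfolding exchanges_def by blast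
    from exch(1) s(2) obtain h' w' where hw': "h' \<in> torus n" "w' \<in> U_plus n"
      "u * blk n i 1 0 (\<sigma>' s) 1 = blk n i 1 0 (\<sigma> (\<sigma>' s)) 1 * h' * w'" unfolding exchanges_def by blast
    \<comment> \<open>The torus factor from the first exchange is moved to the left of the unipotent
      factor from the second, which restores the order y, torus, U^+.\<close>
    from U_plus_torus[OF hw'(2) hw(1)] obtain w'' where w'': "w'' \<in> U_plus n" "w' * h = h * w''" by blast
    have c: "u \<in> carrier_mat (2 * n) (2 * n)" "v \<in> carrier_mat (2 * n) (2 * n)"
      "h \<in> carrier_mat (2 * n) (2 * n)" "h' \<in> carrier_mat (2 * n) (2 * n)" "w \<in> carrier_mat (2 * n) (2 * n)"
      "w' \<in> carrier_mat (2 * n) (2 * n)" "w'' \<in> carrier_mat (2 * n) (2 * n)"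
      by (intro Sp_carrier_mat torus_Sp U_plus_Sp mult hw hw' w'')+
    note assoc = mat_assoc_square[of _ "2 * n"] mult_carrier_mat[of _ "2 * n" "2 * n"]
    have "u * v * blk n i 1 0 s 1 = u * (v * blk n i 1 0 s 1)" using c by (simp add: assoc)
    also have "\<dots> = u * blk n i 1 0 (\<sigma>' s) 1 * (h * w)" unfolding hw(3) using c by (simp add: assoc)
    also have "\<dots> = blk n i 1 0 (\<sigma> (\<sigma>' s)) 1 * h' * (w' * h) * w" unfolding hw'(3) using c by (simp add: assoc)
    also have "\<dots> = blk n i 1 0 (\<sigma> (\<sigma>' s)) 1 * (h' * h) * (w'' * w)" unfolding w''(2) using c by (simp add: assoc)
    finally show ?thesis
      using torus_mult[OF hw'(1) hw(1)] U_plus_mult[OF w''(1) hw(2)] unfolding comp_def by blast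
  qed
  ultimately have "exchanges n i (u * v) R (\<sigma> \<circ> \<sigma>')" unfolding exchanges_def by blast
  then show ?case by blast
qed

section \<open>The big cell and polynomials vanishing on it\<close>

definition big_cell :: "nat \<Rightarrow> complex mat set" where
  "big_cell n = {u * t * v |u t v. u \<in> U_minus n \<and> t \<in> torus n \<and> v \<in> U_plus n}"

lemma big_cell_Sp: "g \<in> big_cell n \<Longrightarrow> g \<in> carrier (Sp n)"
  unfolding big_cell_def using Sp_mult_closed U_minus_Sp torus_Sp U_plus_Sp by blast

lemma big_cell_x:
  assumes "g \<in> big_cell n" "i \<in> {1..n}"
  shows "g * blk n i 1 a 0 1 \<in> big_cell n"
proof -
  from assms(1) obtain u t v where g: "g = u * t * v" "u \<in> U_minus n" "t \<in> torus n" "v \<in> U_plus n"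
    unfolding big_cell_def by blast
  have c: "u \<in> carrier_mat (2 * n) (2 * n)" "t \<in> carrier_mat (2 * n) (2 * n)" "v \<in> carrier_mat (2 * n) (2 * n)"
    by (intro Sp_carrier_mat torus_Sp U_plus_Sp U_minus_Sp g)+
  have "g * blk n i 1 a 0 1 = u * t * (v * blk n i 1 a 0 1)"
    unfolding g(1) using c by (simp add: mat_assoc_square[of _ "2 * n"] mult_carrier_mat[of _ "2 * n" "2 * n"])
  then show ?thesis
    unfolding big_cell_def using g U_plus_mult[OF g(4) blk_U_plus[OF assms(2)]] by blast
qed

text \<open>After the exchange the factor y_i stands to the right of the torus part of g;
  conjugation by that part only rescales its parameter, and it joins U^-.\<close>

lemma big_cell_y:
  assumes "g \<in> big_cell n" "i \<in> {1..n}"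
  shows "\<exists>S. finite S \<and> (\<forall>s. s \<notin> S \<longrightarrow> g * blk n i 1 0 s 1 \<in> big_cell n)"
proof -
  from assms(1) obtain u t v where g: "g = u * t * v" "u \<in> U_minus n" "t \<in> torus n" "v \<in> U_plus n"
    unfolding big_cell_def by blast
  from U_plus_exchange[OF g(4) assms(2)] obtain S \<sigma> where S: "exchanges n i v S \<sigma>" by blast
  have "g * blk n i 1 0 s 1 \<in> big_cell n" if "s \<notin> S" for s
  proof -
    from S that(1) have "\<exists>h \<in> torus n. \<exists>w \<in> U_plus n. v * blk n i 1 0 s 1 = blk n i 1 0 (\<sigma> s) 1 * h * w"
      unfolding exchanges_def by blast
    then obtain h w where hw: "h \<in> torus n" "w \<in> U_plus n"
      "v * blk n i 1 0 s 1 = blk n i 1 0 (\<sigma> s) 1 * h * w" by blast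
    obtain r where r: "r \<noteq> 0" "\<And>b c. blk n i 1 b c 1 * t = t * blk n i 1 (b * r) (c / r) 1"
      by (rule torus_conj_blk[OF g(3) assms(2)]) blast
    have ty: "t * blk n i 1 0 (\<sigma> s) 1 = blk n i 1 0 (\<sigma> s * r) 1 * t"
      using r(2)[of 0 "\<sigma> s * r"] r(1) by simp
    have c: "u \<in> carrier_mat (2 * n) (2 * n)" "t \<in> carrier_mat (2 * n) (2 * n)" "v \<in> carrier_mat (2 * n) (2 * n)"
      "h \<in> carrier_mat (2 * n) (2 * n)" "w \<in> carrier_mat (2 * n) (2 * n)"
      by (intro Sp_carrier_mat torus_Sp U_plus_Sp U_minus_Sp g hw)+
    note assoc = mat_assoc_square[of _ "2 * n"] mult_carrier_mat[of _ "2 * n" "2 * n"]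
    have "g * blk n i 1 0 s 1 = u * t * (v * blk n i 1 0 s 1)" unfolding g(1) using c by (simp add: assoc)
    also have "\<dots> = u * (t * blk n i 1 0 (\<sigma> s) 1) * h * w" unfolding hw(3) using c by (simp add: assoc)
    also have "\<dots> = (u * blk n i 1 0 (\<sigma> s * r) 1) * (t * h) * w" unfolding ty using c by (simp add: assoc)
    finally show ?thesis
      unfolding big_cell_def
      using U_minus_mult[OF g(2) blk_U_minus[OF assms(2)]] torus_mult[OF g(3) hw(1)] hw(2) by blast
  qed
  then show ?thesis using S unfolding exchanges_def by blast
qed

lemma entry_poly_y:
  assumes "P \<in> entry_polys n" "g \<in> carrier_mat (2 * n) (2 * n)"
  shows "\<exists>f. \<forall>s. P (g * blk n i 1 0 s 1) = poly f s"
  using assms(1)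
proof (induction rule: entry_polys.induct)
  case (const a)
  show ?case by (rule exI[of _ "[:a:]"]) simp
next
  case (entry p q)
  have "(g * blk n i 1 0 s 1) $$ (p, q) = poly (\<Sum>r<2 * n. [:g $$ (p, r) * of_bool (q = r),
      g $$ (p, r) * of_bool (q = sw n i r) * pick n i 0 1 0 r:]) s" for s
  proof -
    have "(g * blk n i 1 0 s 1) $$ (p, q) = (\<Sum>r<2 * n. g $$ (p, r) * blk n i 1 0 s 1 $$ (r, q))"
      using assms(2) entry by (simp add: scalar_prod_def atLeast0LessThan)
    also have "\<dots> = (\<Sum>r<2 * n. poly [:g $$ (p, r) * of_bool (q = r),
      g $$ (p, r) * of_bool (q = sw n i r) * pick n i 0 1 0 r:] s)"
    proof (rule sum.cong[OF refl])
      fix r assume "r \<in> {..<2 * n}"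
      then have r: "r < 2 * n" by simp
      have "pick n i 0 s 0 r = s * pick n i 0 1 0 r" by (simp add: pick_def)
      then show "g $$ (p, r) * blk n i 1 0 s 1 $$ (r, q) = poly [:g $$ (p, r) * of_bool (q = r),
        g $$ (p, r) * of_bool (q = sw n i r) * pick n i 0 1 0 r:] s"
        unfolding index_blk[OF r entry(2)] by (simp add: distrib_left mult_ac)
    qed
    finally show ?thesis by (simp add: poly_sum)
  qed
  then show ?case by blast
next
  case (add P Q)
  then obtain f f' where "\<forall>s. P (g * blk n i 1 0 s 1) = poly f s" "\<forall>s. Q (g * blk n i 1 0 s 1) = poly f' s" by blast
  then show ?case by (intro exI[of _ "f + f'"]) simp
next
  case (mult P Q)
  then obtain f f' where "\<forall>s. P (g * blk n i 1 0 s 1) = poly f s" "\<forall>s. Q (g * blk n i 1 0 s 1) = poly f' s" by blast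
  then show ?case by (intro exI[of _ "f * f'"]) simp
qed

lemma entry_polys_sum:
  "finite A \<Longrightarrow> (\<And>a. a \<in> A \<Longrightarrow> f a \<in> entry_polys n) \<Longrightarrow> (\<lambda>g. \<Sum>a\<in>A. f a g) \<in> entry_polys n"
proof (induction rule: finite_induct)
  case empty
  show ?case using entry_polys.const[of 0 n] by simp
next
  case (insert a A)
  then show ?case using entry_polys.add[of "f a" n "\<lambda>g. \<Sum>a\<in>A. f a g"] by simp
qed

lemma entry_polys_prod:
  "finite A \<Longrightarrow> (\<And>a. a \<in> A \<Longrightarrow> f a \<in> entry_polys n) \<Longrightarrow> (\<lambda>g. \<Prod>a\<in>A. f a g) \<in> entry_polys n"
proof (induction rule: finite_induct)
  case empty
  show ?case using entry_polys.const[of 1 n] by simp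
next
  case (insert a A)
  then show ?case using entry_polys.mult[of "f a" n "\<lambda>g. \<Prod>a\<in>A. f a g"] by simp
qed

lemma entry_polys_translate:
  assumes "P \<in> entry_polys n" and h: "h \<in> carrier_mat (2 * n) (2 * n)"
  shows "\<exists>P' \<in> entry_polys n. \<forall>g \<in> carrier_mat (2 * n) (2 * n). P (g * h) = P' g"
  using assms(1)
proof (induction rule: entry_polys.induct)
  case (const a)
  show ?case by (rule bexI[OF _ entry_polys.const[of a n]]) simp
next
  case (entry p q)
  have "(g * h) $$ (p, q) = (\<Sum>r<2 * n. g $$ (p, r) * h $$ (r, q))" if "g \<in> carrier_mat (2 * n) (2 * n)" for g
    using that entry h by (simp add: scalar_prod_def atLeast0LessThan)
  moreover have "(\<lambda>g. \<Sum>r<2 * n. g $$ (p, r) * h $$ (r, q)) \<in> entry_polys n"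
    using entry by (intro entry_polys_sum entry_polys.mult entry_polys.entry entry_polys.const) simp_all
  ultimately show ?case by (intro bexI[of _ "\<lambda>g. \<Sum>r<2 * n. g $$ (p, r) * h $$ (r, q)"]) simp_all
next
  case (add P Q)
  then obtain P' Q' where "P' \<in> entry_polys n" "\<forall>g \<in> carrier_mat (2 * n) (2 * n). P (g * h) = P' g"
    "Q' \<in> entry_polys n" "\<forall>g \<in> carrier_mat (2 * n) (2 * n). Q (g * h) = Q' g" by blast
  then show ?case by (intro bexI[of _ "\<lambda>g. P' g + Q' g"] entry_polys.add) simp_all
next
  case (mult P Q)
  then obtain P' Q' where "P' \<in> entry_polys n" "\<forall>g \<in> carrier_mat (2 * n) (2 * n). P (g * h) = P' g"
    "Q' \<in> entry_polys n" "\<forall>g \<in> carrier_mat (2 * n) (2 * n). Q (g * h) = Q' g" by blast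
  then show ?case by (intro bexI[of _ "\<lambda>g. P' g * Q' g"] entry_polys.mult) simp_all
qed

text \<open>A polynomial that vanishes on the big cell \<open>\<Omega>\<close> vanishes on \<open>\<Omega> y\<^sub>i(s)\<close>: as a polynomial in \<open>s\<close> it has
  infinitely many roots. This is the density of \<open>\<Omega>\<close>, as far as it is needed.\<close>

definition preserves_vanishing :: "nat \<Rightarrow> complex mat \<Rightarrow> bool" where
  "preserves_vanishing n w \<longleftrightarrow>
     (\<forall>P \<in> entry_polys n. (\<forall>g \<in> big_cell n. P g = 0) \<longrightarrow> (\<forall>g \<in> big_cell n. P (g * w) = 0))"

text \<open>The right translate P' of P by h is again a polynomial and vanishes on the big cell by
  the assumption on h. The assumption on w is then applied to P'.\<close>

lemma preserves_vanishing_mult: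
  assumes h: "h \<in> carrier_mat (2 * n) (2 * n)" "preserves_vanishing n h"
    and w: "w \<in> carrier_mat (2 * n) (2 * n)" "preserves_vanishing n w"
  shows "preserves_vanishing n (w * h)"
  unfolding preserves_vanishing_def
proof (intro ballI impI)
  fix P g assume P: "P \<in> entry_polys n" "\<forall>g \<in> big_cell n. P g = 0" and g: "g \<in> big_cell n"
  obtain P' where P': "P' \<in> entry_polys n" "\<forall>g \<in> carrier_mat (2 * n) (2 * n). P (g * h) = P' g"
    using entry_polys_translate[OF P(1) h(1)] by blast
  have bc: "g \<in> carrier_mat (2 * n) (2 * n)" if "g \<in> big_cell n" for g
    using that by (intro Sp_carrier_mat big_cell_Sp)
  have "\<forall>g \<in> big_cell n. P' g = 0"
  proof
    fix g assume "g \<in> big_cell n"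
    then have "P (g * h) = 0" using h(2) P unfolding preserves_vanishing_def by blast
    then show "P' g = 0" using P'(2) bc[OF \<open>g \<in> big_cell n\<close>] by simp
  qed
  then have "P' (g * w) = 0" using w(2) P'(1) g unfolding preserves_vanishing_def by blast
  moreover have "g * w \<in> carrier_mat (2 * n) (2 * n)" using bc[OF g] w(1) by simp
  ultimately have "P (g * w * h) = 0" using P'(2) by simp
  then show "P (g * (w * h)) = 0" using bc[OF g] w(1) h(1) by (simp add: mat_assoc_square[of _ "2 * n"])
qed

lemma preserves_vanishing_elem_group: "h \<in> elem_group n \<Longrightarrow> preserves_vanishing n h"
proof (induction rule: elem_group.induct)
  case one
  have "g * 1\<^sub>m (2 * n) = g" if "g \<in> big_cell n" for g
    using Sp_carrier_mat[OF big_cell_Sp[OF that]] by simp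
  then show ?case unfolding preserves_vanishing_def by simp
next
  case (x i h t)
  have "preserves_vanishing n (blk n i 1 t 0 1)"
    unfolding preserves_vanishing_def using big_cell_x[OF _ x(1)] by blast
  then show ?case using preserves_vanishing_mult[OF elem_group_carrier[OF x(2)] x.IH blk_carrier] by blast
next
  case (y i h t)
  have "preserves_vanishing n (blk n i 1 0 t 1)"
    unfolding preserves_vanishing_def
  proof (intro ballI impI)
    fix P g assume P: "P \<in> entry_polys n" "\<forall>g \<in> big_cell n. P g = 0" and g: "g \<in> big_cell n"
    obtain f where f: "\<forall>s. P (g * blk n i 1 0 s 1) = poly f s"
      using entry_poly_y[OF P(1) Sp_carrier_mat[OF big_cell_Sp[OF g]]] by blast
    obtain S where S: "finite S" "\<forall>s. s \<notin> S \<longrightarrow> g * blk n i 1 0 s 1 \<in> big_cell n"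
      using big_cell_y[OF g y(1)] by blast
    have "- S \<subseteq> {s. poly f s = 0}"
    proof
      fix s assume "s \<in> - S"
      then have "P (g * blk n i 1 0 s 1) = 0" using S(2) P(2) by blast
      then show "s \<in> {s. poly f s = 0}" using f by simp
    qed
    moreover have "infinite (- S)" using S(1) infinite_UNIV_char_0 by (simp add: Compl_eq_Diff_UNIV)
    ultimately have "f = 0" using poly_roots_finite[of f] finite_subset by blast
    then show "P (g * blk n i 1 0 t 1) = 0" using f by simp
  qed
  then show ?case using preserves_vanishing_mult[OF elem_group_carrier[OF y(2)] y.IH blk_carrier] by blast
qed

section \<open>Leading principal minors and their uniqueness\<close>

definition lead_minor :: "nat \<Rightarrow> complex mat \<Rightarrow> complex" where
  "lead_minor k g = det (mat k k (\<lambda>(p, q). g $$ (p, q)))"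

lemma lead_minor_entry_polys:
  assumes "k \<le> 2 * n"
  shows "lead_minor k \<in> entry_polys n"
proof -
  have "lead_minor k = (\<lambda>g. \<Sum>\<pi> | \<pi> permutes {0..<k}. signof \<pi> * (\<Prod>i = 0..<k. g $$ (i, \<pi> i)))"
  proof
    fix g :: "complex mat"
    have "\<pi> i < k" if "\<pi> permutes {0..<k}" "i < k" for \<pi> i
      using permutes_in_image[OF that(1)] that(2) by simp
    then show "lead_minor k g = (\<Sum>\<pi> | \<pi> permutes {0..<k}. signof \<pi> * (\<Prod>i = 0..<k. g $$ (i, \<pi> i)))"
      unfolding lead_minor_def by (subst det_def'[of _ k]) (auto intro!: sum.cong prod.cong)
  qed
  moreover have "(\<lambda>g. \<Sum>\<pi> | \<pi> permutes {0..<k}. signof \<pi> * (\<Prod>i = 0..<k. g $$ (i, \<pi> i))) \<in> entry_polys n"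
  proof (intro entry_polys_sum entry_polys.mult entry_polys.const entry_polys_prod entry_polys.entry)
    fix \<pi> i assume "\<pi> \<in> {\<pi>. \<pi> permutes {0..<k}}" "i \<in> {0..<k}"
    moreover from this have "\<pi> i \<in> {0..<k}" using permutes_in_image[of \<pi> "{0..<k}" i] by blast
    ultimately have "i < k" "\<pi> i < k" by (simp_all only: atLeastLessThan_iff)
    then show "i < 2 * n" "\<pi> i < 2 * n" using assms by linarith+
  qed (simp_all add: finite_permutations)
  ultimately show ?thesis by simp
qed

definition lower_uni :: "nat \<Rightarrow> complex mat \<Rightarrow> bool" where
  "lower_uni N g \<longleftrightarrow> (\<forall>p<N. \<forall>q<N. p < q \<longrightarrow> g $$ (p, q) = 0) \<and> (\<forall>p<N. g $$ (p, p) = 1)"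

lemma lower_uni_mult:
  assumes "lower_uni N g" "lower_uni N h" "g \<in> carrier_mat N N" "h \<in> carrier_mat N N"
  shows "lower_uni N (g * h)"
proof -
  have idx: "(g * h) $$ (p, q) = (\<Sum>r<N. g $$ (p, r) * h $$ (r, q))" if "p < N" "q < N" for p q
    using that assms by (simp add: scalar_prod_def atLeast0LessThan)
  have "(g * h) $$ (p, q) = 0" if "p < N" "q < N" "p < q" for p q
  proof -
    have "g $$ (p, r) * h $$ (r, q) = 0" if "r < N" for r
      using assms(1,2) that \<open>p < N\<close> \<open>q < N\<close> \<open>p < q\<close> unfolding lower_uni_def
      by (cases "p < r") auto
    then show ?thesis unfolding idx[OF that(1,2)] by (intro sum.neutral) simp
  qed
  moreover have "(g * h) $$ (p, p) = 1" if "p < N" for p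
  proof -
    have "(g * h) $$ (p, p) = (\<Sum>r<N. if r = p then 1 else 0)"
      unfolding idx[OF that that]
    proof (rule sum.cong[OF refl])
      fix r assume "r \<in> {..<N}"
      then have "r < N" by simp
      then show "g $$ (p, r) * h $$ (r, p) = (if r = p then 1 else 0)"
        using assms(1,2) that unfolding lower_uni_def by (cases r p rule: linorder_cases) auto
    qed
    then show ?thesis using that by simp
  qed
  ultimately show ?thesis by (simp add: lower_uni_def)
qed

lemma blk_lower_uni:
  assumes "i \<in> {1..n}"
  shows "lower_uni (2 * n) (blk n i 1 0 t 1)"
proof -
  obtain u v where uv: "i = Suc u" "2 * n = Suc (Suc (u + v))" "u = v \<or> Suc u < v"
    "i - 1 = u" "2 * n - i - 1 = v" "2 * n - i = Suc v" using assms sw_index by blast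
  have "pick n i 0 t 0 p = 0 \<or> sw n i p < p" for p
    unfolding pick_def sw_def uv(4-6) unfolding uv(1) using uv(3) by auto
  note * = this
  show ?thesis
    unfolding lower_uni_def
  proof (intro conjI allI impI)
    fix p q assume pq: "p < 2 * n" "q < 2 * n" "p < q"
    then have "q \<noteq> p" "pick n i 0 t 0 p = 0 \<or> q \<noteq> sw n i p" using *[of p] by auto
    then show "blk n i 1 0 t 1 $$ (p, q) = 0" unfolding index_blk[OF pq(1,2)] by auto
  next
    fix p assume p: "p < 2 * n"
    have "pick n i 0 t 0 p = 0 \<or> p \<noteq> sw n i p" using *[of p] by linarith
    then show "blk n i 1 0 t 1 $$ (p, p) = 1" unfolding index_blk[OF p p] pick_const by (elim disjE) simp_all
  qed
qed

lemma U_minus_lower: "u \<in> U_minus n \<Longrightarrow> lower_uni (2 * n) u"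
proof (induction rule: U_minus_induct)
  case one
  then show ?case by (simp add: lower_uni_def)
next
  case (gen i t)
  then show ?case by (rule blk_lower_uni)
next
  case (mult u v)
  then show ?case by (intro lower_uni_mult Sp_carrier_mat U_minus_Sp)
qed

lemma U_plus_transpose: "u \<in> U_plus n \<Longrightarrow> u\<^sup>T \<in> U_minus n"
proof (induction rule: U_plus_induct)
  case one
  then show ?case by (simp add: one_U_minus)
next
  case (gen i t)
  then show ?case by (simp add: blk_transpose blk_U_minus)
next
  case (mult u v)
  then show ?case
    using transpose_mult[OF Sp_carrier_mat[OF U_plus_Sp] Sp_carrier_mat[OF U_plus_Sp], of u n v]
    by (simp add: U_minus_mult)
qed

lemma det_lower_uni:
  assumes "lower_uni k g" "g \<in> carrier_mat k k"
  shows "det g = 1"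
proof -
  have "det g = prod_list (diag_mat g)"
    using assms by (intro det_lower_triangular[of k]) (simp_all add: lower_uni_def)
  also have "diag_mat g = map (\<lambda>i. 1) [0..<k]"
    using assms unfolding diag_mat_def lower_uni_def by simp
  also have "prod_list (map (\<lambda>i. 1) [0..<k]) = (1 :: complex)" by (induction k) simp_all
  finally show ?thesis .
qed

text \<open>As u is lower triangular, the first k rows of u M involve only the first k rows of M, so
  taking the top left block is multiplicative here. The blocks of u and of t v are triangular, with
  diagonals 1 and that of t.\<close>

lemma lead_minor_big_cell:
  assumes u: "u \<in> U_minus n" and t: "t \<in> torus n" and v: "v \<in> U_plus n" and k: "k \<le> 2 * n"
  shows "lead_minor k (u * t * v) = fund_char k t"
proof -
  let ?B = "\<lambda>g :: complex mat. mat k k (\<lambda>(p, q). g $$ (p, q))"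
  have c: "u \<in> carrier_mat (2 * n) (2 * n)" "t \<in> carrier_mat (2 * n) (2 * n)" "v \<in> carrier_mat (2 * n) (2 * n)"
    by (intro Sp_carrier_mat torus_Sp U_plus_Sp U_minus_Sp u t v)+
  have lu: "lower_uni (2 * n) u" "lower_uni (2 * n) (v\<^sup>T)"
    by (intro U_minus_lower U_plus_transpose u v)+
  have "u * t * v = u * (t * v)" using c by (simp add: mat_assoc_square[of _ "2 * n"])
  have "?B (u * t * v) = ?B u * ?B (t * v)"
  proof (rule eq_matI)
    fix p q assume "p < dim_row (?B u * ?B (t * v))" "q < dim_col (?B u * ?B (t * v))"
    then have pq: "p < k" "q < k" by simp_all
    then have pq': "p < 2 * n" "q < 2 * n" using k by simp_all
    have "(u * t * v) $$ (p, q) = (\<Sum>r<2 * n. u $$ (p, r) * (t * v) $$ (r, q))"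
      unfolding \<open>u * t * v = u * (t * v)\<close> using c pq' by (subst times_mat_def) (simp add: scalar_prod_def atLeast0LessThan)
    also have "\<dots> = (\<Sum>r<k. u $$ (p, r) * (t * v) $$ (r, q))"
    proof (rule sum.mono_neutral_right)
      show "\<forall>r\<in>{..<2 * n} - {..<k}. u $$ (p, r) * (t * v) $$ (r, q) = 0"
        using lu(1) pq pq' unfolding lower_uni_def by simp
    qed (use k in auto)
    also have "\<dots> = (?B u * ?B (t * v)) $$ (p, q)"
      using pq by (subst (2) times_mat_def) (simp add: scalar_prod_def atLeast0LessThan)
    finally show "?B (u * t * v) $$ (p, q) = (?B u * ?B (t * v)) $$ (p, q)"
      using pq by simp
  qed simp_all
  then have "lead_minor k (u * t * v) = det (?B u) * det (?B (t * v))"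
    unfolding lead_minor_def by (simp add: det_mult[of _ k])
  also have "det (?B u) = 1"
    using lu(1) k by (intro det_lower_uni[of k]) (simp_all add: lower_uni_def)
  also have "det (?B (t * v)) = det ((?B (t * v))\<^sup>T)"
    by (rule det_transpose[symmetric, of _ k]) simp
  also have "\<dots> = prod_list (diag_mat ((?B (t * v))\<^sup>T))"
  proof (rule det_lower_triangular[of k])
    fix p q assume pq: "p < q" "q < k"
    then have pq': "p < 2 * n" "q < 2 * n" using k by simp_all
    have "v $$ (q, p) = 0" using lu(2) pq pq' c unfolding lower_uni_def by (metis carrier_matD index_transpose_mat(1))
    then show "(?B (t * v))\<^sup>T $$ (p, q) = 0" using pq index_mult_torus(2)[OF t c(3) pq'(2,1)] by simp
  qed simp
  also have "diag_mat ((?B (t * v))\<^sup>T) = map (\<lambda>p. t $$ (p, p)) [0..<k]"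
  proof -
    have "(t * v) $$ (p, p) = t $$ (p, p)" if "p < k" for p
    proof -
      have p: "p < 2 * n" using that k by simp
      have "v $$ (p, p) = 1" using lu(2) p c unfolding lower_uni_def by (metis carrier_matD index_transpose_mat(1))
      then show ?thesis using index_mult_torus(2)[OF t c(3) p p] by simp
    qed
    then show ?thesis by (simp add: diag_mat_def)
  qed
  also have "prod_list (map (\<lambda>p. t $$ (p, p)) [0..<k]) = fund_char k t"
    by (simp add: fund_char_def prod.list_conv_set_nth atLeast0LessThan)
  finally show ?thesis by simp
qed

text \<open>The leading minor has the defining property, so the chosen function has it too. Their
  difference is a polynomial on the group that vanishes on the big cell, hence on every translate of
  the identity by \<open>elem_group\<close>.\<close>

lemma princ_minor_eq:
  assumes g: "g \<in> elem_group n" and k: "k \<le> n"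
  shows "princ_minor n k g = lead_minor k g"
proof -
  let ?Q = "\<lambda>F. regular_fun n F \<and>
     (\<forall>u \<in> U_minus n. \<forall>t \<in> torus n. \<forall>u' \<in> U_plus n. F (u * t * u') = fund_char k t)"
  have poly: "lead_minor k \<in> entry_polys n" using k by (intro lead_minor_entry_polys) simp
  have "?Q (lead_minor k)"
    using lead_minor_big_cell[of _ n _ _ k] k poly unfolding regular_fun_def by auto
  then have F: "?Q (princ_minor n k)" unfolding princ_minor_def by (rule someI[of ?Q])
  then obtain P where P: "P \<in> entry_polys n" "\<forall>g \<in> carrier (Sp n). princ_minor n k g = P g"
    unfolding regular_fun_def by blast
  define R where "R = (\<lambda>g. P g + (-1) * lead_minor k g)"
  have R: "R \<in> entry_polys n" unfolding R_def by (intro entry_polys.add entry_polys.mult entry_polys.const P poly)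
  have "\<forall>g \<in> big_cell n. R g = 0"
  proof
    fix g assume g: "g \<in> big_cell n"
    then obtain u t v where "g = u * t * v" "u \<in> U_minus n" "t \<in> torus n" "v \<in> U_plus n"
      unfolding big_cell_def by blast
    then have "princ_minor n k g = lead_minor k g" using F lead_minor_big_cell[of u n t v k] k by simp
    then show "R g = 0" using P(2) big_cell_Sp[OF g] by (simp add: R_def)
  qed
  moreover have one: "1\<^sub>m (2 * n) \<in> big_cell n"
  proof -
    have "1\<^sub>m (2 * n) = 1\<^sub>m (2 * n) * 1\<^sub>m (2 * n) * (1\<^sub>m (2 * n) :: complex mat)" by simp
    then show ?thesis unfolding big_cell_def using one_U_minus one_torus one_U_plus by blast
  qed
  ultimately have "R (1\<^sub>m (2 * n) * g) = 0"
    using preserves_vanishing_elem_group[OF g] R unfolding preserves_vanishing_def by blast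
  then have "R g = 0" using elem_group_carrier[OF g] by simp
  then show ?thesis using P(2) elem_group_Sp[OF g] by (simp add: R_def)
qed

section \<open>Rows of the lower triangular factorization\<close>

definition cox_tail :: "nat \<Rightarrow> (nat \<Rightarrow> complex) \<Rightarrow> nat \<Rightarrow> complex mat" where
  "cox_tail n a i = mat_list_prod n (map (\<lambda>i. Y_sub n i (a i)) [i..<Suc n])"

text \<open>The product \<open>L\<^sub>m \<cdots> L\<^sub>n\<close>; the empty product at m = n + 1
  starts the inductions on the number of factors.\<close>

definition Theta_tail :: "nat \<Rightarrow> (int \<Rightarrow> nat \<Rightarrow> complex) \<Rightarrow> nat \<Rightarrow> complex mat" where
  "Theta_tail n c m = mat_list_prod n (map (\<lambda>m. cox_tail n (c (int m)) 1) [m..<Suc n])"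

lemma Y_sub_carrier: "i \<in> {1..n} \<Longrightarrow> Y_sub n i a \<in> carrier_mat (2 * n) (2 * n)"
  by (simp add: Y_sub_blk)

lemma cox_tail_carrier: "1 \<le> i \<Longrightarrow> cox_tail n a i \<in> carrier_mat (2 * n) (2 * n)"
  unfolding cox_tail_def by (intro mat_list_prod_carrier) (auto intro!: Y_sub_carrier)

lemma Theta_tail_carrier: "Theta_tail n c m \<in> carrier_mat (2 * n) (2 * n)"
  unfolding Theta_tail_def by (intro mat_list_prod_carrier) (auto intro!: cox_tail_carrier)

lemma mat_list_prod_concat:
  "set (concat gss) \<subseteq> carrier_mat (2 * n) (2 * n) \<Longrightarrow>
   mat_list_prod n (concat gss) = mat_list_prod n (map (mat_list_prod n) gss)"
proof (induction gss)
  case (Cons gs gss)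
  then have "set gs \<subseteq> carrier_mat (2 * n) (2 * n)" "set (concat gss) \<subseteq> carrier_mat (2 * n) (2 * n)" by simp_all
  then show ?case using Cons.IH mat_list_prod_append[of gs n "concat gss"] by simp
qed simp

lemma Theta_eq_tail: "Theta n c = Theta_tail n c 1"
proof -
  have "Y_sub n i a \<in> carrier_mat (2 * n) (2 * n)" if "i \<in> set [1..<Suc n]" for i a
    using that by (intro Y_sub_carrier) auto
  then have "set (concat (map (\<lambda>m. map (\<lambda>i. Y_sub n i (c (int m) i)) [1..<Suc n]) [1..<Suc n])) \<subseteq> carrier_mat (2 * n) (2 * n)"
    by (auto simp del: upt_Suc)
  then show ?thesis
    unfolding Theta_def Theta_tail_def cox_tail_def by (subst mat_list_prod_concat) (simp_all add: comp_def del: upt_Suc)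
qed

lemma Theta_tail_end: "Theta_tail n c (Suc n) = 1\<^sub>m (2 * n)"
  by (simp add: Theta_tail_def)

lemma Theta_tail_rec: "m \<le> n \<Longrightarrow> Theta_tail n c m = cox_tail n (c (int m)) 1 * Theta_tail n c (Suc m)"
  unfolding Theta_tail_def using upt_conv_Cons[of m "Suc n"] by (simp del: upt_Suc)

lemma Theta_elem_group:
  assumes "\<forall>k \<in> {1..int n}. \<forall>i \<in> {1..n}. c k i \<noteq> 0"
  shows "Theta n c \<in> elem_group n"
proof -
  have "set (concat (map (\<lambda>m. map (\<lambda>i. Y_sub n i (c (int m) i)) [1..<Suc n]) [1..<Suc n])) \<subseteq> elem_group n"
    using assms by (auto intro!: Y_sub_elem_group simp del: upt_Suc)
  then show ?thesis unfolding Theta_def by (rule mat_list_prod_elem_group)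
qed

text \<open>Letters are prepended from i = n downwards, and Y_i changes only the rows v_i, v_{i+1},
  vbar_{i+1}, vbar_i (v_n and vbar_n for i = n). In the barred half each letter adds the partial sum
  from the row below its own label to the next row and then divides the former by a_i. The index
  \<open>p - 1\<close> is used only for p > 0, because \<open>i \<ge> 1\<close>.\<close>

lemma cox_tail_rows:
  assumes nz: "\<And>j. j \<in> {1..n} \<Longrightarrow> a j \<noteq> 0" and B: "B \<in> carrier_mat (2 * n) (2 * n)" and q: "q < 2 * n"
    and "1 \<le> i" "i \<le> Suc n"
  defines "R \<equiv> \<lambda>j. B $$ (n - 1, q) + (\<Sum>l = j..n. a l * B $$ (2 * n - l, q))"
  shows "(\<forall>p<n. (cox_tail n a i * B) $$ (p, q) = (if Suc p < i then B $$ (p, q)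
       else if Suc p = i then B $$ (p, q) / a i
       else a p / a (Suc p) * B $$ (p, q) + B $$ (p - 1, q))) \<and>
    (\<forall>j \<in> {1..n}. (cox_tail n a i * B) $$ (2 * n - j, q) = (if j < i then B $$ (2 * n - j, q)
       else if j = i then R j else R j / a (j - 1)))"
  using \<open>i \<le> Suc n\<close> \<open>1 \<le> i\<close>
proof (induction rule: inc_induct)
  case base
  have "cox_tail n a (Suc n) * B = B" using B by (simp add: cox_tail_def)
  then show ?case by simp
next
  case (step i)
  define X where "X = cox_tail n a (Suc i) * B"
  have i: "i \<in> {1..n}" using step by simp
  have X: "X \<in> carrier_mat (2 * n) (2 * n)"
    unfolding X_def using cox_tail_carrier[of "Suc i" n a] B by simp
  have IH1: "X $$ (p, q) = (if Suc p < Suc i then B $$ (p, q) else if Suc p = Suc i then B $$ (p, q) / a (Suc i)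
       else a p / a (Suc p) * B $$ (p, q) + B $$ (p - 1, q))" if "p < n" for p
    using step.IH that unfolding X_def by simp
  have IH2: "X $$ (2 * n - j, q) = (if j < Suc i then B $$ (2 * n - j, q)
       else if j = Suc i then R j else R j / a (j - 1))" if "j \<in> {1..n}" for j
    using step.IH that unfolding X_def by simp
  have eq: "cox_tail n a i * B = blk n i (inverse (a i)) 0 1 (a i) * X"
  proof -
    have "cox_tail n a i = Y_sub n i (a i) * cox_tail n a (Suc i)"
      unfolding cox_tail_def using upt_conv_Cons[of i "Suc n"] i by (simp del: upt_Suc)
    moreover have "Y_sub n i (a i) = blk n i (inverse (a i)) 0 1 (a i)"
      using nz[OF i] by (simp add: Y_sub_blk[OF i])
    ultimately show ?thesis
      unfolding X_def using cox_tail_carrier[of "Suc i" n a] B by (simp add: mat_assoc_square[of _ "2 * n"])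
  qed
  have row: "(cox_tail n a i * B) $$ (p, q) =
      pick n i (inverse (a i)) (a i) 1 p * X $$ (p, q) + pick n i 0 1 0 p * X $$ (sw n i p, q)" if "p < 2 * n" for p
    unfolding eq using X q that by (intro blk_mult_index[OF i]) simp_all
  obtain u v where uv: "i = Suc u" "2 * n = Suc (Suc (u + v))" "u = v \<or> Suc u < v"
    "i - 1 = u" "2 * n - i - 1 = v" "2 * n - i = Suc v" using i by (rule sw_index)
  have row_u: "(cox_tail n a i * B) $$ (p, q) = X $$ (p, q) / a i" if "p = u \<or> p = v" for p
  proof -
    have "p < 2 * n" using that uv(2) by auto
    moreover have "pick n i x y z p = x" for x y z :: complex
      unfolding pick_def uv(4-6) using that by simp
    ultimately show ?thesis using row[of p] by (simp add: field_simps)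
  qed
  have row_d: "(cox_tail n a i * B) $$ (p, q) = a i * X $$ (p, q) + X $$ (p - 1, q)" if "p = Suc u \<or> p = Suc v" for p
  proof -
    have p: "p < 2 * n" using that uv(2) by auto
    have pd: "p = i \<or> p = 2 * n - i" unfolding uv(6) using that uv(1) by simp
    have "sw n i p = p - 1"
      using pd sw_simple(2,3)[OF i] by (elim disjE) simp_all
    then show ?thesis using row[OF p] by (simp add: pick_low[OF i pd])
  qed
  have row_o: "(cox_tail n a i * B) $$ (p, q) = X $$ (p, q)"
    if "p < 2 * n" "p \<noteq> u" "p \<noteq> Suc u" "p \<noteq> v" "p \<noteq> Suc v" for p
  proof -
    have "pick n i x y z p = z" for x y z :: complex
      unfolding pick_def uv(4-6) unfolding uv(1) using that by simp
    then show ?thesis using row[OF that(1)] by simp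
  qed
  have nv: "n \<le> Suc v" "u < n" using uv(2,3) by linarith+
  show ?case
  proof (intro conjI allI impI ballI)
    fix p assume p: "p < n"
    consider "p = u" | "p = Suc u" | "p \<noteq> u" "p \<noteq> Suc u" by blast
    then show "(cox_tail n a i * B) $$ (p, q) = (if Suc p < i then B $$ (p, q) else if Suc p = i then B $$ (p, q) / a i
       else a p / a (Suc p) * B $$ (p, q) + B $$ (p - 1, q))"
    proof cases
      case 1
      then show ?thesis using row_u[of p] IH1[OF p] uv(1) by simp
    next
      case 2
      have "X $$ (p - 1, q) = B $$ (p - 1, q)" using IH1[of "p - 1"] 2 p uv(1) by simp
      then show ?thesis using row_d[of p] IH1[OF p] 2 uv(1) by simp
    next
      case 3
      have "p \<noteq> Suc v" using p nv(1) by simp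
      moreover have "p \<noteq> v" using p nv(1) 3 uv(2,3) by linarith
      ultimately have "(cox_tail n a i * B) $$ (p, q) = X $$ (p, q)" using 3 p by (intro row_o) simp_all
      then show ?thesis using IH1[OF p] 3 uv(1) by (auto split: if_splits)
    qed
  next
    fix j assume j: "j \<in> {1..n}"
    consider "j = i" | "j = Suc i" | "j \<noteq> i" "j \<noteq> Suc i" by blast
    then show "(cox_tail n a i * B) $$ (2 * n - j, q) = (if j < i then B $$ (2 * n - j, q)
       else if j = i then R j else R j / a (j - 1))"
    proof cases
      case 1
      have "2 * n - j = Suc v" using 1 uv(6) by simp
      then have "(cox_tail n a i * B) $$ (2 * n - j, q) = a i * X $$ (2 * n - i, q) + X $$ (v, q)"
        using row_d[of "2 * n - j"] 1 by simp
      also have "X $$ (2 * n - i, q) = B $$ (2 * n - i, q)" using IH2[OF i] by simp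
      \<comment> \<open>For i = n the row preceding vbar_n is v_n, still equal to the row of B, and
        the sum in \<open>R (Suc n)\<close> is empty.\<close>
      also have "X $$ (v, q) = R (Suc i)"
      proof (cases "i = n")
        case True
        then have "v = n - 1" using uv(5) by simp
        then show ?thesis using IH1[of v] i True by (simp add: R_def)
      next
        case False
        then have "Suc i \<in> {1..n}" using i by simp
        moreover have "2 * n - Suc i = v" using uv(5) by simp
        ultimately show ?thesis using IH2[of "Suc i"] by simp
      qed
      also have "a i * B $$ (2 * n - i, q) + R (Suc i) = R i"
      proof -
        have "{i..n} = insert i {Suc i..n}" using i by auto
        then show ?thesis by (simp add: R_def)
      qed
      finally show ?thesis using 1 by simp
    next
      case 2
      have "2 * n - j = v" using 2 uv(5) by simp
      then show ?thesis using row_u[of "2 * n - j"] IH2[OF j] 2 by simp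
    next
      case 3
      have "2 * n - j \<noteq> Suc v" "2 * n - j \<noteq> v" "2 * n - j < 2 * n" "2 * n - j \<noteq> u" "2 * n - j \<noteq> Suc u"
        using 3 j uv(1,2,3) unfolding atLeastAtMost_iff by linarith+
      then have "(cox_tail n a i * B) $$ (2 * n - j, q) = X $$ (2 * n - j, q)" by (intro row_o)
      then show ?thesis using IH2[OF j] 3 by (auto split: if_splits)
    qed
  qed
qed

text \<open>The convention \<open>c\<^sub>0\<^sup>(\<^sup>m\<^sup>) = 1\<close>.\<close>

definition cpad :: "(int \<Rightarrow> nat \<Rightarrow> complex) \<Rightarrow> nat \<Rightarrow> nat \<Rightarrow> complex" where
  "cpad c m j = (if j = 0 then 1 else c (int m) j)"

section \<open>Leading entries of the tails and the row recursion\<close>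

context
  fixes n :: nat and c :: "int \<Rightarrow> nat \<Rightarrow> complex" and T :: "nat \<Rightarrow> complex mat" and z :: "nat \<Rightarrow> nat \<Rightarrow> complex"
  assumes nz: "\<forall>k \<in> {1..int n}. \<forall>i \<in> {1..n}. c k i \<noteq> 0" and n: "n \<ge> 1"
  defines "T \<equiv> Theta_tail n c" and "z \<equiv> cpad c"
begin

lemma z_nonzero: "1 \<le> m \<Longrightarrow> m \<le> n \<Longrightarrow> j \<le> n \<Longrightarrow> z m j \<noteq> 0"
  using nz by (auto simp: z_def cpad_def)

lemma one_le_Suc: "1 \<le> Suc n"
  by simp

lemma tail_row_upper:
  assumes m: "1 \<le> m" "m \<le> n" and p: "p < n" and q: "q < 2 * n"
  shows "T m $$ (p, q) = z m p / z m (Suc p) * T (Suc m) $$ (p, q) + (if p = 0 then 0 else T (Suc m) $$ (p - 1, q))"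
proof -
  have "\<And>j. j \<in> {1..n} \<Longrightarrow> c (int m) j \<noteq> 0" using nz m by simp
  from cox_tail_rows[OF this Theta_tail_carrier[of n c "Suc m"] q order_refl one_le_Suc]
  show ?thesis
    unfolding T_def Theta_tail_rec[OF m(2)] using p by (cases "p = 0") (simp_all add: z_def cpad_def)
qed

lemma tail_row_lower:
  assumes m: "1 \<le> m" "m \<le> n" and j: "1 \<le> j" "j \<le> n" and q: "q < 2 * n"
  shows "T m $$ (2 * n - j, q) =
    (T (Suc m) $$ (n - 1, q) + (\<Sum>l = j..n. z m l * T (Suc m) $$ (2 * n - l, q))) / z m (j - 1)"
proof -
  have "\<And>j. j \<in> {1..n} \<Longrightarrow> c (int m) j \<noteq> 0" using nz m by simp
  note rows = cox_tail_rows[OF this Theta_tail_carrier[of n c "Suc m"] q order_refl one_le_Suc]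
  have "(\<Sum>l = j..n. z m l * T (Suc m) $$ (2 * n - l, q)) =
      (\<Sum>l = j..n. c (int m) l * Theta_tail n c (Suc m) $$ (2 * n - l, q))"
    using j by (intro sum.cong) (simp_all add: z_def cpad_def T_def)
  then show ?thesis
    unfolding T_def Theta_tail_rec[OF m(2)] using conjunct2[OF rows] j by (cases "j = 1") (simp_all add: z_def cpad_def)
qed

lemma tail_end: "T (Suc n) = 1\<^sub>m (2 * n)"
  unfolding T_def by (rule Theta_tail_end)

text \<open>A tail with r factors is considered. Each factor adds the row p - 1 to a multiple of row
  p, so the leading 1 moves one column to the left, and the entry after it collects one ratio per
  factor. The bound \<open>r \<le> p\<close> keeps that 1 inside the matrix.\<close>

lemma tail_upper:
  assumes "r \<le> n" "p < n"
  shows "(\<forall>q<2 * n. q + r < p \<longrightarrow> T (Suc n - r) $$ (p, q) = 0) \<and>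
    (r \<le> p \<longrightarrow> T (Suc n - r) $$ (p, p - r) = 1 \<and>
      T (Suc n - r) $$ (p, Suc p - r) = (\<Sum>i<r. z (Suc n - r + i) (p - i) / z (Suc n - r + i) (Suc (p - i))))"
  using assms
proof (induction r arbitrary: p)
  case 0
  then show ?case by (simp add: tail_end)
next
  case (Suc r)
  define m where "m = n - r"
  have m: "1 \<le> m" "m \<le> n" "Suc n - Suc r = m" "Suc n - r = Suc m" using Suc.prems by (auto simp: m_def)
  have r: "r \<le> n" using Suc.prems by simp
  note IH = Suc.IH[OF r, unfolded m(4)]
  show ?case unfolding m(3)
  proof (intro conjI allI impI)
    fix q assume q: "q < 2 * n" "q + Suc r < p"
    then have "p \<noteq> 0" by simp
    have "T (Suc m) $$ (p, q) = 0" using IH[OF Suc.prems(2)] q by simp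
    moreover have "T (Suc m) $$ (p - 1, q) = 0" using IH[of "p - 1"] Suc.prems(2) q by simp
    ultimately show "T m $$ (p, q) = 0" using tail_row_upper[OF m(1,2) Suc.prems(2) q(1)] by simp
  next
    assume r': "Suc r \<le> p"
    then have p: "p \<noteq> 0" "p - Suc r < 2 * n" using Suc.prems(2) by simp_all
    have "T (Suc m) $$ (p, p - Suc r) = 0" using IH[OF Suc.prems(2)] r' p by simp
    moreover have "T (Suc m) $$ (p - 1, p - Suc r) = 1" using IH[of "p - 1"] Suc.prems(2) r' by simp
    ultimately show "T m $$ (p, p - Suc r) = 1" using tail_row_upper[OF m(1,2) Suc.prems(2) p(2)] p by simp
  next
    assume r': "Suc r \<le> p"
    then have p: "p \<noteq> 0" "Suc p - Suc r < 2 * n" "r \<le> p" "r \<le> p - 1" "p - 1 < n" "Suc (p - 1) - r = p - r"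
      using Suc.prems(2) by simp_all
    have "T (Suc m) $$ (p, p - r) = 1" using IH[OF Suc.prems(2)] p(3) by simp
    moreover have "T (Suc m) $$ (p - 1, p - r) = (\<Sum>i<r. z (Suc m + i) (p - 1 - i) / z (Suc m + i) (Suc (p - 1 - i)))"
      using IH[OF p(5)] p(4) unfolding p(6) by blast
    ultimately have "T m $$ (p, Suc p - Suc r) = z m p / z m (Suc p) +
        (\<Sum>i<r. z (Suc m + i) (p - 1 - i) / z (Suc m + i) (Suc (p - 1 - i)))"
      using tail_row_upper[OF m(1,2) Suc.prems(2) p(2)] p(1) by simp
    then show "T m $$ (p, Suc p - Suc r) = (\<Sum>i<Suc r. z (m + i) (p - i) / z (m + i) (Suc (p - i)))"
      unfolding sum.lessThan_Suc_shift by simp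
  qed
qed

text \<open>In the next tail the row v_n starts one column before all barred rows. It alone produces
  the leading entry, and the division in \<open>tail_row_lower\<close> gives its value.\<close>

lemma tail_lower:
  assumes "r \<le> n" "1 \<le> j" "j \<le> n"
  shows "(\<forall>q<2 * n. q + r < n \<longrightarrow> T (Suc n - r) $$ (2 * n - j, q) = 0) \<and>
    (1 \<le> r \<longrightarrow> T (Suc n - r) $$ (2 * n - j, n - r) = 1 / z (Suc n - r) (j - 1))"
  using assms
proof (induction r arbitrary: j)
  case 0
  then show ?case by (simp add: tail_end)
next
  case (Suc r)
  define m where "m = n - r"
  have m: "1 \<le> m" "m \<le> n" "Suc n - Suc r = m" "Suc n - r = Suc m" using Suc.prems by (auto simp: m_def)
  have r: "r \<le> n" "n - 1 < n" using Suc.prems by simp_all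
  note IH = Suc.IH[OF r(1), unfolded m(4)]
  note up = tail_upper[OF r, unfolded m(4)]
  have sum0: "(\<Sum>l = j..n. z m l * T (Suc m) $$ (2 * n - l, q)) = 0" if "q < 2 * n" "q + r < n" for q
    using IH that Suc.prems by (intro sum.neutral) simp
  show ?case unfolding m(3)
  proof (intro conjI allI impI)
    fix q assume q: "q < 2 * n" "q + Suc r < n"
    have "T (Suc m) $$ (n - 1, q) = 0" using up q by simp
    then show "T m $$ (2 * n - j, q) = 0"
      using tail_row_lower[OF m(1,2) Suc.prems(2,3) q(1)] sum0[OF q(1)] q(2) by simp
  next
    have q: "n - Suc r < 2 * n" "n - Suc r + r < n" using Suc.prems by simp_all
    have "T (Suc m) $$ (n - 1, n - Suc r) = 1" using up Suc.prems by simp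
    then show "T m $$ (2 * n - j, n - Suc r) = 1 / z m (j - 1)"
      using tail_row_lower[OF m(1,2) Suc.prems(2,3) q(1)] sum0[OF q] by simp
  qed
qed

text \<open>This is the row Q_{1,k}, split by \<open>tail_row_lower\<close> for j = 1. In column k
  (counted from 0) the barred rows contribute their leading entries and v_n contributes the entry
  after its leading 1. For k = n the next tail is the identity and only the row vbar_n
  contributes.\<close>

lemma last_row:
  assumes k: "1 \<le> k" "k \<le> n"
  shows "q < k - 1 \<Longrightarrow> T k $$ (2 * n - 1, q) = 0"
    and "T k $$ (2 * n - 1, k - 1) = 1"
    and "k < n \<Longrightarrow> T k $$ (2 * n - 1, k) =
      (\<Sum>j = 1..n. z k j / z (Suc k) (j - 1)) +
      (\<Sum>j = Suc k..n. z (k + n - j + 1) (j - 1) / z (k + n - j + 1) j)"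
    and "k = n \<Longrightarrow> T k $$ (2 * n - 1, n) = z n n"
proof -
  have row: "T k $$ (2 * n - 1, q) =
    T (Suc k) $$ (n - 1, q) + (\<Sum>l = 1..n. z k l * T (Suc k) $$ (2 * n - l, q))" if "q < 2 * n" for q
    using tail_row_lower[OF k order_refl n that] by (simp add: z_def cpad_def)
  define r where "r = n - k"
  have r: "r \<le> n" "Suc n - r = Suc k" "n - 1 < n" "n - r = k" using k by (auto simp: r_def)
  note up = tail_upper[OF r(1,3), unfolded r(2)] and lo = tail_lower[OF r(1), unfolded r(2)]
  have low0: "(\<Sum>l = 1..n. z k l * T (Suc k) $$ (2 * n - l, q)) = 0" if "q < k" for q
    using lo that k by (intro sum.neutral) (simp add: r_def)
  show "T k $$ (2 * n - 1, q) = 0" if "q < k - 1"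
  proof -
    have "T (Suc k) $$ (n - 1, q) = 0" using up that k by (simp add: r_def)
    then show ?thesis using row[of q] low0[of q] that k by simp
  qed
  show "T k $$ (2 * n - 1, k - 1) = 1"
  proof -
    have "n - 1 - r = k - 1" "r \<le> n - 1" using k by (auto simp: r_def)
    then have "T (Suc k) $$ (n - 1, k - 1) = 1" using up by simp
    then show ?thesis using row[of "k - 1"] low0[of "k - 1"] k by simp
  qed
  show "T k $$ (2 * n - 1, k) = (\<Sum>j = 1..n. z k j / z (Suc k) (j - 1)) +
      (\<Sum>j = Suc k..n. z (k + n - j + 1) (j - 1) / z (k + n - j + 1) j)" if "k < n"
  proof -
    have e: "Suc (n - 1) - r = k" "r \<le> n - 1" "1 \<le> r" using k that by (auto simp: r_def)
    have "T (Suc k) $$ (n - 1, k) = (\<Sum>i<r. z (Suc k + i) (n - 1 - i) / z (Suc k + i) (Suc (n - 1 - i)))"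
      using up e by simp
    also have "\<dots> = (\<Sum>j = Suc k..n. z (k + n - j + 1) (j - 1) / z (k + n - j + 1) j)"
    \<comment> \<open>With j = n - i the superscript k + 1 + i becomes k + n - j + 1.\<close>
    proof (rule sum.reindex_bij_witness[of _ "\<lambda>j. n - j" "\<lambda>i. n - i"])
      fix i assume "i \<in> {..<r}"
      then have i: "i < n - k" by (simp add: r_def)
      then show "n - (n - i) = i" "n - i \<in> {Suc k..n}" by auto
      have "k + n - (n - i) + 1 = Suc k + i" "n - i - 1 = n - 1 - i" "Suc (n - 1 - i) = n - i" using i by auto
      then show "z (k + n - (n - i) + 1) (n - i - 1) / z (k + n - (n - i) + 1) (n - i) =
         z (Suc k + i) (n - 1 - i) / z (Suc k + i) (Suc (n - 1 - i))" by simp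
    qed (auto simp: r_def)
    moreover have "(\<Sum>l = 1..n. z k l * T (Suc k) $$ (2 * n - l, k)) = (\<Sum>j = 1..n. z k j / z (Suc k) (j - 1))"
    proof (rule sum.cong[OF refl])
      fix l assume "l \<in> {1..n}"
      then have "T (Suc k) $$ (2 * n - l, k) = 1 / z (Suc k) (l - 1)" using lo[of l] e(3) r(4) by simp
      then show "z k l * T (Suc k) $$ (2 * n - l, k) = z k l / z (Suc k) (l - 1)" by simp
    qed
    ultimately show ?thesis using row[of k] that by simp
  qed
  show "T k $$ (2 * n - 1, n) = z n n" if "k = n"
  proof -
    have "(\<Sum>l = 1..n. z n l * T (Suc n) $$ (2 * n - l, n)) = (\<Sum>l = 1..n. if l = n then z n n else 0)"
      unfolding tail_end using n by (intro sum.cong) auto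
    then show ?thesis using row[of n] that n by (simp add: tail_end)
  qed
qed

text \<open>The numerators in \<open>tail_row_lower\<close> for j and j + 1 are partial sums that
  differ by one term, a multiple of the row vbar_j of the next tail.\<close>

lemma row_recursion:
  assumes m: "1 \<le> m" "m \<le> n" and j: "1 \<le> j" "Suc j \<le> n" and q: "q < 2 * n"
  shows "T m $$ (2 * n - Suc j, q) = z m (j - 1) / z m j * T m $$ (2 * n - j, q) - T (Suc m) $$ (2 * n - j, q)"
proof -
  have jn: "j \<le> n" "1 \<le> Suc j" using j by simp_all
  have nz: "z m (j - 1) \<noteq> 0" "z m j \<noteq> 0" using z_nonzero m jn by simp_all
  have "{j..n} = insert j {Suc j..n}" using j by auto
  then show ?thesis
    unfolding tail_row_lower[OF m j(1) jn(1) q] tail_row_lower[OF m jn(2) j(2) q] using nz by (simp add: field_simps)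
qed

text \<open>A step down in the row label is traded for a step in m, so the claim is needed for all
  m. The sign (-1)^d normalizes the coefficient of Q_{1,m+d} to 1, and the coefficient before it
  collects one ratio from each step.\<close>

lemma row_expansion:
  assumes "1 \<le> m" "m + d \<le> n"
  shows "\<exists>u. (\<forall>q<2 * n. (-1) ^ d * T m $$ (2 * n - Suc d, q) =
      T (m + d) $$ (2 * n - 1, q) + (\<Sum>i<d. u i * T (m + i) $$ (2 * n - 1, q))) \<and>
    (1 \<le> d \<longrightarrow> u (d - 1) = - (\<Sum>l = 1..d. z (m + d - l) (l - 1) / z (m + d - l) l))"
  using assms
proof (induction d arbitrary: m)
  case 0
  then show ?case by simp
next
  case (Suc d)
  then have prems: "1 \<le> m" "m + d \<le> n" "1 \<le> Suc m" "Suc m + d \<le> n" "m \<le> n" "1 \<le> Suc d" "Suc (Suc d) \<le> n" by simp_all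
  obtain u where u: "\<forall>q<2 * n. (-1) ^ d * T m $$ (2 * n - Suc d, q) =
      T (m + d) $$ (2 * n - 1, q) + (\<Sum>i<d. u i * T (m + i) $$ (2 * n - 1, q))"
    using Suc.IH[OF prems(1,2)] by blast
  obtain v where v: "\<forall>q<2 * n. (-1) ^ d * T (Suc m) $$ (2 * n - Suc d, q) =
      T (Suc m + d) $$ (2 * n - 1, q) + (\<Sum>i<d. v i * T (Suc m + i) $$ (2 * n - 1, q))"
    "1 \<le> d \<longrightarrow> v (d - 1) = - (\<Sum>l = 1..d. z (Suc m + d - l) (l - 1) / z (Suc m + d - l) l)"
    using Suc.IH[OF prems(3,4)] by blast
  define \<alpha> where "\<alpha> = z m d / z m (Suc d)"
  \<comment> \<open>The coefficients v belong to m + 1 and are shifted by one place. The value 1 at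
    i = d is the leading coefficient of the expansion for m, so w at d is v at d - 1 minus
    \<open>\<alpha>\<close>, the new term l = d + 1.\<close>
  define w where "w = (\<lambda>i. (if i = 0 then 0 else v (i - 1)) - \<alpha> * (if i < d then u i else 1))"
  have "(-1) ^ Suc d * T m $$ (2 * n - Suc (Suc d), q) =
      T (m + Suc d) $$ (2 * n - 1, q) + (\<Sum>i<Suc d. w i * T (m + i) $$ (2 * n - 1, q))" if q: "q < 2 * n" for q
  proof -
    let ?t = "\<lambda>i. T (m + i) $$ (2 * n - 1, q)"
    have "(\<Sum>i<Suc d. w i * ?t i) = (\<Sum>i<Suc d. (if i = 0 then 0 else v (i - 1)) * ?t i) -
        \<alpha> * (\<Sum>i<Suc d. (if i < d then u i else 1) * ?t i)"
      by (simp only: w_def left_diff_distrib sum_subtractf sum_distrib_left mult.assoc)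
    also have "(\<Sum>i<Suc d. (if i = 0 then 0 else v (i - 1)) * ?t i) = (\<Sum>i<d. v i * ?t (Suc i))"
      unfolding sum.lessThan_Suc_shift by simp
    also have "(\<Sum>i<Suc d. (if i < d then u i else 1) * ?t i) = (\<Sum>i<d. u i * ?t i) + ?t d"
    proof -
      have "(\<Sum>i<d. (if i < d then u i else 1) * ?t i) = (\<Sum>i<d. u i * ?t i)" by (intro sum.cong) simp_all
      then show ?thesis unfolding sum.lessThan_Suc by simp
    qed
    finally have w: "(\<Sum>i<Suc d. w i * ?t i) = (\<Sum>i<d. v i * ?t (Suc i)) - \<alpha> * ((\<Sum>i<d. u i * ?t i) + ?t d)" .
    have "(-1) ^ Suc d * T m $$ (2 * n - Suc (Suc d), q) =
       (-1) ^ d * T (Suc m) $$ (2 * n - Suc d, q) - \<alpha> * ((-1) ^ d * T m $$ (2 * n - Suc d, q))"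
      unfolding row_recursion[OF prems(1,5,6,7) q] \<alpha>_def by (simp add: algebra_simps)
    also have "\<dots> = ?t (Suc d) + (\<Sum>i<d. v i * ?t (Suc i)) - \<alpha> * (?t d + (\<Sum>i<d. u i * ?t i))"
      using u v(1) q by simp
    finally show ?thesis unfolding w by (simp add: algebra_simps)
  qed
  moreover have "w d = - (\<Sum>l = 1..Suc d. z (m + Suc d - l) (l - 1) / z (m + Suc d - l) l)"
  proof (cases "d = 0")
    case True
    then show ?thesis by (simp add: w_def \<alpha>_def)
  next
    case False
    then have "w d = v (d - 1) - \<alpha>" by (simp add: w_def)
    then show ?thesis using v(2) False by (simp add: \<alpha>_def)
  qed
  ultimately show ?case by (intro exI[of _ w]) simp
qed

end

section \<open>The monomial realization of the vector representation\<close>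

text \<open>The variable \<open>c\<^sub>i\<^sup>(\<^sup>a\<^sup>)\<close>, with the convention \<open>c\<^sub>0\<^sup>(\<^sup>a\<^sup>) = 1\<close>.\<close>

definition cv :: "int \<Rightarrow> nat \<Rightarrow> monomial" where
  "cv a i = (if i = 0 then 0 else Poly_Mapping.single (a, i) 1)"

lemma cvar_cv: "i \<noteq> 0 \<Longrightarrow> cvar a i = cv a i"
  by (simp add: cvar_def cv_def)

lemma partial_exp_ratio:
  assumes "i \<noteq> 0" "i \<noteq> j"
  shows "partial_exp (cv a i - cv b j) i m = of_bool (a \<le> m)"
proof -
  let ?Y = "cv a i - cv b j"
  have look: "Poly_Mapping.lookup ?Y (k, i) = of_bool (k = a)" for k
    using assms by (auto simp: cv_def lookup_minus lookup_single when_def)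
  have "{x \<in> Poly_Mapping.keys ?Y. snd x = i \<and> fst x \<le> m} = (if a \<le> m then {(a, i)} else {})"
  proof (rule Set.set_eqI, rule iffI)
    fix x assume "x \<in> {x \<in> Poly_Mapping.keys ?Y. snd x = i \<and> fst x \<le> m}"
    then have "Poly_Mapping.lookup ?Y (fst x, i) \<noteq> 0" "snd x = i" "fst x \<le> m"
      by (auto simp: in_keys_iff)
    then show "x \<in> (if a \<le> m then {(a, i)} else {})" unfolding look by (cases x) auto
  next
    fix x assume "x \<in> (if a \<le> m then {(a, i)} else {})"
    then have "x = (a, i)" "a \<le> m" by (auto split: if_splits)
    then show "x \<in> {x \<in> Poly_Mapping.keys ?Y. snd x = i \<and> fst x \<le> m}" by (simp add: in_keys_iff look)
  qed
  then show ?thesis unfolding partial_exp_def by (simp add: look)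
qed

text \<open>The partial sums at i jump from 0 to 1 at the superscript a, so phi_i is 1 and n_f is a;
  the denominator has another index and does not interfere.\<close>

lemma mon_f_ratio:
  assumes "i \<noteq> 0" "i \<noteq> j"
  shows "mon_f n p i (cv a i - cv b j) = Some (cv a i - cv b j - A_mon n p a i)"
proof -
  note pe = partial_exp_ratio[OF assms, of a b]
  have "range (\<lambda>m. of_bool (a \<le> m)) = {0, 1 :: int}"
  proof (rule Set.set_eqI, rule iffI)
    fix x :: int assume "x \<in> {0, 1}"
    then show "x \<in> range (\<lambda>m. of_bool (a \<le> m))"
      by (elim insertE emptyE) (intro image_eqI[of _ _ "a - 1"], simp_all, intro image_eqI[of _ _ a], simp_all)
  qed auto
  then have phi: "mon_phi i (cv a i - cv b j) = 1"
    unfolding mon_phi_def pe[abs_def] by simp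
  have "(LEAST m. 1 = of_bool (a \<le> m)) = a"
    by (rule Least_equality) (simp_all split: if_splits)
  then show ?thesis unfolding mon_f_def phi pe by simp
qed

text \<open>Only neighbours of i contribute, the lower one at superscript a + 1 and the upper one at
  a. For i = n the Cartan entry -2 makes \<open>cv (a + 1) (n - 1)\<close> occur twice; for i = 1
  the missing neighbour is absorbed by \<open>cv (a + 1) 0 = 0\<close>.\<close>

lemma A_mon_p0:
  assumes "1 \<le> i" "i \<le> n" "2 \<le> n"
  shows "A_mon n p0 a i = cv a i + cv (a + 1) i -
    (if i = n then cv (a + 1) (n - 1) + cv (a + 1) (n - 1) else cv (a + 1) (i - 1) + cv a (Suc i))"
proof -
  define w :: int where "w = (if i = n then 2 else 1)"
  define g where "g = Poly_Mapping.single (a + 1, i - 1) (- w)"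
  define h where "h = Poly_Mapping.single (a, Suc i) (-1 :: int)"
  have "(\<Sum>j\<in>{1..n} - {i}. Poly_Mapping.single (a + p0 j i, j) (cartan n j i)) =
      (\<Sum>j\<in>{1..n} - {i}. (if j = i - 1 then g else 0) + (if j = Suc i then h else 0))"
  proof (rule sum.cong[OF refl])
    fix j assume "j \<in> {1..n} - {i}"
    then have j: "1 \<le> j" "j \<le> n" "j \<noteq> i" by auto
    consider "Suc j = i" | "j = Suc i" | "Suc j \<noteq> i" "j \<noteq> Suc i" by blast
    then show "Poly_Mapping.single (a + p0 j i, j) (cartan n j i) =
        (if j = i - 1 then g else 0) + (if j = Suc i then h else 0)"
    proof cases
      case 1
      then have "cartan n j i = - w" "p0 j i = 1" "j = i - 1" "j \<noteq> Suc i" using j assms by (auto simp: cartan_def p0_def w_def)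
      then show ?thesis by (simp add: g_def)
    next
      case 2
      then have "cartan n j i = - 1" "p0 j i = 0" "j \<noteq> i - 1" using j assms by (auto simp: cartan_def p0_def)
      then show ?thesis using 2 by (simp add: h_def)
    next
      case 3
      then have "cartan n j i = 0" "j \<noteq> i - 1" using j assms by (auto simp: cartan_def)
      then show ?thesis using 3 by simp
    qed
  qed
  also have "\<dots> = (if 2 \<le> i then g else 0) + (if i < n then h else 0)"
    using assms by (auto simp: sum.distrib)
  also have "(if 2 \<le> i then g else 0) = (if i = n then - cv (a + 1) (n - 1) - cv (a + 1) (n - 1) else - cv (a + 1) (i - 1))"
  proof -
    have two: "Poly_Mapping.single x (2 :: int) = Poly_Mapping.single x 1 + Poly_Mapping.single x 1" for x :: "int \<times> nat"
      by (simp flip: single_add)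
    show ?thesis using assms by (auto simp: g_def w_def cv_def single_uminus two)
  qed
  also have "(if i < n then h else 0) = (if i = n then 0 else - cv a (Suc i))"
    using assms by (auto simp: h_def cv_def single_uminus)
  finally show ?thesis using assms unfolding A_mon_def by (simp add: cvar_cv)
qed

lemma mon_eval_ratio:
  assumes "i \<noteq> j"
  shows "mon_eval c (cv a i - cv b j) = (if i = 0 then 1 else c a i) / (if j = 0 then 1 else c b j)"
proof -
  consider "i = 0" "j \<noteq> 0" | "j = 0" "i \<noteq> 0" | "i \<noteq> 0" "j \<noteq> 0" using assms by (cases "i = 0"; cases "j = 0") auto
  then show ?thesis
  proof cases
    case 1
    then show ?thesis by (simp add: mon_eval_def cv_def power_int_minus divide_inverse)
  next
    case 2
    then show ?thesis by (simp add: mon_eval_def cv_def)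
  next
    case 3
    let ?Y = "Poly_Mapping.single (a, i) (1 :: int) - Poly_Mapping.single (b, j) 1"
    have look: "Poly_Mapping.lookup ?Y x = of_bool (x = (a, i)) - of_bool (x = (b, j))" for x
      by (auto simp: lookup_minus lookup_single when_def)
    have "Poly_Mapping.keys ?Y = {(a, i), (b, j)}"
      using assms by (auto simp: in_keys_iff look)
    then show ?thesis
      using assms 3 by (simp add: mon_eval_def cv_def look power_int_minus divide_inverse)
  qed
qed

lemma embedding_step:
  assumes "crystal_embedding n (B_fund n 1) (mon_crystal n p0) \<psi>" "n \<ge> 1"
    and "x \<in> V ` {1..n} \<union> VB ` {1..n}" "i \<in> {1..n}" "letter_f n i x = Some y"
  shows "mon_f n p0 i (\<psi> [x]) = Some (\<psi> [y])"
proof -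
  have "[x] \<in> carrier (B_fund n 1)" using assms(2,3) unfolding carrier_B_fund_1[OF assms(2)] by blast
  then have "f_op (mon_crystal n p0) i (\<psi> [x]) = map_option \<psi> (f_op (B_fund n 1) i [x])"
    using assms(1,4) unfolding crystal_embedding_def by blast
  then show ?thesis
    using assms(5) one_letter_word(2)[of n i x] by (simp add: mon_crystal_def B_fund_def word_crystal_def del: word_f.simps)
qed

text \<open>Dividing by A_{k,j} cancels both variables of the old ratio and leaves a ratio with the
  same superscripts k and k + 1.\<close>

lemma embedding_V:
  assumes emb: "crystal_embedding n (B_fund n 1) (mon_crystal n p0) \<psi>" "n \<ge> 2" "\<psi> [V 1] = cv k 1"
    and "1 \<le> j" "j \<le> n"
  shows "\<psi> [V j] = cv k j - cv (k + 1) (j - 1)"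
  using assms(4,5)
proof (induction j rule: dec_induct)
  case base
  then show ?case using emb(3) by (simp add: cv_def)
next
  case (step j)
  then have IH: "\<psi> [V j] = cv k j - cv (k + 1) (j - 1)" by simp
  have "mon_f n p0 j (\<psi> [V j]) = Some (\<psi> [V (Suc j)])"
    using step.hyps step.prems emb by (intro embedding_step) auto
  moreover have "mon_f n p0 j (\<psi> [V j]) = Some (cv k j - cv (k + 1) (j - 1) - A_mon n p0 k j)"
    unfolding IH using step.hyps by (intro mon_f_ratio) auto
  ultimately have "\<psi> [V (Suc j)] = cv k j - cv (k + 1) (j - 1) - A_mon n p0 k j" by simp
  then show ?case using A_mon_p0[of j n k] step.hyps step.prems emb(2) by simp
qed

text \<open>Between barred letters each division raises the common superscript by 1. At the turn
  from v_n to vbar_n the square in A_{k,n} inverts the old denominator into the new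
  numerator.\<close>

lemma embedding_VB:
  assumes emb: "crystal_embedding n (B_fund n 1) (mon_crystal n p0) \<psi>" "n \<ge> 2" "\<psi> [V 1] = cv k 1"
    and "j \<le> n" "1 \<le> j"
  shows "\<psi> [VB j] = cv (k + int n - int j + 1) (j - 1) - cv (k + int n - int j + 1) j"
  using assms(4,5)
proof (induction j rule: inc_induct)
  case base
  have V: "\<psi> [V n] = cv k n - cv (k + 1) (n - 1)" using embedding_V[OF emb] base by simp
  have "mon_f n p0 n (\<psi> [V n]) = Some (\<psi> [VB n])"
    using base emb by (intro embedding_step) auto
  moreover have "mon_f n p0 n (\<psi> [V n]) = Some (cv k n - cv (k + 1) (n - 1) - A_mon n p0 k n)"
    unfolding V using emb(2) by (intro mon_f_ratio) auto
  ultimately have "\<psi> [VB n] = cv k n - cv (k + 1) (n - 1) - A_mon n p0 k n" by simp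
  then show ?case using A_mon_p0[of n n k] emb(2) by simp
next
  case (step j)
  define a where "a = k + int n - int j"
  have a: "k + int n - int (Suc j) + 1 = a" "k + int n - int j + 1 = a + 1" by (simp_all add: a_def)
  have IH: "\<psi> [VB (Suc j)] = cv a j - cv a (Suc j)" using step.IH unfolding a by simp
  have "mon_f n p0 j (\<psi> [VB (Suc j)]) = Some (\<psi> [VB j])"
    using step.hyps step.prems emb by (intro embedding_step) auto
  moreover have "mon_f n p0 j (\<psi> [VB (Suc j)]) = Some (cv a j - cv a (Suc j) - A_mon n p0 a j)"
    unfolding IH using step.prems by (intro mon_f_ratio) auto
  ultimately have "\<psi> [VB j] = cv a j - cv a (Suc j) - A_mon n p0 a j" by simp
  then show ?case unfolding a using A_mon_p0[of j n a] step.hyps step.prems emb(2) by simp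
qed

lemma mon_eval_V:
  assumes "crystal_embedding n (B_fund n 1) (mon_crystal n p0) \<psi>" "n \<ge> 2" "\<psi> [V 1] = cv k 1" "j \<in> {1..n}"
  shows "mon_eval c (\<psi> [V j]) = c k j / (if j - 1 = 0 then 1 else c (k + 1) (j - 1))"
proof -
  have j: "1 \<le> j" "j \<le> n" "j \<noteq> j - 1" "j \<noteq> 0" using assms(4) by auto
  show ?thesis unfolding embedding_V[OF assms(1-3) j(1,2)] mon_eval_ratio[OF j(3)] using j(4) by (simp only: if_False)
qed

lemma mon_eval_VB:
  assumes "crystal_embedding n (B_fund n 1) (mon_crystal n p0) \<psi>" "n \<ge> 2" "\<psi> [V 1] = cv k 1" "j \<in> {1..n}"
  shows "mon_eval c (\<psi> [VB j]) =
    (if j - 1 = 0 then 1 else c (k + int n - int j + 1) (j - 1)) / c (k + int n - int j + 1) j"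
proof -
  have j: "1 \<le> j" "j \<le> n" "j - 1 \<noteq> j" "j \<noteq> 0" using assms(4) by auto
  show ?thesis unfolding embedding_VB[OF assms(1-3) j(2,1)] mon_eval_ratio[OF j(3)] using j(4) by (simp only: if_False)
qed

section \<open>Evaluation of the minors\<close>

lemma det_lower_last:
  fixes A :: "complex mat"
  assumes A: "A \<in> carrier_mat k k" and k: "1 \<le> k"
    and tri: "\<And>i j. i < j \<Longrightarrow> j < k \<Longrightarrow> A $$ (i, j) = 0"
    and diag: "\<And>i. i < k - 1 \<Longrightarrow> A $$ (i, i) = 1"
  shows "det A = A $$ (k - 1, k - 1)"
proof -
  have "det A = prod_list (diag_mat A)" using tri A by (rule det_lower_triangular)
  also have "diag_mat A = map (\<lambda>i. if i = k - 1 then A $$ (k - 1, k - 1) else 1) [0..<k]"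
    using A diag unfolding diag_mat_def by (intro map_cong) auto
  also have "prod_list \<dots> = (\<Prod>i<k. if i = k - 1 then A $$ (k - 1, k - 1) else 1)"
    by (simp add: prod.list_conv_set_nth atLeast0LessThan)
  also have "\<dots> = A $$ (k - 1, k - 1)" using k by simp
  finally show ?thesis .
qed

lemma det_upper_last:
  fixes A :: "complex mat"
  assumes A: "A \<in> carrier_mat k k" and k: "1 \<le> k"
    and tri: "\<And>i j. i < j \<Longrightarrow> j < k \<Longrightarrow> A $$ (j, i) = 0"
    and diag: "\<And>i. i < k - 1 \<Longrightarrow> A $$ (i, i) = 1"
  shows "det A = A $$ (k - 1, k - 1)"
proof -
  have "det A = det A\<^sup>T" by (rule det_transpose[OF A, symmetric])
  also have "\<dots> = A\<^sup>T $$ (k - 1, k - 1)" using A k tri diag by (intro det_lower_last[of _ k]) simp_all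
  finally show ?thesis using A k by simp
qed

lemma sum_unitriangular_row:
  fixes x :: "nat \<Rightarrow> complex"
  assumes "p < k"
  shows "(\<Sum>i<k. (if i = p then 1 else if i < p then u i else 0) * x i) = x p + (\<Sum>i<p. u i * x i)"
proof -
  have "(\<Sum>i<k. (if i = p then 1 else if i < p then u i else 0) * x i) =
      (\<Sum>i<k. (if i = p then x p else 0) + (if i < p then u i * x i else 0))"
    by (intro sum.cong) auto
  also have "\<dots> = x p + (\<Sum>i<k. if i < p then u i * x i else 0)"
    using assms by (simp add: sum.distrib)
  also have "(\<Sum>i<k. if i < p then u i * x i else 0) = (\<Sum>i<p. u i * x i)"
    using assms by (intro sum.mono_neutral_cong_right) auto
  finally show ?thesis .
qed

lemma mat_mult_index_sum:
  fixes A B :: "complex mat"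
  assumes "A \<in> carrier_mat k l" "B \<in> carrier_mat l m" "p < k" "q < m"
  shows "(A * B) $$ (p, q) = (\<Sum>i<l. A $$ (p, i) * B $$ (i, q))"
  using assms by (simp add: scalar_prod_def atLeast0LessThan)

lemma Theta_rows:
  assumes nz: "\<forall>k \<in> {1..int n}. \<forall>i \<in> {1..n}. c k i \<noteq> 0" and n: "n \<ge> 1"
  obtains u where
    "\<And>p q. p < n \<Longrightarrow> q < 2 * n \<Longrightarrow> (-1) ^ p * Theta n c $$ (2 * n - Suc p, q) =
      Theta_tail n c (Suc p) $$ (2 * n - 1, q) + (\<Sum>i<p. u p i * Theta_tail n c (Suc i) $$ (2 * n - 1, q))"
    "\<And>p. 1 \<le> p \<Longrightarrow> p < n \<Longrightarrow>
      u p (p - 1) = - (\<Sum>l = 1..p. cpad c (Suc p - l) (l - 1) / cpad c (Suc p - l) l)"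
proof -
  have "\<forall>p \<in> {..<n}. \<exists>u. (\<forall>q<2 * n. (-1) ^ p * Theta_tail n c 1 $$ (2 * n - Suc p, q) =
      Theta_tail n c (1 + p) $$ (2 * n - 1, q) + (\<Sum>i<p. u i * Theta_tail n c (1 + i) $$ (2 * n - 1, q))) \<and>
    (1 \<le> p \<longrightarrow> u (p - 1) = - (\<Sum>l = 1..p. cpad c (1 + p - l) (l - 1) / cpad c (1 + p - l) l))"
    using row_expansion[OF nz n, of 1] by simp
  from bchoice[OF this] obtain u where u: "\<forall>p \<in> {..<n}. (\<forall>q<2 * n. (-1) ^ p * Theta_tail n c 1 $$ (2 * n - Suc p, q) =
      Theta_tail n c (1 + p) $$ (2 * n - 1, q) + (\<Sum>i<p. u p i * Theta_tail n c (1 + i) $$ (2 * n - 1, q))) \<and>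
    (1 \<le> p \<longrightarrow> u p (p - 1) = - (\<Sum>l = 1..p. cpad c (1 + p - l) (l - 1) / cpad c (1 + p - l) l))" by blast
  show ?thesis
  proof (rule that[of u])
    show "(-1) ^ p * Theta n c $$ (2 * n - Suc p, q) =
      Theta_tail n c (Suc p) $$ (2 * n - 1, q) + (\<Sum>i<p. u p i * Theta_tail n c (Suc i) $$ (2 * n - 1, q))"
      if "p < n" "q < 2 * n" for p q
      unfolding Theta_eq_tail using u that by simp
    show "u p (p - 1) = - (\<Sum>l = 1..p. cpad c (Suc p - l) (l - 1) / cpad c (Suc p - l) l)"
      if "1 \<le> p" "p < n" for p
      using u that by simp
  qed
qed

text \<open>The lower unitriangular factor has determinant 1. Exchanging the last column leaves the
  other factor upper triangular with diagonal 1 except in its last place, where an entry of the row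
  Q_{1,k} appears.\<close>

lemma det_first:
  assumes nz: "\<forall>k \<in> {1..int n}. \<forall>i \<in> {1..n}. c k i \<noteq> 0" and k: "1 \<le> k" "k \<le> n"
  shows "det (mat k k (\<lambda>(p, q). (-1) ^ p * Theta n c $$ (2 * n - Suc p, if q = k - 1 then k else q))) =
    Theta_tail n c k $$ (2 * n - 1, k)"
proof -
  have n: "n \<ge> 1" using k by simp
  define f where "f = (\<lambda>q. if q = k - 1 then k else q)"
  have f: "f q < 2 * n" if "q < k" for q using that k by (auto simp: f_def)
  obtain u where u: "\<And>p q. p < n \<Longrightarrow> q < 2 * n \<Longrightarrow> (-1) ^ p * Theta n c $$ (2 * n - Suc p, q) =
      Theta_tail n c (Suc p) $$ (2 * n - 1, q) + (\<Sum>i<p. u p i * Theta_tail n c (Suc i) $$ (2 * n - 1, q))"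
    by (rule Theta_rows[OF nz n]) blast
  define A where "A = mat k k (\<lambda>(p, i). if i = p then 1 else if i < p then u p i else 0)"
  define N where "N = mat k k (\<lambda>(i, q). Theta_tail n c (Suc i) $$ (2 * n - 1, f q))"
  have AN: "A \<in> carrier_mat k k" "N \<in> carrier_mat k k" by (simp_all add: A_def N_def)
  have "mat k k (\<lambda>(p, q). (-1) ^ p * Theta n c $$ (2 * n - Suc p, f q)) = A * N"
  proof (rule eq_matI)
    fix p q assume "p < dim_row (A * N)" "q < dim_col (A * N)"
    then have pq: "p < k" "q < k" using AN by simp_all
    have "(A * N) $$ (p, q) = (\<Sum>i<k. (if i = p then 1 else if i < p then u p i else 0) * Theta_tail n c (Suc i) $$ (2 * n - 1, f q))"
      unfolding mat_mult_index_sum[OF AN pq] using pq by (intro sum.cong) (simp_all add: A_def N_def)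
    also have "\<dots> = (-1) ^ p * Theta n c $$ (2 * n - Suc p, f q)"
      unfolding sum_unitriangular_row[OF pq(1)] using u[of p "f q"] f[OF pq(2)] pq(1) k by simp
    finally show "mat k k (\<lambda>(p, q). (-1) ^ p * Theta n c $$ (2 * n - Suc p, f q)) $$ (p, q) = (A * N) $$ (p, q)"
      using pq by simp
  qed (use AN in simp_all)
  then have "det (mat k k (\<lambda>(p, q). (-1) ^ p * Theta n c $$ (2 * n - Suc p, f q))) = det A * det N"
    using det_mult[OF AN] by simp
  also have "det A = 1"
    using AN(1) by (intro det_lower_uni[of k]) (simp_all add: lower_uni_def A_def)
  also have "det N = N $$ (k - 1, k - 1)"
  proof (rule det_upper_last[OF AN(2) k(1)])
    fix i j assume ij: "i < j" "j < k"
    then have "Theta_tail n c (Suc j) $$ (2 * n - 1, i) = 0"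
      using last_row(1)[OF nz n, of "Suc j" i] k by simp
    then show "N $$ (j, i) = 0" using ij by (simp add: N_def f_def)
  next
    fix i assume i: "i < k - 1"
    then have "Theta_tail n c (Suc i) $$ (2 * n - 1, i) = 1"
      using last_row(2)[OF nz n, of "Suc i"] k by simp
    then show "N $$ (i, i) = 1" using i by (simp add: N_def f_def)
  qed
  also have "N $$ (k - 1, k - 1) = Theta_tail n c k $$ (2 * n - 1, k)" using k by (simp add: N_def f_def)
  finally show ?thesis by (simp add: f_def)
qed

text \<open>Now the last row is exchanged. The factor of rows Q_{1,i} keeps determinant 1, and the
  last diagonal entry of the lower factor is the subdiagonal coefficient of the expansion of row
  vbar_{k+1}.\<close>

lemma det_second:
  assumes nz: "\<forall>k \<in> {1..int n}. \<forall>i \<in> {1..n}. c k i \<noteq> 0" and k: "1 \<le> k" "k < n"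
  shows "det (mat k k (\<lambda>(p, q). (-1) ^ p * Theta n c $$ (2 * n - Suc (if p = k - 1 then k else p), q))) =
    (\<Sum>l = 1..k. cpad c (Suc k - l) (l - 1) / cpad c (Suc k - l) l)"
proof -
  have n: "n \<ge> 1" using k by simp
  obtain u where u: "\<And>p q. p < n \<Longrightarrow> q < 2 * n \<Longrightarrow> (-1) ^ p * Theta n c $$ (2 * n - Suc p, q) =
      Theta_tail n c (Suc p) $$ (2 * n - 1, q) + (\<Sum>i<p. u p i * Theta_tail n c (Suc i) $$ (2 * n - 1, q))"
    "\<And>p. 1 \<le> p \<Longrightarrow> p < n \<Longrightarrow>
      u p (p - 1) = - (\<Sum>l = 1..p. cpad c (Suc p - l) (l - 1) / cpad c (Suc p - l) l)"
    by (rule Theta_rows[OF nz n]) blast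
  define A where "A = mat k k (\<lambda>(p, i). if p = k - 1 then - u k i else if i = p then 1 else if i < p then u p i else 0)"
  define N where "N = mat k k (\<lambda>(i, q). Theta_tail n c (Suc i) $$ (2 * n - 1, q))"
  let ?D = "mat k k (\<lambda>(p, q). (-1) ^ p * Theta n c $$ (2 * n - Suc (if p = k - 1 then k else p), q))"
  have AN: "A \<in> carrier_mat k k" "N \<in> carrier_mat k k" by (simp_all add: A_def N_def)
  have "?D = A * N"
  proof (rule eq_matI)
    fix p q assume "p < dim_row (A * N)" "q < dim_col (A * N)"
    then have pq: "p < k" "q < k" "q < 2 * n" using AN k by simp_all
    show "?D $$ (p, q) = (A * N) $$ (p, q)"
    proof (cases "p = k - 1")
      case False
      have "(A * N) $$ (p, q) = (\<Sum>i<k. (if i = p then 1 else if i < p then u p i else 0) * Theta_tail n c (Suc i) $$ (2 * n - 1, q))"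
        unfolding mat_mult_index_sum[OF AN pq(1,2)] using pq False by (intro sum.cong) (simp_all add: A_def N_def)
      also have "\<dots> = (-1) ^ p * Theta n c $$ (2 * n - Suc p, q)"
        unfolding sum_unitriangular_row[OF pq(1)] using u(1)[of p q] pq k by simp
      finally show ?thesis using pq False by simp
    next
      case True
      \<comment> \<open>The leading term Q_{1,k+1} of that expansion vanishes in the first k
        columns, so k rows suffice.\<close>
      have "Theta_tail n c (Suc k) $$ (2 * n - 1, q) = 0"
        using last_row(1)[OF nz n, of "Suc k" q] k pq by simp
      then have *: "(-1) ^ k * Theta n c $$ (2 * n - Suc k, q) =
          (\<Sum>i<k. u k i * Theta_tail n c (Suc i) $$ (2 * n - 1, q))"
        using u(1)[of k q] pq k by simp
      have "(A * N) $$ (p, q) = (\<Sum>i<k. - (u k i * Theta_tail n c (Suc i) $$ (2 * n - 1, q)))"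
        unfolding mat_mult_index_sum[OF AN pq(1,2)] using pq True by (intro sum.cong) (simp_all add: A_def N_def)
      also have "\<dots> = - ((-1) ^ k * Theta n c $$ (2 * n - Suc k, q))" unfolding * by (rule sum_negf)
      \<comment> \<open>The exchanged row stands in place k - 1 but carries the sign of row k; this
        explains the minus in the last row of A.\<close>
      also have "- ((-1) ^ k) = (-1 :: complex) ^ p" using True k(1) by (cases k) simp_all
      then have "- ((-1) ^ k * Theta n c $$ (2 * n - Suc k, q)) = (-1) ^ p * Theta n c $$ (2 * n - Suc k, q)"
        by (metis mult_minus_left)
      finally show ?thesis using pq True by simp
    qed
  qed (use AN in simp_all)
  then have "det ?D = det A * det N" using det_mult[OF AN] by simp
  also have "det A = A $$ (k - 1, k - 1)"
    using k by (intro det_lower_last[OF AN(1) k(1)]) (simp_all add: A_def)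
  also have "A $$ (k - 1, k - 1) = (\<Sum>l = 1..k. cpad c (Suc k - l) (l - 1) / cpad c (Suc k - l) l)"
    using u(2)[OF k] k(1) by (simp add: A_def)
  also have "det N = 1"
  proof -
    have one: "N $$ (i, i) = 1" if "i < k" for i
      using last_row(2)[OF nz n, of "Suc i"] k that by (simp add: N_def)
    have "det N = N $$ (k - 1, k - 1)"
    proof (rule det_upper_last[OF AN(2) k(1)])
      fix i j assume ij: "i < j" "j < k"
      then show "N $$ (j, i) = 0" using last_row(1)[OF nz n, of "Suc j" i] k by (simp add: N_def)
    qed (simp add: one)
    then show ?thesis using one[of "k - 1"] k by simp
  qed
  finally show ?thesis by simp
qed

text \<open>Multiplication by the transposed lift on the left and by a lift on the right selects
  rows and columns, each with the inversion sign of its position.\<close>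

lemma gen_minor_word:
  assumes ws: "us \<in> lists {1..n}" "vs \<in> lists {1..n}" and g: "g \<in> elem_group n" and k: "k \<le> n"
  defines "s \<equiv> \<lambda>ws q. (-1 :: complex) ^ card {r. r < q \<and> perm_word n ws q < perm_word n ws r}"
  shows "gen_minor n k (word_refl n us) (word_refl n vs) g =
    det (mat k k (\<lambda>(p, q). s us p * s vs q * g $$ (perm_word n us p, perm_word n vs q)))"
proof -
  let ?W = "weyl_lift n (word_refl n us)" and ?V = "weyl_lift n (word_refl n vs)"
  have e: "?W \<in> elem_group n" "?V \<in> elem_group n" by (intro weyl_lift_elem_group ws)+
  note c = elem_group_carrier[OF e(1)] elem_group_carrier[OF e(2)] elem_group_carrier[OF g]
  have "gen_minor n k (word_refl n us) (word_refl n vs) g = lead_minor k (?W\<^sup>T * g * ?V)"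
    unfolding gen_minor_def inv_weyl_lift[OF ws(1)]
    by (intro princ_minor_eq elem_group_mult elem_group_transpose e g k)
  also have "\<dots> = det (mat k k (\<lambda>(p, q). s us p * s vs q * g $$ (perm_word n us p, perm_word n vs q)))"
    unfolding lead_minor_def
  proof (rule arg_cong[of _ _ det], rule eq_matI)
    fix p q assume "p < dim_row (mat k k (\<lambda>(p, q). s us p * s vs q * g $$ (perm_word n us p, perm_word n vs q)))"
      "q < dim_col (mat k k (\<lambda>(p, q). s us p * s vs q * g $$ (perm_word n us p, perm_word n vs q)))"
    then have pq: "p < k" "q < k" "p < 2 * n" "q < 2 * n" using k by simp_all
    have lt: "perm_word n us p < 2 * n" "perm_word n vs q < 2 * n"
      using signed_perm_lt[OF signed_perm_word[OF ws(1)] pq(3)] signed_perm_lt[OF signed_perm_word[OF ws(2)] pq(4)] by simp_all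
    have Wg: "(?W\<^sup>T * g) $$ (p, r) = s us p * g $$ (perm_word n us p, r)" if r: "r < 2 * n" for r
    proof -
      have "(?W\<^sup>T * g) $$ (p, r) = (\<Sum>i<2 * n. ?W\<^sup>T $$ (p, i) * g $$ (i, r))"
        using c pq r by (intro mat_mult_index_sum[of _ "2 * n" "2 * n" _ "2 * n"]) simp_all
      also have "\<dots> = (\<Sum>i<2 * n. if i = perm_word n us p then s us p * g $$ (perm_word n us p, r) else 0)"
        using c pq weyl_lift_index[OF ws(1) _ pq(3)] by (intro sum.cong) (auto simp: s_def)
      finally show ?thesis using lt by simp
    qed
    have "(?W\<^sup>T * g * ?V) $$ (p, q) = (\<Sum>i<2 * n. (?W\<^sup>T * g) $$ (p, i) * ?V $$ (i, q))"
      using c pq by (intro mat_mult_index_sum[of _ "2 * n" "2 * n" _ "2 * n"]) simp_all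
    also have "\<dots> = (\<Sum>i<2 * n. if i = perm_word n vs q then s us p * s vs q * g $$ (perm_word n us p, perm_word n vs q) else 0)"
      using weyl_lift_index[OF ws(2) _ pq(4)] Wg by (intro sum.cong) (auto simp: s_def)
    also have "\<dots> = s us p * s vs q * g $$ (perm_word n us p, perm_word n vs q)" using lt by simp
    finally show "mat k k (\<lambda>(p, q). (?W\<^sup>T * g * ?V) $$ (p, q)) $$ (p, q) =
      mat k k (\<lambda>(p, q). s us p * s vs q * g $$ (perm_word n us p, perm_word n vs q)) $$ (p, q)"
      using pq by simp
  qed simp_all
  finally show ?thesis .
qed

lemma sw_below: 
  assumes "1 \<le> k" "k \<le> n" "q < k"
  shows "sw n k q = (if q = k - 1 then k else q)"
proof (cases "q = k - 1")
  case False
  then have "q \<noteq> k" "q \<noteq> 2 * n - k - 1" "q \<noteq> 2 * n - k" using assms by linarith+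
  then show ?thesis using False by (simp add: sw_def)
qed (simp add: sw_def)

lemma word_refl_append: "word_refl n (us @ ws) = word_refl n us \<circ> word_refl n ws"
  by (induction us) (simp_all add: o_assoc)

text \<open>Under w_0 every earlier position is an inversion, so row p gets the sign (-1)^p required
  by \<open>det_first\<close>. On the first k positions s_k is increasing, since its only inversion
  there would need position k; the columns get no sign.\<close>

lemma gen_minor_longest_srefl:
  assumes nz: "\<forall>k \<in> {1..int n}. \<forall>i \<in> {1..n}. c k i \<noteq> 0" and k: "1 \<le> k" "k \<le> n"
  shows "gen_minor n k (longest n) (srefl n k) (Theta n c) = Theta_tail n c k $$ (2 * n - 1, k)"
proof -
  obtain ws where ws: "ws \<in> lists {1..n}" "perm_word n ws = mirror_perm n" "longest n = word_refl n ws"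
    by (rule longest_word)
  have s: "srefl n k = word_refl n [k]" by simp
  have ks: "[k] \<in> lists {1..n}" using k by simp
  have pk: "perm_word n [k] = sw n k" by simp
  show ?thesis
    unfolding ws(3) s gen_minor_word[OF ws(1) ks Theta_elem_group[OF nz] k(2)] det_first[OF nz k, symmetric]
  proof (rule arg_cong[of _ _ det], rule eq_matI, goal_cases)
    case (1 p q)
    then have pq: "p < k" "q < k" by simp_all
    have e: "mirror_perm n p = 2 * n - Suc p" using pq k by (simp add: mirror_perm_def)
    have "{r. r < p \<and> mirror_perm n p < mirror_perm n r} = {..<p}"
      using pq k by (auto simp: mirror_perm_def)
    then have c1: "card {r. r < p \<and> mirror_perm n p < mirror_perm n r} = p" by simp
    have "{r. r < q \<and> sw n k q < sw n k r} = {}"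
      using pq sw_below[OF k] by auto
    then have c2: "card {r. r < q \<and> sw n k q < sw n k r} = 0" by (simp only: card.empty)
    show ?case
      unfolding ws(2) pk index_mat(1)[OF pq] prod.case c1 c2 unfolding e sw_below[OF k pq(2)] by simp
  qed simp_all
qed

text \<open>s_k is increasing on the first k positions, so w_0 s_k is still decreasing there and the
  signs are again (-1)^p; only the last selected row differs.\<close>

lemma gen_minor_longest_srefl':
  assumes nz: "\<forall>k \<in> {1..int n}. \<forall>i \<in> {1..n}. c k i \<noteq> 0" and k: "1 \<le> k" "k < n"
  shows "gen_minor n k (longest n \<circ> srefl n k) id (Theta n c) =
    (\<Sum>l = 1..k. cpad c (Suc k - l) (l - 1) / cpad c (Suc k - l) l)"
proof -
  obtain ws where ws: "ws \<in> lists {1..n}" "perm_word n ws = mirror_perm n" "longest n = word_refl n ws"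
    by (rule longest_word)
  have k': "k \<le> n" using k by simp
  have s: "longest n \<circ> srefl n k = word_refl n (ws @ [k])" "id = word_refl n []"
    unfolding ws(3) word_refl_append by simp_all
  have ks: "ws @ [k] \<in> lists {1..n}" "[] \<in> lists {1..n}" using k ws(1) by simp_all
  have pk: "perm_word n (ws @ [k]) q = mirror_perm n (sw n k q)" "perm_word n [] q = q" for q
    unfolding perm_word_append ws(2) by simp_all
  show ?thesis
    unfolding s gen_minor_word[OF ks Theta_elem_group[OF nz] k'] det_second[OF nz k, symmetric]
  proof (rule arg_cong[of _ _ det], rule eq_matI, goal_cases)
    case (1 p q)
    then have pq: "p < k" "q < k" by simp_all
    let ?f = "\<lambda>p. if p = k - 1 then k else p"
    have mf: "mirror_perm n (sw n k r) = 2 * n - Suc (?f r)" if "r < k" for r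
      unfolding sw_below[OF k(1) k' that] using that k by (simp add: mirror_perm_def)
    have "{r. r < p \<and> mirror_perm n (sw n k p) < mirror_perm n (sw n k r)} = {..<p}"
    proof (rule Set.set_eqI)
      fix r
      have "mirror_perm n (sw n k p) < mirror_perm n (sw n k r)" if r: "r < p"
      proof -
        have "?f r < ?f p" "?f p \<le> k" using r pq by auto
        then show ?thesis using mf[of r] mf[of p] r pq k by linarith
      qed
      then show "r \<in> {r. r < p \<and> mirror_perm n (sw n k p) < mirror_perm n (sw n k r)} \<longleftrightarrow> r \<in> {..<p}" by auto
    qed
    then have c1: "card {r. r < p \<and> mirror_perm n (sw n k p) < mirror_perm n (sw n k r)} = p" by simp
    have "{r. r < q \<and> q < r} = {}" by auto
    then have c2: "card {r. r < q \<and> q < r} = 0" by (simp only: card.empty)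
    show ?case
      unfolding pk index_mat(1)[OF pq] prod.case c1 c2 unfolding mf[OF pq(1)] by simp
  qed simp_all
qed

theorem theorem7p13:
  fixes n :: nat
    and c :: "int \<Rightarrow> nat \<Rightarrow> complex"
    and m :: "int \<Rightarrow> nat \<Rightarrow> letter list \<Rightarrow> monomial"
  assumes "n \<ge> 2"
    and "\<forall>k \<in> {1..int n}. \<forall>i \<in> {1..n}. c k i \<noteq> 0"
    and "\<forall>k. \<forall>i \<in> {1..n}. crystal_embedding n (B_fund n i) (mon_crystal n p0) (m k i) \<and>
           m k i (hw i) = cvar k i"
  shows "gen_minor n n (longest n) (srefl n n) (Theta n c) = mon_eval c (m (int n) n (hw n)) \<and>
         mon_eval c (m (int n) n (hw n)) = c (int n) n \<and>
         (\<forall>k \<in> {1..n - 1}.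
            gen_minor n k (longest n) (srefl n k) (Theta n c) =
              (\<Sum>j = 1..n. mon_eval c (m (int k) 1 (v_el j))) +
              (\<Sum>j = k + 1..n. mon_eval c (m (int k) 1 (vbar_el j))) \<and>
            gen_minor n k (longest n \<circ> srefl n k) id (Theta n c) =
              (\<Sum>j = 1..k. mon_eval c (m (int k - int n) 1 (vbar_el j))))"
proof -
  have n: "n \<ge> 1" using assms(1) by simp
  have emb: "crystal_embedding n (B_fund n 1) (mon_crystal n p0) (m k 1)" "m k 1 [V 1] = cv k 1" for k
  proof -
    have one: "(1 :: nat) \<in> {1..n}" "hw 1 = [V 1]" using n by (simp_all add: hw_def)
    have "crystal_embedding n (B_fund n 1) (mon_crystal n p0) (m k 1) \<and> m k 1 (hw 1) = cvar k 1"
      using assms(3) one(1) by blast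
    then show "crystal_embedding n (B_fund n 1) (mon_crystal n p0) (m k 1)" "m k 1 [V 1] = cv k 1"
      unfolding one(2) by (simp_all add: cvar_cv)
  qed
  note V = mon_eval_V[OF emb(1) assms(1) emb(2)] and VB = mon_eval_VB[OF emb(1) assms(1) emb(2)]
  \<comment> \<open>\<open>cv 0 0\<close> is 0; it brings the single variable into the ratio form
    evaluated by \<open>mon_eval_ratio\<close>.\<close>
  have "m (int n) n (hw n) = cv (int n) n - cv 0 0"
    using assms(1,3) by (simp add: cvar_def cv_def)
  then have top: "mon_eval c (m (int n) n (hw n)) = c (int n) n"
    using mon_eval_ratio[of n 0 c "int n" 0] n by simp
  have "gen_minor n n (longest n) (srefl n n) (Theta n c) = c (int n) n"
    using gen_minor_longest_srefl[OF assms(2) n order_refl] last_row(4)[OF assms(2) n n order_refl refl] n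
    by (simp add: cpad_def)
  moreover have "gen_minor n k (longest n) (srefl n k) (Theta n c) =
      (\<Sum>j = 1..n. mon_eval c (m (int k) 1 (v_el j))) +
      (\<Sum>j = k + 1..n. mon_eval c (m (int k) 1 (vbar_el j)))"
    and "gen_minor n k (longest n \<circ> srefl n k) id (Theta n c) =
      (\<Sum>j = 1..k. mon_eval c (m (int k - int n) 1 (vbar_el j)))" if "k \<in> {1..n - 1}" for k
  proof -
    have k: "1 \<le> k" "k < n" "k \<le> n" using that assms(1) by auto
    have "gen_minor n k (longest n) (srefl n k) (Theta n c) =
        (\<Sum>j = 1..n. cpad c k j / cpad c (Suc k) (j - 1)) +
        (\<Sum>j = Suc k..n. cpad c (k + n - j + 1) (j - 1) / cpad c (k + n - j + 1) j)"
      unfolding gen_minor_longest_srefl[OF assms(2) k(1,3)] by (rule last_row(3)[OF assms(2) n k(1,3,2)])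
    also have "(\<Sum>j = 1..n. cpad c k j / cpad c (Suc k) (j - 1)) = (\<Sum>j = 1..n. mon_eval c (m (int k) 1 (v_el j)))"
    proof (rule sum.cong[OF refl])
      fix j assume j: "j \<in> {1..n}"
      have "int (Suc k) = int k + 1" "j \<noteq> 0" using j by simp_all
      then show "cpad c k j / cpad c (Suc k) (j - 1) = mon_eval c (m (int k) 1 (v_el j))"
        unfolding V[OF j] cpad_def by (simp only: if_False)
    qed
    also have "(\<Sum>j = Suc k..n. cpad c (k + n - j + 1) (j - 1) / cpad c (k + n - j + 1) j) =
        (\<Sum>j = k + 1..n. mon_eval c (m (int k) 1 (vbar_el j)))"
    proof (rule sum.cong)
      fix j assume "j \<in> {k + 1..n}"
      then have j: "j \<in> {1..n}" "j \<noteq> 0" "int (k + n - j + 1) = int k + int n - int j + 1" by auto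
      show "cpad c (k + n - j + 1) (j - 1) / cpad c (k + n - j + 1) j = mon_eval c (m (int k) 1 (vbar_el j))"
        unfolding VB[OF j(1)] cpad_def j(3) using j(2) by (simp only: if_False)
    qed simp
    finally show "gen_minor n k (longest n) (srefl n k) (Theta n c) =
      (\<Sum>j = 1..n. mon_eval c (m (int k) 1 (v_el j))) +
      (\<Sum>j = k + 1..n. mon_eval c (m (int k) 1 (vbar_el j)))" .
    have "gen_minor n k (longest n \<circ> srefl n k) id (Theta n c) =
        (\<Sum>j = 1..k. cpad c (Suc k - j) (j - 1) / cpad c (Suc k - j) j)"
      by (rule gen_minor_longest_srefl'[OF assms(2) k(1,2)])
    also have "\<dots> = (\<Sum>j = 1..k. mon_eval c (m (int k - int n) 1 (vbar_el j)))"
    proof (rule sum.cong[OF refl])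
      fix j assume "j \<in> {1..k}"
      \<comment> \<open>Starting from superscript k - n, the letter vbar_j sits at (k - n) + n - j +
        1 = k - j + 1. Only superscripts from 1 to k occur, and \<open>j \<le> k\<close> makes the
        subtraction of naturals exact.\<close>
      then have j: "j \<in> {1..n}" "j \<noteq> 0" "int (Suc k - j) = int k - int n + int n - int j + 1" using k by auto
      show "cpad c (Suc k - j) (j - 1) / cpad c (Suc k - j) j = mon_eval c (m (int k - int n) 1 (vbar_el j))"
        unfolding VB[OF j(1)] cpad_def j(3) using j(2) by (simp only: if_False)
    qed
    finally show "gen_minor n k (longest n \<circ> srefl n k) id (Theta n c) =
      (\<Sum>j = 1..k. mon_eval c (m (int k - int n) 1 (vbar_el j)))" .
  qed
  ultimately show ?thesis using top by simp
qed

end
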